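(* Let $\mathbf{k}$ be an algebraically closed field and let $d\ge2$ be an integer. Let $\mathrm{Bir}_d$ be the space of birational maps of $\mathbb{P}^2(\mathbf{k})$ of degree $d$. Then for every $\lambda<d$, the set $$U_\lambda=\{f\in\mathrm{Bir}_d\mid\lambda_1(f)>\lambda\}$$ is a Zariski dense open subset of $\mathrm{Bir}_d$. In particular, for a general birational map $f$ of degree $d>1$, we have $\lambda_1(f)>1$.
   Context: The degree of a birational map $f$ of $\mathbb{P}^2$ is the common degree of homogeneous polynomials $f_0,f_1,f_2$ without common factor such that $f=[f_0,f_1,f_2]$. The set $\mathrm{Bir}_d$ has a natural quasi-projective algebraic structure, as a subset of the projective space of triples of homogeneous polynomials of degree $d$ in three variables up to a common scalar; it carries the Zariski topology. The first dynamical degree is $\lambda_1(f)=\lim_{n\to\infty}\deg(f^n)^{1/n}\ge1$. "General" means: for all $f$ in some dense Zariski open subset of $\mathrm{Bir}_d$. *)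

theory Defs
  imports
    "HOL-Analysis.Analysis"
    "HOL-Computational_Algebra.Polynomial"
    "HOL-Library.Poly_Mapping"
    "HOL-Library.Numeral_Type"
begin

section \<open>Multivariate polynomials\<close>

text \<open>The polynomial ring over \<open>'a\<close> in variables indexed by \<open>'v\<close> is \<open>('v \<Rightarrow>\<^sub>0 nat) \<Rightarrow>\<^sub>0 'a\<close>.\<close>

type_synonym ('v, 'a) mpoly = "('v \<Rightarrow>\<^sub>0 nat) \<Rightarrow>\<^sub>0 'a"

definition monom_degree :: "('v \<Rightarrow>\<^sub>0 nat) \<Rightarrow> nat" where
  "monom_degree m = (\<Sum>v\<in>Poly_Mapping.keys m. Poly_Mapping.lookup m v)"

definition homogeneous :: "nat \<Rightarrow> ('v, 'a::zero) mpoly \<Rightarrow> bool" where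
  "homogeneous e p \<longleftrightarrow> (\<forall>m\<in>Poly_Mapping.keys p. monom_degree m = e)"

definition const :: "'a::zero \<Rightarrow> ('v, 'a) mpoly" where
  "const c = Poly_Mapping.single 0 c"

definition var :: "'v \<Rightarrow> ('v, 'a::zero_neq_one) mpoly" where
  "var v = Poly_Mapping.single (Poly_Mapping.single v 1) 1"

text \<open>The image of a polynomial under the map sending coefficients along \<open>\<phi>\<close> and each variable
  \<open>v\<close> to \<open>x v\<close>. With \<open>\<phi>\<close> the identity this is evaluation at a point; with \<open>\<phi> = const\<close> it
  is substitution of polynomials for the variables.\<close>

definition monom_subst :: "('v \<Rightarrow> 'r) \<Rightarrow> ('v \<Rightarrow>\<^sub>0 nat) \<Rightarrow> 'r::comm_ring_1" where
  "monom_subst x m = (\<Prod>v\<in>Poly_Mapping.keys m. x v ^ Poly_Mapping.lookup m v)"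

definition subst :: "('a \<Rightarrow> 'r) \<Rightarrow> ('v \<Rightarrow> 'r) \<Rightarrow> ('v, 'a::zero) mpoly \<Rightarrow> 'r::comm_ring_1" where
  "subst \<phi> x p =
     (\<Sum>m\<in>Poly_Mapping.keys p. \<phi> (Poly_Mapping.lookup p m) * monom_subst x m)"

lemma monom_degree_superset:
  assumes "finite A" "Poly_Mapping.keys m \<subseteq> A"
  shows "monom_degree m = (\<Sum>v\<in>A. Poly_Mapping.lookup m v)"
  unfolding monom_degree_def using assms
  by (intro sum.mono_neutral_left) (auto simp: in_keys_iff)

lemma monom_degree_add: "monom_degree (m + n) = monom_degree m + monom_degree n"
proof -
  let ?A = "Poly_Mapping.keys m \<union> Poly_Mapping.keys n"
  have "monom_degree k = (\<Sum>v\<in>?A. Poly_Mapping.lookup k v)" if "k \<in> {m, n, m + n}" for k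
    using that Poly_Mapping.keys_add[of m n] by (intro monom_degree_superset) auto
  then show ?thesis by (simp add: lookup_add sum.distrib)
qed

lemma homogeneous_mult:
  fixes p q :: "('v, 'a::comm_ring_1) mpoly"
  assumes "homogeneous d p" "homogeneous e q"
  shows "homogeneous (d + e) (p * q)"
  unfolding homogeneous_def
proof
  fix m assume "m \<in> Poly_Mapping.keys (p * q)"
  then obtain a b where "m = a + b" "a \<in> Poly_Mapping.keys p" "b \<in> Poly_Mapping.keys q"
    using keys_mult[of p q] by blast
  then show "monom_degree m = d + e"
    using assms by (simp add: homogeneous_def monom_degree_add)
qed

lemma monom_subst_superset:
  assumes "finite A" "Poly_Mapping.keys m \<subseteq> A"
  shows "monom_subst x m = (\<Prod>v\<in>A. x v ^ Poly_Mapping.lookup m v)"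
  unfolding monom_subst_def using assms
  by (intro prod.mono_neutral_left) (auto simp: in_keys_iff)

lemma monom_subst_add: "monom_subst x (m + n) = monom_subst x m * monom_subst x n"
proof -
  let ?A = "Poly_Mapping.keys m \<union> Poly_Mapping.keys n"
  have "monom_subst x k = (\<Prod>v\<in>?A. x v ^ Poly_Mapping.lookup k v)" if "k \<in> {m, n, m + n}" for k
    using that Poly_Mapping.keys_add[of m n] by (intro monom_subst_superset) auto
  then show ?thesis by (simp add: lookup_add power_add prod.distrib)
qed

locale coeff_hom =
  fixes \<phi> :: "'a::comm_ring_1 \<Rightarrow> 'r::comm_ring_1"
  assumes hom_zero: "\<phi> 0 = 0"
    and hom_add: "\<phi> (a + b) = \<phi> a + \<phi> b"
    and hom_mult: "\<phi> (a * b) = \<phi> a * \<phi> b"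
begin

lemma subst_superset:
  assumes "finite A" "Poly_Mapping.keys p \<subseteq> A"
  shows "subst \<phi> x p = (\<Sum>m\<in>A. \<phi> (Poly_Mapping.lookup p m) * monom_subst x m)"
  unfolding subst_def using assms
  by (intro sum.mono_neutral_left) (auto simp: in_keys_iff hom_zero)

lemma subst_add: "subst \<phi> x (p + q) = subst \<phi> x p + subst \<phi> x q"
proof -
  let ?A = "Poly_Mapping.keys p \<union> Poly_Mapping.keys q"
  have "subst \<phi> x r = (\<Sum>m\<in>?A. \<phi> (Poly_Mapping.lookup r m) * monom_subst x m)"
    if "r \<in> {p, q, p + q}" for r
    using that Poly_Mapping.keys_add[of p q] by (intro subst_superset) auto
  then show ?thesis by (simp add: lookup_add hom_add ring_distribs sum.distrib)
qed

lemma subst_single: "subst \<phi> x (Poly_Mapping.single m c) = \<phi> c * monom_subst x m"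
  by (simp add: subst_def hom_zero)

lemma subst_sum: "subst \<phi> x (sum f A) = (\<Sum>a\<in>A. subst \<phi> x (f a))"
  by (induction A rule: infinite_finite_induct) (simp_all add: subst_add, simp_all add: subst_def)

lemma subst_mult: "subst \<phi> x (p * q) = subst \<phi> x p * subst \<phi> x q"
proof -
  have expand: "(\<Sum>m\<in>Poly_Mapping.keys r. Poly_Mapping.single m (Poly_Mapping.lookup r m)) = r"
    for r :: "('b, 'a) mpoly"
    by (intro poly_mapping_eqI)
       (simp add: lookup_sum lookup_single when_def sum.delta in_keys_iff)
  have "subst \<phi> x (p * q) = subst \<phi> x
      ((\<Sum>m\<in>Poly_Mapping.keys p. Poly_Mapping.single m (Poly_Mapping.lookup p m)) *
       (\<Sum>n\<in>Poly_Mapping.keys q. Poly_Mapping.single n (Poly_Mapping.lookup q n)))"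
    by (simp only: expand)
  also have "\<dots> = subst \<phi> x p * subst \<phi> x q"
    unfolding sum_product mult_single subst_sum subst_single hom_mult monom_subst_add
    unfolding subst_def sum_product by (simp add: ac_simps)
  finally show ?thesis .
qed

end

lemma subst_scale:
  assumes "homogeneous e p"
  shows "subst \<phi> (\<lambda>v. c * x v) p = c ^ e * subst \<phi> x p"
proof -
  have "monom_subst (\<lambda>v. c * x v) m = c ^ monom_degree m * monom_subst x m" for m
    by (simp add: monom_subst_def monom_degree_def power_mult_distrib prod.distrib power_sum)
  then show ?thesis
    using assms unfolding subst_def homogeneous_def sum_distrib_left
    by (intro sum.cong) (auto simp: ac_simps)
qed

lemma coeff_hom_id: "coeff_hom (\<lambda>c. c)"
  by standard auto

lemma const_mult: "const (a * b) = const a * (const b :: ('v, 'a::comm_ring_1) mpoly)"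
  by (simp add: const_def mult_single)

lemma const_1: "const 1 = (1 :: ('v, 'a::comm_ring_1) mpoly)"
  by (simp add: const_def)

lemma coeff_hom_const: "coeff_hom (const :: 'a::comm_ring_1 \<Rightarrow> ('v, 'a) mpoly)"
  by standard (auto simp: const_def mult_single single_add)


section \<open>Rational self-maps of the projective plane\<close>

text \<open>A triple \<open>F\<close> of homogeneous polynomials of the same degree, not all zero, represents the
  rational map \<open>[F 0 : F 1 : F 2]\<close>; the three coordinates are indexed by the three-element
  type \<open>3\<close>.\<close>

type_synonym 'a triple = "3 \<Rightarrow> (3, 'a) mpoly"

definition hom_triple :: "nat \<Rightarrow> 'a::field triple \<Rightarrow> bool" where
  "hom_triple d F \<longleftrightarrow> (\<forall>i. homogeneous d (F i)) \<and> F \<noteq> (\<lambda>i. 0)"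

definition no_common_factor :: "'a::field triple \<Rightarrow> bool" where
  "no_common_factor F \<longleftrightarrow> (\<forall>h. (\<forall>i. h dvd F i) \<longrightarrow> h dvd 1)"

text \<open>Equality of the represented rational maps: the vectors \<open>F\<close> and \<open>G\<close> are proportional over
  the function field. This is only meaningful when \<open>F\<close> and \<open>G\<close> are nonzero.\<close>

definition same_map :: "'a::field triple \<Rightarrow> 'a triple \<Rightarrow> bool" where
  "same_map F G \<longleftrightarrow> (\<forall>i j. F i * G j = F j * G i)"

text \<open>Composition substitutes \<open>G\<close> into \<open>F\<close>. The result may have a common factor, or be zero if
  the image of \<open>G\<close> lies in the indeterminacy locus of \<open>F\<close>.\<close>

definition comp_triple :: "'a::field triple \<Rightarrow> 'a triple \<Rightarrow> 'a triple" where
  "comp_triple F G = (\<lambda>i. subst const G (F i))"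

definition iter_triple :: "nat \<Rightarrow> 'a::field triple \<Rightarrow> 'a triple" where
  "iter_triple n F = (comp_triple F ^^ n) var"

definition birational :: "'a::field triple \<Rightarrow> bool" where
  "birational F \<longleftrightarrow> (\<exists>e G. hom_triple e G
     \<and> comp_triple F G \<noteq> (\<lambda>i. 0) \<and> same_map (comp_triple F G) var
     \<and> comp_triple G F \<noteq> (\<lambda>i. 0) \<and> same_map (comp_triple G F) var)"

definition map_degree :: "'a::field triple \<Rightarrow> nat" where
  "map_degree F = (THE e. \<exists>G. hom_triple e G \<and> no_common_factor G \<and> same_map F G)"

text \<open>For birational \<open>F\<close> the limit exists because the degree is submultiplicative. The iterates
  are polynomial compositions, so \<open>map_degree\<close> accounts for the common factors they acquire.\<close>

definition dyn_degree :: "'a::field triple \<Rightarrow> real" where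
  "dyn_degree F = lim (\<lambda>n. root n (real (map_degree (iter_triple n F))))"


section \<open>The projective space of triples and its Zariski topology\<close>

definition scale_triple :: "'a::field \<Rightarrow> 'a triple \<Rightarrow> 'a triple" where
  "scale_triple c F = (\<lambda>i. const c * F i)"

definition proj_pt :: "'a::field triple \<Rightarrow> 'a triple set" where
  "proj_pt F = {scale_triple c F | c. c \<noteq> 0}"

definition proj_triples :: "nat \<Rightarrow> 'a::field triple set set" where
  "proj_triples d = proj_pt ` {F. hom_triple d F}"

text \<open>The homogeneous coordinates of a point are the coefficients of a representing triple,
  indexed by a component and a monomial. Coordinates at monomials of degree other than \<open>d\<close>
  vanish on \<open>proj_triples d\<close>, so it is harmless that polynomials may involve them.\<close>

definition coords :: "'a::field triple \<Rightarrow> 3 \<times> (3 \<Rightarrow>\<^sub>0 nat) \<Rightarrow> 'a" where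
  "coords F = (\<lambda>(i, m). Poly_Mapping.lookup (F i) m)"

definition vanishes_at :: "(3 \<times> (3 \<Rightarrow>\<^sub>0 nat), 'a::field) mpoly \<Rightarrow> 'a triple set \<Rightarrow> bool" where
  "vanishes_at Q p \<longleftrightarrow> (\<forall>F\<in>p. subst (\<lambda>c. c) (coords F) Q = 0)"

definition zero_locus :: "nat \<Rightarrow> (3 \<times> (3 \<Rightarrow>\<^sub>0 nat), 'a::field) mpoly set \<Rightarrow> 'a triple set set" where
  "zero_locus d S = {p \<in> proj_triples d. \<forall>Q\<in>S. vanishes_at Q p}"

definition zariski_closed :: "nat \<Rightarrow> 'a::field triple set set \<Rightarrow> bool" where
  "zariski_closed d Z \<longleftrightarrow> (\<exists>S. (\<forall>Q\<in>S. \<exists>e. homogeneous e Q) \<and> Z = zero_locus d S)"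

definition zariski :: "nat \<Rightarrow> 'a::field triple set topology" where
  "zariski d = topology (\<lambda>U. U \<subseteq> proj_triples d \<and> zariski_closed d (proj_triples d - U))"

lemma const_mult_lookup:
  "Poly_Mapping.lookup (const c * p) m = c * Poly_Mapping.lookup p m"
  for p :: "('v, 'a::comm_ring_1) mpoly"
proof -
  have "const c * p = Poly_Mapping.map ((*) c) p"
    unfolding const_def by (metis mult_map_scale_conv_mult)
  then show ?thesis by (simp add: Poly_Mapping.map.rep_eq when_def)
qed

lemma coords_scale: "coords (scale_triple c F) = (\<lambda>v. c * coords F v)"
  by (auto simp: coords_def scale_triple_def const_mult_lookup fun_eq_iff)

lemma self_in_proj_pt: "F \<in> proj_pt F"
proof -
  have "scale_triple 1 F = F" by (simp add: scale_triple_def const_1)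
  then show ?thesis unfolding proj_pt_def by (metis (mono_tags, lifting) mem_Collect_eq one_neq_zero)
qed

lemma vanishes_at_proj_pt:
  assumes "homogeneous e Q"
  shows "vanishes_at Q (proj_pt F) \<longleftrightarrow> subst (\<lambda>c. c) (coords F) Q = 0"
proof
  show "vanishes_at Q (proj_pt F) \<Longrightarrow> subst (\<lambda>c. c) (coords F) Q = 0"
    using self_in_proj_pt by (auto simp: vanishes_at_def)
  show "subst (\<lambda>c. c) (coords F) Q = 0 \<Longrightarrow> vanishes_at Q (proj_pt F)"
    by (auto simp: vanishes_at_def proj_pt_def coords_scale subst_scale[OF assms])
qed

lemma vanishes_at_mult:
  assumes "homogeneous d P" "homogeneous e Q" "p \<in> proj_triples n"
  shows "vanishes_at (P * Q) p \<longleftrightarrow> vanishes_at P p \<or> vanishes_at Q p"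
  using assms homogeneous_mult[OF assms(1,2)]
  by (auto simp: proj_triples_def vanishes_at_proj_pt coeff_hom.subst_mult[OF coeff_hom_id])

lemma zero_locus_Un:
  assumes S: "\<forall>P\<in>S. \<exists>e. homogeneous e P" and T: "\<forall>Q\<in>T. \<exists>e. homogeneous e Q"
  shows "zero_locus d S \<union> zero_locus d T = zero_locus d {P * Q | P Q. P \<in> S \<and> Q \<in> T}"
    (is "?L = ?R")
proof (rule set_eqI)
  fix p
  show "p \<in> ?L \<longleftrightarrow> p \<in> ?R"
  proof (cases "p \<in> proj_triples d")
    case True
    have "vanishes_at (P * Q) p \<longleftrightarrow> vanishes_at P p \<or> vanishes_at Q p" if "P \<in> S" "Q \<in> T" for P Q
      using vanishes_at_mult True S T that by metis
    then show ?thesis using True unfolding zero_locus_def by blast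
  qed (simp add: zero_locus_def)
qed

lemma zariski_closedI:
  "\<lbrakk>\<And>Q. Q \<in> S \<Longrightarrow> \<exists>e. homogeneous e Q; Z = zero_locus d S\<rbrakk> \<Longrightarrow> zariski_closed d Z"
  unfolding zariski_closed_def by auto

lemma zariski_closedE:
  assumes "zariski_closed d Z"
  obtains S where "\<forall>Q\<in>S. \<exists>e. homogeneous e Q" "Z = zero_locus d S"
  using assms unfolding zariski_closed_def by auto

lemma zariski_closed_Un:
  assumes "zariski_closed d Y" "zariski_closed d Z"
  shows "zariski_closed d (Y \<union> Z)"
proof -
  from assms(1) obtain S where S: "\<forall>Q\<in>S. \<exists>e. homogeneous e Q" "Y = zero_locus d S"
    by (rule zariski_closedE)
  from assms(2) obtain T where T: "\<forall>Q\<in>T. \<exists>e. homogeneous e Q" "Z = zero_locus d T"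
    by (rule zariski_closedE)
  show ?thesis
  proof (rule zariski_closedI)
    show "Y \<union> Z = zero_locus d {P * Q | P Q. P \<in> S \<and> Q \<in> T}"
      unfolding S(2) T(2) by (rule zero_locus_Un[OF S(1) T(1)])
  next
    fix R assume "R \<in> {P * Q | P Q. P \<in> S \<and> Q \<in> T}"
    then obtain P Q where R: "R = P * Q" "P \<in> S" "Q \<in> T" by auto
    obtain a b where "homogeneous a P" "homogeneous b Q" using S(1) T(1) R by blast
    then show "\<exists>e. homogeneous e R" unfolding R(1) by (blast intro: homogeneous_mult)
  qed
qed

lemma zariski_closed_Inter:
  assumes "\<And>i. i \<in> I \<Longrightarrow> zariski_closed d (Z i)"
  shows "zariski_closed d (proj_triples d \<inter> (\<Inter>i\<in>I. Z i))"
proof -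
  define S where "S i = (SOME S. (\<forall>Q\<in>S. \<exists>e. homogeneous e Q) \<and> Z i = zero_locus d S)" for i
  have S: "(\<forall>Q\<in>S i. \<exists>e. homogeneous e Q) \<and> Z i = zero_locus d (S i)" if "i \<in> I" for i
    unfolding S_def by (rule someI_ex) (use assms[OF that] in \<open>simp add: zariski_closed_def\<close>)
  show ?thesis
  proof (rule zariski_closedI)
    have "p \<in> Z i \<longleftrightarrow> p \<in> proj_triples d \<and> (\<forall>Q\<in>S i. vanishes_at Q p)" if "i \<in> I" for i p
      using S[OF that] by (simp add: zero_locus_def)
    then show "proj_triples d \<inter> (\<Inter>i\<in>I. Z i) = zero_locus d (\<Union>i\<in>I. S i)"
      by (auto simp: zero_locus_def)
  next
    fix Q assume "Q \<in> (\<Union>i\<in>I. S i)"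
    then show "\<exists>e. homogeneous e Q" using S by auto
  qed
qed

lemma istopology_zariski:
  "istopology (\<lambda>U. U \<subseteq> proj_triples d \<and> zariski_closed d (proj_triples d - U))"
  unfolding istopology_def
proof (intro conjI allI impI)
  fix U V :: "'a triple set set"
  assume U: "U \<subseteq> proj_triples d \<and> zariski_closed d (proj_triples d - U)"
    and V: "V \<subseteq> proj_triples d \<and> zariski_closed d (proj_triples d - V)"
  show "U \<inter> V \<subseteq> proj_triples d" using conjunct1[OF U] by (rule le_infI1)
  show "zariski_closed d (proj_triples d - (U \<inter> V))"
    unfolding Diff_Int using U V by (intro zariski_closed_Un) simp_all
next
  fix K :: "'a triple set set set"
  assume K: "\<forall>U\<in>K. U \<subseteq> proj_triples d \<and> zariski_closed d (proj_triples d - U)"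
  show "\<Union>K \<subseteq> proj_triples d" using K by (simp add: Sup_le_iff)
  have "proj_triples d - \<Union>K = proj_triples d \<inter> (\<Inter>U\<in>K. proj_triples d - U)"
    by auto
  then show "zariski_closed d (proj_triples d - \<Union>K)"
    using zariski_closed_Inter[of K d "\<lambda>U. proj_triples d - U"] K by simp
qed

lemma openin_zariski:
  "openin (zariski d) U \<longleftrightarrow> U \<subseteq> proj_triples d \<and> zariski_closed d (proj_triples d - U)"
  unfolding zariski_def topology_inverse'[OF istopology_zariski] ..

lemma topspace_zariski: "topspace (zariski d) = (proj_triples d :: 'a::field triple set set)"
proof -
  have "zero_locus d {1} = ({} :: 'a triple set set)"
    using self_in_proj_pt
    by (auto simp: zero_locus_def proj_triples_def vanishes_at_def subst_def monom_subst_def)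
  moreover have "homogeneous 0 (1 :: (3 \<times> (3 \<Rightarrow>\<^sub>0 nat), 'a) mpoly)"
    by (simp add: homogeneous_def monom_degree_def)
  ultimately have "zariski_closed d ({} :: 'a triple set set)"
    by (intro zariski_closedI[of "{1}"]) auto
  then have "openin (zariski d) (proj_triples d :: 'a triple set set)"
    by (simp add: openin_zariski)
  moreover have "topspace (zariski d) \<subseteq> (proj_triples d :: 'a triple set set)"
    using openin_topspace openin_zariski by (rule iffD1[THEN conjunct1, rotated])
  ultimately show ?thesis
    by (intro equalityI openin_subset)
qed


section \<open>Birational maps of fixed degree\<close>

text \<open>A rational map of degree \<open>d\<close> has a representing triple without common factor, unique up to a
  scalar, so it is a point of \<open>proj_triples d\<close>.\<close>

definition Bir :: "nat \<Rightarrow> 'a::field triple set set" where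
  "Bir d = proj_pt ` {F. hom_triple d F \<and> no_common_factor F \<and> birational F}"

definition Bir_top :: "nat \<Rightarrow> 'a::field triple set topology" where
  "Bir_top d = subtopology (zariski d) (Bir d)"

definition lambda1 :: "'a::field triple set \<Rightarrow> real" where
  "lambda1 f = dyn_degree (SOME F. F \<in> f)"

lemma topspace_Bir_top: "topspace (Bir_top d) = Bir d"
  by (auto simp: Bir_top_def topspace_zariski Bir_def proj_triples_def)

lemma iter_triple_scale:
  assumes "hom_triple d F" "c \<noteq> 0"
  shows "\<exists>b. b \<noteq> 0 \<and> iter_triple n (scale_triple c F) = scale_triple b (iter_triple n F)"
proof (induction n)
  case 0
  show ?case by (rule exI[of _ 1]) (simp add: iter_triple_def scale_triple_def const_1)
next
  case (Suc n)
  then obtain b where b: "b \<noteq> 0" "iter_triple n (scale_triple c F) = scale_triple b (iter_triple n F)"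
    by blast
  have pow: "const b ^ d = (const (b ^ d) :: (3, 'a) mpoly)"
    by (induction d) (simp_all add: const_1 const_mult)
  have sub: "subst const G (const c) = const c" for G :: "'a triple"
    unfolding const_def[of c] coeff_hom.subst_single[OF coeff_hom_const]
    by (simp add: monom_subst_def const_def)
  have "iter_triple (Suc n) (scale_triple c F) i
      = scale_triple (c * b ^ d) (iter_triple (Suc n) F) i" for i
  proof -
    let ?G = "iter_triple n F"
    have "iter_triple (Suc n) (scale_triple c F) i
        = subst const (scale_triple b ?G) (const c * F i)"
      using b(2) by (simp add: iter_triple_def comp_triple_def scale_triple_def)
    also have "\<dots> = const c * subst const (\<lambda>i. const b * ?G i) (F i)"
      by (simp add: coeff_hom.subst_mult[OF coeff_hom_const] sub scale_triple_def)
    also have "\<dots> = const c * (const b ^ d * subst const ?G (F i))"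
      using assms(1) by (subst subst_scale[of d]) (auto simp: hom_triple_def)
    also have "\<dots> = scale_triple (c * b ^ d) (iter_triple (Suc n) F) i"
      by (simp add: pow iter_triple_def comp_triple_def scale_triple_def const_mult ac_simps)
    finally show ?thesis .
  qed
  then show ?case using b(1) assms(2) by (intro exI[of _ "c * b ^ d"]) auto
qed

lemma same_map_scale:
  assumes "b \<noteq> 0"
  shows "same_map (scale_triple b F) G \<longleftrightarrow> same_map F G"
proof -
  have "const (inverse b) * (const b * p) = p" for p :: "(3, 'a) mpoly"
    using assms by (simp flip: mult.assoc const_mult add: const_1)
  then have "const b * p = const b * q \<longleftrightarrow> p = q" for p q :: "(3, 'a) mpoly"
    by metis
  then show ?thesis
    by (simp add: same_map_def scale_triple_def mult.assoc)
qed

text \<open>The choice of representative in \<open>lambda1\<close> is immaterial.\<close>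

lemma lambda1_proj_pt:
  assumes "hom_triple d F"
  shows "lambda1 (proj_pt F) = dyn_degree F"
proof -
  have "(SOME G. G \<in> proj_pt F) \<in> proj_pt F"
    by (rule someI[of "\<lambda>G. G \<in> proj_pt F", OF self_in_proj_pt])
  then obtain c where c: "c \<noteq> 0" "(SOME G. G \<in> proj_pt F) = scale_triple c F"
    unfolding proj_pt_def by blast
  have "map_degree (iter_triple n (scale_triple c F)) = map_degree (iter_triple n F)" for n
    using iter_triple_scale[OF assms c(1), of n] by (auto simp: map_degree_def same_map_scale)
  then show ?thesis using c(2) by (simp add: lambda1_def dyn_degree_def)
qed

end

theory Submission
  imports Defs "HOL-Computational_Algebra.Polynomial_Factorial" "HOL-Real_Asymp.Real_Asymp"
begin

text \<open>Write \<open>deg f\<close> for the degree of a map. The theorem rests on one inequality: for birational \<open>f\<close>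
  and all \<open>k \<ge> 1\<close>,

    \<open>deg (f\<^sup>2\<^sup>k) \<le> 4096 \<lambda>\<^sub>1(f)\<^sup>k deg (f\<^sup>k)\<close>.

  Along \<open>k = 2\<^sup>j\<close> it gives \<open>deg (f\<^sup>N) \<le> 4096\<^sup>j \<lambda>\<^sub>1(f)\<^sup>N deg f\<close> with \<open>N = 2\<^sup>j\<close>. The first factor is
  subexponential in \<open>N\<close>, so the condition \<open>\<lambda>\<^sub>1(f) > \<lambda>\<close> is detected by the degree of one iterate
  \<open>f\<^sup>N\<close> (\<open>dyn_degree_gt\<close>). Conversely \<open>\<lambda>\<^sub>1(f) > \<lambda>\<close> forces the degree of some iterate above that
  threshold, because \<open>deg (f\<^sup>N) \<ge> \<lambda>\<^sub>1(f)\<^sup>N\<close> by submultiplicativity.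

  The inequality comes from hyperbolicity. Birational maps act by isometries on an
  infinite-dimensional hyperbolic space, where \<open>log deg\<close> is a distance up to a bounded error; a
  product of degrees over one pairing of four points is therefore bounded by the products over the
  two other pairings (\<open>four_point\<close>). The space itself is not used. The four-point inequality follows
  from a dimension count, as in Siu's criterion for the difference of two nef classes to be big: if
  \<open>X\<close> and \<open>Y = E X\<close> are maps on the same plane, the forms \<open>P(X, Y)\<close> with \<open>P\<close> of bidegree \<open>(A, B)\<close>
  span a space of dimension at least \<open>A B deg E / 2\<close> if \<open>A \<ge> deg E\<close>, so that one of them vanishes to high order on
  a general line; pulled back by a further map \<open>K\<close>, its degree bounds a multiple of \<open>deg K\<close>. Applied
  to the iterates of orders \<open>0\<close>, \<open>k\<close>, \<open>2 k\<close> and \<open>(m + 2) k\<close> it shows that the degrees of the iterates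
  grow geometrically at rate \<open>q\<close> once \<open>deg (f\<^sup>2\<^sup>k) = 4096 q deg (f\<^sup>k)\<close> with \<open>q \<ge> 1\<close>.

  Openness: the condition \<open>deg (f\<^sup>N) > r\<close> says that no nonzero triple of forms of degree \<open>r\<close> is
  proportional to the \<open>N\<close>-th iterate. This is a linear system whose coefficients are forms in the
  coefficients of \<open>f\<close>, and having only the trivial solution is an open condition
  (\<open>map_degree_iter_gt_open\<close>, \<open>lambda1_gt_open\<close>).

  Density: it suffices to find, near a given \<open>f\<close>, a map whose \<open>N\<close>-th iterate has degree \<open>d\<^sup>N\<close>, that
  is, no common factor. Consider \<open>A f\<close> for matrices \<open>A\<close>. If \<open>A\<close> has rank two, the image of \<open>A\<close> is a
  line without base points of \<open>f\<close> and the kernel of \<open>A\<close> is general, then the iterates of \<open>A f\<close>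
  have no zeros on this line. That the restrictions of two entries of the \<open>N\<close>-th iterate to the line
  have no common zero is an open condition on \<open>A\<close> and prevents common factors, so the general member of the pencil that joins the identity to
  such an \<open>A\<close> gives the map (\<open>exists_stable_nearby\<close>, \<open>lambda1_gt_dense\<close>).\<close>

section \<open>Polynomial substitution\<close>

abbreviation "lookup \<equiv> Poly_Mapping.lookup"
abbreviation "keys \<equiv> Poly_Mapping.keys"
abbreviation "single \<equiv> Poly_Mapping.single"

lemma ring_hom_sum:
  assumes "coeff_hom \<psi>"
  shows "\<psi> (sum f A) = (\<Sum>a\<in>A. \<psi> (f a))"
  by (induction A rule: infinite_finite_induct)
     (use assms in \<open>auto simp: coeff_hom_def\<close>)

lemma ring_hom_power:
  assumes "coeff_hom \<psi>" "\<psi> 1 = 1"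
  shows "\<psi> (a ^ n) = \<psi> a ^ n"
  by (induction n) (use assms in \<open>auto simp: coeff_hom_def\<close>)

lemma ring_hom_prod:
  assumes "coeff_hom \<psi>" "\<psi> 1 = 1"
  shows "\<psi> (prod f A) = (\<Prod>a\<in>A. \<psi> (f a))"
  by (induction A rule: infinite_finite_induct)
     (use assms in \<open>auto simp: coeff_hom_def\<close>)

text \<open>Substitution commutes with every ring homomorphism. Associativity of composition, evaluation of a
  composition and restriction to curves are all instances.\<close>

lemma ring_hom_subst:
  assumes "coeff_hom \<psi>" "\<psi> 1 = 1"
  shows "\<psi> (subst \<phi> x p) = subst (\<lambda>c. \<psi> (\<phi> c)) (\<lambda>v. \<psi> (x v)) p"
  by (simp add: subst_def monom_subst_def ring_hom_sum[OF assms(1)] ring_hom_prod[OF assms]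
      ring_hom_power[OF assms] coeff_hom.hom_mult[OF assms(1)])

lemma ring_hom_uminus:
  assumes "coeff_hom \<psi>"
  shows "\<psi> (- a) = - \<psi> a"
proof -
  interpret coeff_hom \<psi> by fact
  have "\<psi> (- a) + \<psi> a = 0" by (metis hom_add hom_zero add.left_inverse)
  then show ?thesis by (simp add: eq_neg_iff_add_eq_0)
qed

lemma ring_hom_diff:
  assumes "coeff_hom \<psi>"
  shows "\<psi> (a - b) = \<psi> a - \<psi> b"
  using ring_hom_uminus[OF assms, of b] coeff_hom.hom_add[OF assms, of a "- b"] by simp

lemma coeff_hom_subst: "coeff_hom \<phi> \<Longrightarrow> coeff_hom (subst \<phi> x)"
  by unfold_locales (simp_all add: coeff_hom.subst_add coeff_hom.subst_mult, simp add: subst_def)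

lemma subst_one: "coeff_hom \<phi> \<Longrightarrow> \<phi> 1 = 1 \<Longrightarrow> subst \<phi> x 1 = 1"
  by (simp add: subst_def monom_subst_def)

lemma subst_const_coeff:
  assumes "coeff_hom \<phi>"
  shows "subst \<phi> x (const c) = \<phi> c"
  unfolding const_def by (simp add: coeff_hom.subst_single[OF assms] monom_subst_def)

lemma subst_var_coeff:
  assumes "coeff_hom \<phi>" "\<phi> 1 = 1"
  shows "subst \<phi> x (var v) = x v"
  unfolding var_def by (simp add: coeff_hom.subst_single[OF assms(1)] monom_subst_def assms(2))

lemma monom_subst_var: "monom_subst var m = (single m 1 :: ('v, 'a::comm_ring_1) mpoly)"
proof -
  have pow: "(var k :: ('v, 'a) mpoly) ^ n = single (single k n) 1" for k n
    by (induction n) (simp_all add: var_def mult_single single_add[symmetric])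
  have "(\<Prod>v\<in>A. single (f v) 1) = (single (sum f A) 1 :: ('v, 'a) mpoly)"
    for A and f :: "'v \<Rightarrow> 'v \<Rightarrow>\<^sub>0 nat"
    by (induction A rule: infinite_finite_induct) (simp_all add: mult_single)
  moreover have "(\<Sum>v\<in>keys m. single v (lookup m v)) = m"
    by (intro poly_mapping_eqI) (simp add: lookup_sum lookup_single when_def sum.delta in_keys_iff)
  ultimately show ?thesis by (simp add: monom_subst_def pow)
qed

lemma subst_const_var [simp]: "subst const var p = (p :: ('v, 'a::comm_ring_1) mpoly)"
  by (intro poly_mapping_eqI)
    (simp add: subst_def monom_subst_var const_def mult_single lookup_sum lookup_single when_def
      sum.delta in_keys_iff)

abbreviation ev :: "('v \<Rightarrow> 'a) \<Rightarrow> ('v, 'a) mpoly \<Rightarrow> 'a::comm_ring_1" where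
  "ev \<equiv> subst (\<lambda>c. c)"

abbreviation psubst :: "('v \<Rightarrow> ('w, 'a) mpoly) \<Rightarrow> ('v, 'a) mpoly \<Rightarrow> ('w, 'a::comm_ring_1) mpoly" where
  "psubst \<equiv> subst const"

lemma coeff_hom_psubst: "coeff_hom (psubst G)"
  by (rule coeff_hom_subst[OF coeff_hom_const])

lemma coeff_hom_ev: "coeff_hom (ev x)"
  by (rule coeff_hom_subst[OF coeff_hom_id])

lemma psubst_const [simp]: "psubst G (const c) = const c"
  by (rule subst_const_coeff[OF coeff_hom_const])

lemma psubst_var [simp]: "psubst G (var v) = G v"
  by (rule subst_var_coeff[OF coeff_hom_const const_1])

lemma ev_const [simp]: "ev x (const c) = c"
  by (rule subst_const_coeff[OF coeff_hom_id])

lemma ev_var [simp]: "ev x (var v) = x v"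
  by (rule subst_var_coeff[OF coeff_hom_id refl])

lemma psubst_one [simp]: "psubst G 1 = 1"
  by (rule subst_one[OF coeff_hom_const const_1])

lemma ev_one [simp]: "ev x 1 = 1"
  by (rule subst_one[OF coeff_hom_id refl])

lemma subst_zero [simp]: "subst \<phi> x 0 = 0"
  by (simp add: subst_def)

lemmas psubst_mult [simp] = coeff_hom.hom_mult[OF coeff_hom_psubst]
lemmas psubst_add [simp] = coeff_hom.hom_add[OF coeff_hom_psubst]
lemmas psubst_diff [simp] = ring_hom_diff[OF coeff_hom_psubst]
lemmas psubst_power [simp] = ring_hom_power[OF coeff_hom_psubst psubst_one]
lemmas psubst_sum = ring_hom_sum[OF coeff_hom_psubst]
lemmas ev_mult [simp] = coeff_hom.hom_mult[OF coeff_hom_ev]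
lemmas ev_add [simp] = coeff_hom.hom_add[OF coeff_hom_ev]
lemmas ev_diff [simp] = ring_hom_diff[OF coeff_hom_ev]
lemmas ev_power [simp] = ring_hom_power[OF coeff_hom_ev ev_one]
lemmas ev_sum = ring_hom_sum[OF coeff_hom_ev]

lemma psubst_psubst: "psubst G (psubst F p) = psubst (\<lambda>v. psubst G (F v)) p"
  by (simp add: ring_hom_subst[OF coeff_hom_psubst psubst_one])

lemma ev_psubst: "ev x (psubst G p) = ev (\<lambda>v. ev x (G v)) p"
  by (simp add: ring_hom_subst[OF coeff_hom_ev ev_one])

lemma comp_triple_assoc: "comp_triple (comp_triple E F) G = comp_triple E (comp_triple F G)"
  by (simp add: comp_triple_def psubst_psubst)

lemma comp_triple_var_left [simp]: "comp_triple var G = G"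
  by (simp add: comp_triple_def fun_eq_iff)

lemma comp_triple_var_right [simp]: "comp_triple F var = F"
  by (simp add: comp_triple_def fun_eq_iff)

lemma psubst_comp_triple: "psubst (comp_triple F G) p = psubst G (psubst F p)"
  by (simp add: comp_triple_def psubst_psubst)

lemma const_0 [simp]: "const 0 = 0"
  by (simp add: const_def)

lemma const_eq_0_iff [simp]: "const c = 0 \<longleftrightarrow> c = 0"
  unfolding const_def by (metis lookup_single_eq lookup_zero single_zero)

lemma const_add: "const (a + b) = const a + (const b :: ('v, 'a::comm_ring_1) mpoly)"
  by (simp add: const_def single_add)

lemma const_diff: "const (a - b) = const a - (const b :: ('v, 'a::comm_ring_1) mpoly)"
  by (simp add: const_def single_diff)


section \<open>Homogeneous polynomials\<close>

lemma homogeneous_0 [simp]: "homogeneous e 0"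
  by (simp add: homogeneous_def)

lemma homogeneous_const [simp]: "homogeneous 0 (const c)"
  by (simp add: homogeneous_def const_def monom_degree_def)

lemma homogeneous_1 [simp]: "homogeneous 0 (1 :: ('v, 'a::comm_ring_1) mpoly)"
  by (simp add: homogeneous_def monom_degree_def)

lemma homogeneous_var [simp]: "homogeneous 1 (var v)"
  by (simp add: homogeneous_def var_def monom_degree_def)

lemma homogeneous_single: "homogeneous (monom_degree m) (single m c)"
  by (simp add: homogeneous_def)

lemma homogeneous_add: "homogeneous e p \<Longrightarrow> homogeneous e q \<Longrightarrow> homogeneous e (p + q)"
  unfolding homogeneous_def using Poly_Mapping.keys_add[of p q] by blast

lemma homogeneous_diff:
  "homogeneous e p \<Longrightarrow> homogeneous e q \<Longrightarrow> homogeneous e (p - q :: ('v, 'a::comm_ring_1) mpoly)"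
  unfolding homogeneous_def using keys_diff[of p q] by blast

lemma homogeneous_sum: "(\<And>a. a \<in> A \<Longrightarrow> homogeneous e (f a)) \<Longrightarrow> homogeneous e (sum f A)"
  by (induction A rule: infinite_finite_induct) (auto intro: homogeneous_add)

lemma homogeneous_const_mult:
  "homogeneous e p \<Longrightarrow> homogeneous e (const c * p :: ('v, 'a::comm_ring_1) mpoly)"
  using homogeneous_mult[OF homogeneous_const[of c], of e p] by simp

lemma homogeneous_power:
  "homogeneous e p \<Longrightarrow> homogeneous (n * e) (p ^ n :: ('v, 'a::comm_ring_1) mpoly)"
  by (induction n) (auto dest: homogeneous_mult)

lemma homogeneous_prod:
  "(\<And>a. a \<in> A \<Longrightarrow> homogeneous (e a) (f a)) \<Longrightarrow>
    homogeneous (sum e A) (prod f A :: ('v, 'a::comm_ring_1) mpoly)"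
  by (induction A rule: infinite_finite_induct) (auto intro: homogeneous_mult)

lemma homogeneous_psubst:
  assumes "homogeneous d p" "\<And>v. homogeneous e (G v)"
  shows "homogeneous (d * e) (psubst G p)"
  unfolding subst_def
proof (rule homogeneous_sum)
  fix m assume m: "m \<in> keys p"
  have "homogeneous (\<Sum>v\<in>keys m. lookup m v * e) (monom_subst G m)"
    unfolding monom_subst_def by (intro homogeneous_prod homogeneous_power assms)
  moreover have "(\<Sum>v\<in>keys m. lookup m v * e) = d * e"
    using assms(1) m by (simp add: homogeneous_def monom_degree_def flip: sum_distrib_right)
  ultimately show "homogeneous (d * e) (const (lookup p m) * monom_subst G m)"
    by (intro homogeneous_const_mult) simp
qed

lemma homogeneous_unique:
  "homogeneous d p \<Longrightarrow> homogeneous e p \<Longrightarrow> p \<noteq> 0 \<Longrightarrow> d = e"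
  unfolding homogeneous_def by (metis ex_in_conv keys_eq_empty)

lemma homogeneous_lookup: "homogeneous e p \<Longrightarrow> lookup p m \<noteq> 0 \<Longrightarrow> monom_degree m = e"
  by (simp add: homogeneous_def in_keys_iff)

lemma psubst_scale:
  assumes "homogeneous e p"
  shows "psubst (\<lambda>v. h * x v) p = h ^ e * psubst x p"
  by (rule subst_scale[OF assms])

text \<open>Substituting \<open>s x\<close> for \<open>x\<close>, with a new variable \<open>s\<close>, sends a form \<open>p\<close> of degree \<open>e\<close> to
  the monomial \<open>p s\<^sup>e\<close>, and no other polynomials to monomials. A factorisation of a monomial in \<open>s\<close>
  consists of monomials, so the factors of a homogeneous polynomial are homogeneous.\<close>

definition grade :: "('v, 'a::comm_ring_1) mpoly \<Rightarrow> ('v, 'a) mpoly poly" where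
  "grade = subst (\<lambda>c. [:const c:]) (\<lambda>v. monom (var v) 1)"

lemma coeff_hom_const_poly: "coeff_hom (\<lambda>c. [:const c:])"
  by unfold_locales (simp_all add: const_add const_mult)

lemma grade_eq:
  fixes p :: "('v, 'a::comm_ring_1) mpoly"
  shows "grade p = (\<Sum>m\<in>keys p.
     monom (single m (lookup p m)) (monom_degree m))"
proof -
  have mp: "(\<Prod>v\<in>A. monom (var v :: ('v, 'a) mpoly) (Suc 0) ^ f v) = monom (\<Prod>v\<in>A. var v ^ f v) (sum f A)"
    for A and f :: "'v \<Rightarrow> nat"
    by (induction A rule: infinite_finite_induct) (simp_all add: monom_power mult_monom)
  have "[:const c:] * monom_subst (\<lambda>v. monom (var v :: ('v, 'a) mpoly) 1) m
      = monom (single m c) (monom_degree m)" for c m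
    using monom_subst_var[of m, where 'a = 'a] unfolding monom_subst_def monom_degree_def
    by (simp add: mp smult_monom const_def mult_single)
  then show ?thesis by (simp add: grade_def subst_def)
qed

lemma poly_grade_1: "poly (grade p) 1 = p"
proof -
  have "(\<Sum>m\<in>keys p. single m (lookup p m)) = p"
    by (intro poly_mapping_eqI) (simp add: lookup_sum lookup_single when_def sum.delta in_keys_iff)
  then show ?thesis by (simp add: grade_eq poly_sum poly_monom)
qed

lemma lookup_coeff_grade:
  "lookup (coeff (grade p) e) m = (if monom_degree m = e then lookup p m else 0)"
proof -
  have "lookup (coeff (grade p) e) m =
     (\<Sum>k\<in>keys p. if k = m then (if monom_degree m = e then lookup p m else 0) else 0)"
    unfolding grade_eq coeff_sum lookup_sum
    by (intro sum.cong) (auto simp: lookup_single when_def)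
  then show ?thesis by (simp add: sum.delta in_keys_iff)
qed

lemma homogeneous_iff_grade: "homogeneous e p \<longleftrightarrow> grade p = monom p e"
proof
  assume "homogeneous e p"
  show "grade p = monom p e"
  proof (intro poly_eqI poly_mapping_eqI)
    fix k m
    show "lookup (coeff (grade p) k) m = lookup (coeff (monom p e) k) m"
      using homogeneous_lookup[OF \<open>homogeneous e p\<close>, of m] by (auto simp: lookup_coeff_grade)
  qed
next
  assume *: "grade p = monom p e"
  show "homogeneous e p"
    unfolding homogeneous_def
  proof
    fix m assume "m \<in> keys p"
    then show "monom_degree m = e"
      using lookup_coeff_grade[of p e m] * by (auto simp: in_keys_iff split: if_splits)
  qed
qed

lemma grade_mult: "grade (p * q) = grade p * grade q"
  unfolding grade_def by (rule coeff_hom.subst_mult[OF coeff_hom_const_poly])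

lemma factor_of_monom:
  fixes p q :: "'a::idom poly"
  assumes "p * q = monom c e" "c \<noteq> 0"
  shows "\<exists>a i. p = monom a i"
  using assms(1)
proof (induction e arbitrary: p q)
  case 0
  then have "p * q = [:c:]" by (simp add: monom_0)
  then have "degree p + degree q = 0"
    using \<open>c \<noteq> 0\<close> by (metis degree_mult_eq degree_pCons_0 mult_zero_left mult_zero_right pCons_eq_0_iff)
  then show ?case by (metis add_is_0 degree_eq_zeroE monom_0)
next
  case (Suc e)
  have "coeff p 0 * coeff q 0 = coeff (p * q) 0" by (simp add: coeff_mult_0)
  then consider "coeff p 0 = 0" | "coeff q 0 = 0" using Suc.prems by auto
  then show ?case
  proof cases
    case 1
    then obtain p' where p: "p = pCons 0 p'" by (metis coeff_pCons_0 pCons_cases)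
    have "p' * q = monom c e" using Suc.prems by (simp add: p monom_Suc)
    then obtain a i where "p' = monom a i" using Suc.IH by blast
    then show ?thesis using p by (metis monom_Suc)
  next
    case 2
    then obtain q' where q: "q = pCons 0 q'" by (metis coeff_pCons_0 pCons_cases)
    have "p * q' = monom c e" using Suc.prems by (simp add: q monom_Suc)
    then show ?thesis using Suc.IH by blast
  qed
qed

lemma homogeneous_factor:
  fixes p q :: "('v::linorder, 'a::idom) mpoly"
  assumes "homogeneous e (p * q)" "p * q \<noteq> 0"
  obtains i where "homogeneous i p"
proof -
  have "grade p * grade q = monom (p * q) e"
    using assms(1) by (simp add: homogeneous_iff_grade grade_mult)
  then obtain a i where *: "grade p = monom a i" using factor_of_monom assms(2) by blast
  then have "a = p" using poly_grade_1[of p] by (simp add: poly_monom)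
  then show ?thesis using * that homogeneous_iff_grade by metis
qed

section \<open>Unique factorization\<close>

text \<open>A copy of an arbitrary field that carries the trivial Euclidean structure. Polynomials over
  it are then instances of the library's class of factorial rings with greatest common
  divisors.\<close>

typedef (overloaded) 'a fld = "UNIV :: 'a::field set"
  morphisms of_fld to_fld
  by simp

setup_lifting type_definition_fld

instantiation fld :: (field) field
begin

lift_definition zero_fld :: "'a fld" is 0 .
lift_definition one_fld :: "'a fld" is 1 .
lift_definition plus_fld :: "'a fld \<Rightarrow> 'a fld \<Rightarrow> 'a fld" is "(+)" .
lift_definition minus_fld :: "'a fld \<Rightarrow> 'a fld \<Rightarrow> 'a fld" is "(-)" .
lift_definition uminus_fld :: "'a fld \<Rightarrow> 'a fld" is uminus .
lift_definition times_fld :: "'a fld \<Rightarrow> 'a fld \<Rightarrow> 'a fld" is "(*)" .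
lift_definition divide_fld :: "'a fld \<Rightarrow> 'a fld \<Rightarrow> 'a fld" is "(/)" .
lift_definition inverse_fld :: "'a fld \<Rightarrow> 'a fld" is inverse .

instance
  by standard (transfer; simp add: field_simps)+

end

instantiation fld :: (field)
  "{unique_euclidean_ring, normalization_euclidean_semiring, normalization_semidom_multiplicative}"
begin

definition normalize_fld :: "'a fld \<Rightarrow> 'a fld" where
  [simp]: "normalize_fld x = (if x = 0 then 0 else 1)"
definition unit_factor_fld :: "'a fld \<Rightarrow> 'a fld" where
  [simp]: "unit_factor_fld x = x"
definition modulo_fld :: "'a fld \<Rightarrow> 'a fld \<Rightarrow> 'a fld" where
  [simp]: "modulo_fld x y = (if y = 0 then x else 0)"
definition euclidean_size_fld :: "'a fld \<Rightarrow> nat" where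
  [simp]: "euclidean_size_fld x = (if x = 0 then 0 else 1)"
definition division_segment_fld :: "'a fld \<Rightarrow> 'a fld" where
  [simp]: "division_segment_fld x = 1"

instance
  by standard (simp_all add: dvd_field_iff field_split_simps split: if_splits)

end

instantiation fld :: (field) euclidean_ring_gcd
begin

definition gcd_fld :: "'a fld \<Rightarrow> 'a fld \<Rightarrow> 'a fld" where
  "gcd_fld = Euclidean_Algorithm.gcd"
definition lcm_fld :: "'a fld \<Rightarrow> 'a fld \<Rightarrow> 'a fld" where
  "lcm_fld = Euclidean_Algorithm.lcm"
definition Gcd_fld :: "'a fld set \<Rightarrow> 'a fld" where
  "Gcd_fld = Euclidean_Algorithm.Gcd"
definition Lcm_fld :: "'a fld set \<Rightarrow> 'a fld" where
  "Lcm_fld = Euclidean_Algorithm.Lcm"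

instance by standard (simp_all add: gcd_fld_def lcm_fld_def Gcd_fld_def Lcm_fld_def)

end

instance fld :: (field) field_gcd ..

text \<open>The isomorphism of the polynomial ring in three variables with an iterated ring of univariate
  polynomials. It carries unique factorization over from there.\<close>

definition to_tower_var :: "3 \<Rightarrow> 'a::field fld poly poly poly" where
  "to_tower_var v = (if v = 1 then [:[:monom 1 1:]:] else if v = 2 then [:monom 1 1:] else monom 1 1)"

definition to_tower :: "(3, 'a::field) mpoly \<Rightarrow> 'a fld poly poly poly" where
  "to_tower = subst (\<lambda>c. [:[:[:to_fld c:]:]:]) to_tower_var"

lemma to_fld_simps:
  "to_fld 0 = 0" "to_fld 1 = 1" "to_fld (a + b) = to_fld a + to_fld b"
  "to_fld (a * b) = to_fld a * to_fld b"
  by (simp_all add: zero_fld_def one_fld_def plus_fld_def times_fld_def to_fld_inverse)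

lemma coeff_hom_to_fld: "coeff_hom (\<lambda>c. [:[:[:to_fld c:]:]:])"
  by unfold_locales (simp_all add: to_fld_simps)

lemma coeff_hom_to_tower: "coeff_hom to_tower"
  unfolding to_tower_def by (rule coeff_hom_subst[OF coeff_hom_to_fld])

lemma to_tower_1 [simp]: "to_tower 1 = 1"
  unfolding to_tower_def by (rule subst_one[OF coeff_hom_to_fld]) (simp add: to_fld_simps one_pCons)

lemmas to_tower_mult = coeff_hom.hom_mult[OF coeff_hom_to_tower]
  and to_tower_add = coeff_hom.hom_add[OF coeff_hom_to_tower]

lemma to_tower_0 [simp]: "to_tower 0 = 0"
  by (rule coeff_hom.hom_zero[OF coeff_hom_to_tower])

lemma to_tower_const: "to_tower (const c) = [:[:[:to_fld c:]:]:]"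
  unfolding to_tower_def by (rule subst_const_coeff[OF coeff_hom_to_fld])

lemma to_tower_var: "to_tower (var v) = to_tower_var v"
  unfolding to_tower_def
  by (rule subst_var_coeff[OF coeff_hom_to_fld]) (simp add: to_fld_simps one_pCons)

lemma monom_subst_3:
  "monom_subst x m = x 1 ^ lookup m 1 * x 2 ^ lookup m 2
    * x (3::3) ^ lookup m 3"
proof -
  have "monom_subst x m = (\<Prod>v\<in>UNIV. x v ^ lookup m v)"
    by (rule monom_subst_superset) simp_all
  then show ?thesis unfolding UNIV_3 by (simp add: mult.assoc)
qed

lemma monom_degree_3:
  "monom_degree m = lookup m 1 + lookup m 2 + lookup m (3::3)"
proof -
  have "monom_degree m = (\<Sum>v\<in>UNIV. lookup m v)"
    by (rule monom_degree_superset) simp_all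
  then show ?thesis by (simp only: sum_3)
qed

definition mono3 :: "nat \<Rightarrow> nat \<Rightarrow> nat \<Rightarrow> 3 \<Rightarrow>\<^sub>0 nat" where
  "mono3 i j k = single 1 i + single 2 j + single 3 k"

lemma lookup_mono3 [simp]:
  "lookup (mono3 i j k) 1 = i" "lookup (mono3 i j k) 2 = j"
  "lookup (mono3 i j k) 3 = k"
  by (simp_all add: mono3_def lookup_add lookup_single when_def)

lemma mono3_eqI:
  "lookup m 1 = lookup n 1 \<Longrightarrow> lookup m 2 = lookup n 2
    \<Longrightarrow> lookup m 3 = lookup n (3::3) \<Longrightarrow> m = n"
  by (rule poly_mapping_eqI) (metis exhaust_3)

lemma mono3_eq_iff: "mono3 i j k = m \<longleftrightarrow>
   i = lookup m 1 \<and> j = lookup m 2 \<and> k = lookup m 3"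
  by (metis lookup_mono3 mono3_eqI)

lemma eq_mono3_iff: "m = mono3 i j k \<longleftrightarrow>
   lookup m 1 = i \<and> lookup m 2 = j \<and> lookup m 3 = k"
  by (metis lookup_mono3 mono3_eqI)

lemma mono3_lookup [simp]:
  "mono3 (lookup m 1) (lookup m 2) (lookup m 3) = m"
  by (simp add: mono3_eq_iff)

lemma to_tower_eq:
  "to_tower p = (\<Sum>m\<in>keys p. monom (monom (monom (to_fld (lookup p m))
     (lookup m 1)) (lookup m 2)) (lookup m 3))"
proof -
  have pow1: "[:p:] ^ n = [:p ^ n:]" for p :: "'a fld poly poly" and n
    by (induction n) (simp_all add: one_pCons)
  have pow2: "[:p:] ^ n = [:p ^ n:]" for p :: "'a fld poly" and n
    by (induction n) (simp_all add: one_pCons)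
  have "[:[:[:c:]:]:] * ([:[:monom 1 1:]:] ^ i * [:monom 1 1:] ^ j * monom 1 1 ^ k)
      = monom (monom (monom c i) j) k" for c :: "'a fld" and i j k
    by (simp add: monom_power smult_monom pow1 pow2)
  then show ?thesis
    by (simp add: to_tower_def subst_def monom_subst_3 to_tower_var_def)
qed

lemma coeff_to_tower:
  "coeff (coeff (coeff (to_tower p) k) j) i = to_fld (lookup p (mono3 i j k))"
proof -
  have "coeff (coeff (coeff (to_tower p) k) j) i =
    (\<Sum>m\<in>keys p. if m = mono3 i j k then to_fld (lookup p (mono3 i j k)) else 0)"
    unfolding to_tower_eq coeff_sum
    by (intro sum.cong refl) (auto simp: eq_mono3_iff)
  then show ?thesis by (auto simp: sum.delta in_keys_iff to_fld_simps)
qed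

lemma inj_to_tower: "to_tower p = to_tower q \<Longrightarrow> p = q"
proof (rule poly_mapping_eqI)
  fix m assume "to_tower p = to_tower q"
  then have "to_fld (lookup p m) = to_fld (lookup q m)"
    using coeff_to_tower[of p "lookup m 3" "lookup m 2" "lookup m 1"]
      coeff_to_tower[of q "lookup m 3" "lookup m 2" "lookup m 1"]
    by (metis mono3_eq_iff)
  then show "lookup p m = lookup q m"
    by (simp add: to_fld_inject)
qed

lemma surj_to_tower: "\<exists>p. to_tower p = P"
proof -
  let ?R = "range to_tower"
  have plus: "a + b \<in> ?R" if "a \<in> ?R" "b \<in> ?R" for a b :: "'a fld poly poly poly"
    using that by (metis (no_types, opaque_lifting) rangeE rangeI to_tower_add)
  have times: "a * b \<in> ?R" if "a \<in> ?R" "b \<in> ?R" for a b :: "'a fld poly poly poly"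
    using that by (metis (no_types, opaque_lifting) rangeE rangeI to_tower_mult)
  have vars: "to_tower_var v \<in> ?R" for v
    by (metis rangeI to_tower_var)
  have c1: "[:[:[:c:]:]:] \<in> ?R" for c :: "'a fld"
    by (metis rangeI to_tower_const of_fld_inverse)
  have c2: "[:[:p:]:] \<in> ?R" for p :: "'a fld poly"
  proof (induction p)
    case 0
    then show ?case by (metis rangeI to_tower_0 pCons_0_0)
  next
    case (pCons a p)
    have "[:[:pCons a p:]:] = [:[:[:a:]:]:] + to_tower_var 1 * [:[:p:]:]"
      by (simp add: to_tower_var_def monom_Suc)
    then show ?case by (metis plus times vars c1 pCons.IH)
  qed
  have c3: "[:p:] \<in> ?R" for p :: "'a fld poly poly"
  proof (induction p)
    case 0
    then show ?case by (metis rangeI to_tower_0 pCons_0_0)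
  next
    case (pCons a p)
    have "[:pCons a p:] = [:[:a:]:] + to_tower_var 2 * [:p:]"
      by (simp add: to_tower_var_def monom_Suc)
    then show ?case by (metis plus times vars c2 pCons.IH)
  qed
  have "P \<in> ?R"
  proof (induction P)
    case 0
    then show ?case by (metis rangeI to_tower_0)
  next
    case (pCons a P)
    have "pCons a P = [:a:] + to_tower_var 3 * P"
      by (simp add: to_tower_var_def monom_Suc)
    then show ?case by (metis plus times vars c3 pCons.IH)
  qed
  then show ?thesis by auto
qed

lemma to_tower_dvd_iff: "to_tower p dvd to_tower q \<longleftrightarrow> p dvd q"
proof
  assume "to_tower p dvd to_tower q"
  then obtain R where "to_tower q = to_tower p * R" by (rule dvdE)
  moreover obtain r where "to_tower r = R" using surj_to_tower by blast
  ultimately have "q = p * r" by (intro inj_to_tower) (simp add: to_tower_mult)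
  then show "p dvd q" by simp
next
  assume "p dvd q"
  then show "to_tower p dvd to_tower q" by (auto simp: dvd_def to_tower_mult)
qed

lemma to_tower_eq_0_iff [simp]: "to_tower p = 0 \<longleftrightarrow> p = 0"
  by (metis inj_to_tower to_tower_0)

definition tower_gcd :: "'a::field triple \<Rightarrow> 'a fld poly poly poly" where
  "tower_gcd F = gcd (to_tower (F 1)) (gcd (to_tower (F 2)) (to_tower (F 3)))"

lemma dvd_tower_gcd_iff: "to_tower h dvd tower_gcd F \<longleftrightarrow> (\<forall>i. h dvd F i)"
  by (simp add: tower_gcd_def to_tower_dvd_iff forall_3)

lemma no_common_factor_iff: "no_common_factor F \<longleftrightarrow> is_unit (tower_gcd F)"
proof
  assume "no_common_factor F"
  obtain h where h: "to_tower h = tower_gcd F" using surj_to_tower by blast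
  then have "\<forall>i. h dvd F i" using dvd_tower_gcd_iff[of h F] by simp
  then have "h dvd 1" using \<open>no_common_factor F\<close> by (simp add: no_common_factor_def)
  then show "is_unit (tower_gcd F)" using h to_tower_dvd_iff[of h 1] by simp
next
  assume *: "is_unit (tower_gcd F)"
  show "no_common_factor F"
    unfolding no_common_factor_def
  proof (intro allI impI)
    fix h assume "\<forall>i. h dvd F i"
    then have "to_tower h dvd to_tower 1" using dvd_tower_gcd_iff[of h F] * dvd_trans by auto
    then show "h dvd 1" by (simp only: to_tower_dvd_iff)
  qed
qed

definition mult_triple :: "(3, 'a::field) mpoly \<Rightarrow> 'a triple \<Rightarrow> 'a triple" where
  "mult_triple h G = (\<lambda>i. h * G i)"

lemma remove_common_factor:
  assumes "F \<noteq> (\<lambda>i. 0)"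
  obtains h G where "F = mult_triple h G" "h \<noteq> 0" "no_common_factor G"
proof -
  obtain h where h: "to_tower h = tower_gcd F" using surj_to_tower by blast
  then have "\<forall>i. h dvd F i" using dvd_tower_gcd_iff[of h F] by simp
  then have "\<forall>i. \<exists>g. F i = h * g" by (simp add: dvd_def)
  then obtain G where G: "\<And>i. F i = h * G i" by metis
  have "h \<noteq> 0" using assms G by auto
  have "no_common_factor G"
    unfolding no_common_factor_def
  proof (intro allI impI)
    fix g assume "\<forall>i. g dvd G i"
    then have "\<forall>i. h * g dvd F i" using G by (simp add: mult_dvd_mono)
    then have "to_tower (h * g) dvd to_tower h" using h dvd_tower_gcd_iff[of "h * g" F] by simp
    then have "h * g dvd h" by (simp only: to_tower_dvd_iff)
    then have "h * g dvd h * 1" by simp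
    then show "g dvd 1" using \<open>h \<noteq> 0\<close> by (simp only: dvd_mult_cancel_left) simp
  qed
  then show ?thesis using that[of h G] G \<open>h \<noteq> 0\<close> by (auto simp: mult_triple_def)
qed

lemma no_common_factor_nonzero: "no_common_factor G \<Longrightarrow> G \<noteq> (\<lambda>i. 0)"
  by (auto simp: no_common_factor_def dest: spec[of _ 0])

text \<open>A triple without common factor is the primitive representative of its map: \<open>G i\<close> divides
  \<open>F i * G j\<close> for all \<open>j\<close>, hence \<open>F i\<close> times the greatest common divisor of \<open>G\<close>.\<close>

lemma same_map_multiple:
  assumes "no_common_factor G" "same_map F G"
  obtains h where "F = mult_triple h G"
proof -
  obtain i where i: "G i \<noteq> 0" using no_common_factor_nonzero[OF assms(1)] by auto
  let ?t = to_tower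
  have "F i * G j = F j * G i" for j using assms(2) by (simp add: same_map_def)
  then have "?t (G i) dvd ?t (F i) * ?t (G j)" for j by (simp flip: to_tower_mult add: to_tower_dvd_iff)
  moreover have "X dvd c * gcd a b" if "X dvd c * a" "X dvd c * b" for X a b c :: "'a fld poly poly poly"
  proof -
    have "X dvd gcd (c * a) (c * b)" using that by simp
    also have "gcd (c * a) (c * b) = normalize (c * gcd a b)" by (simp add: gcd_mult_left normalize_mult)
    finally show ?thesis by simp
  qed
  ultimately have "?t (G i) dvd ?t (F i) * tower_gcd G" by (simp add: tower_gcd_def)
  then have "?t (G i) dvd ?t (F i)"
    using assms(1) by (simp add: no_common_factor_iff dvd_mult_unit_iff)
  then obtain h where h: "F i = G i * h" by (auto simp: to_tower_dvd_iff)
  have "F j = h * G j" for j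
  proof -
    have "F j * G i = h * G j * G i" using assms(2) h by (simp add: same_map_def ac_simps)
    then show ?thesis using i by simp
  qed
  then show ?thesis using that by (auto simp: mult_triple_def)
qed

text \<open>The members of the net spanned by \<open>G\<close> that are parametrized by a conic in the dual plane. Any
  three of them span the net, so a one-parameter family serves as a supply of general members.\<close>

definition conic_form :: "'a::field \<Rightarrow> 'a triple \<Rightarrow> (3, 'a) mpoly" where
  "conic_form t G = G 1 + const t * G 2 + const (t ^ 2) * G 3"

lemma finite_if_no_three:
  assumes "\<And>a b c. a \<in> S \<Longrightarrow> b \<in> S \<Longrightarrow> c \<in> S \<Longrightarrow> a \<noteq> b \<Longrightarrow> a \<noteq> c \<Longrightarrow> b \<noteq> c \<Longrightarrow> False"
  shows "finite S"
proof (rule ccontr)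
  assume "infinite S"
  then obtain T where "T \<subseteq> S" "card T = 3" by (metis infinite_arbitrarily_large)
  then obtain a b c where "T = {a, b, c}" "a \<noteq> b" "a \<noteq> c" "b \<noteq> c" by (auto simp: card_3_iff)
  then show False using assms \<open>T \<subseteq> S\<close> by auto
qed

text \<open>Three members of the family determine all three entries of \<open>G\<close>, by a Vandermonde
  determinant; so an element that does not divide all of \<open>G\<close> divides at most two of them.\<close>

lemma conic_form_dvd_unique:
  fixes G :: "'a::field triple"
  assumes "Q dvd conic_form a G" "Q dvd conic_form b G" "Q dvd conic_form c G"
    and "a \<noteq> b" "a \<noteq> c" "b \<noteq> c"
  shows "Q dvd G i"
proof -
  have cancel: "Q dvd X" if "Q dvd const k * X" "k \<noteq> 0" for k and X :: "(3, 'a) mpoly"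
  proof -
    have "const (inverse k) * (const k * X) = X"
      using that(2) by (simp flip: mult.assoc const_mult add: const_1)
    then show ?thesis using dvd_mult[OF that(1), of "const (inverse k)"] by (simp only:)
  qed
  have slope: "Q dvd G 2 + const (a + s) * G 3" if "Q dvd conic_form s G" "a \<noteq> s" for s
  proof -
    have "conic_form a G - conic_form s G = const (a - s) * (G 2 + const (a + s) * G 3)"
      by (simp add: conic_form_def algebra_simps const_diff const_add const_mult power2_eq_square)
    then have *: "Q dvd const (a - s) * (G 2 + const (a + s) * G 3)"
      using dvd_diff[OF assms(1) that(1)] by simp
    show ?thesis by (rule cancel[OF *]) (use that(2) in simp)
  qed
  have "(G 2 + const (a + b) * G 3) - (G 2 + const (a + c) * G 3) = const (b - c) * G 3"
    by (simp add: algebra_simps const_diff const_add)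
  then have *: "Q dvd const (b - c) * G 3"
    using dvd_diff[OF slope[OF assms(2,4)] slope[OF assms(3,5)]] by simp
  have 3: "Q dvd G 3" by (rule cancel[OF *]) (use assms(6) in simp)
  then have 2: "Q dvd G 2"
    using slope[OF assms(2,4)] by (simp add: dvd_add_left_iff)
  have "Q dvd G 1"
    using assms(1) 2 3 by (simp add: conic_form_def dvd_add_left_iff)
  then show ?thesis using 2 3 exhaust_3[of i] by auto
qed

text \<open>Each of the finitely many primes of \<open>Q\<close> divides at most two members of the family, so all other
  members are coprime to \<open>Q\<close>. The conclusion spells out what coprimality is used for.\<close>

lemma finite_conic_form_not_coprime:
  fixes G :: "'a::field triple"
  assumes "no_common_factor G" "Q \<noteq> 0"
  shows "finite {t. \<exists>n X. conic_form t G ^ n dvd Q * X \<and> \<not> conic_form t G ^ n dvd X}"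
proof -
  let ?P = "prime_factors (to_tower Q)"
  have fin: "finite {t. p dvd to_tower (conic_form t G)}" if p: "p \<in> ?P" for p
  proof (rule finite_if_no_three)
    fix a b c assume *: "a \<in> {t. p dvd to_tower (conic_form t G)}" "b \<in> {t. p dvd to_tower (conic_form t G)}"
      "c \<in> {t. p dvd to_tower (conic_form t G)}" "a \<noteq> b" "a \<noteq> c" "b \<noteq> c"
    obtain q where q: "to_tower q = p" using surj_to_tower by blast
    have "q dvd conic_form t G" if "t \<in> {a, b, c}" for t
      using that *(1-3) by (auto simp flip: q simp: to_tower_dvd_iff)
    then have "q dvd G i" for i using *(4-6) by (intro conic_form_dvd_unique[of q a G b c]) auto
    then have "q dvd 1" using assms(1) by (simp add: no_common_factor_def)
    then have "is_unit p" using q to_tower_dvd_iff[of q 1] by simp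
    moreover have "prime p" using p by auto
    ultimately show False using not_prime_unit by blast
  qed
  have "{t. \<exists>n X. conic_form t G ^ n dvd Q * X \<and> \<not> conic_form t G ^ n dvd X}
      \<subseteq> (\<Union>p\<in>?P. {t. p dvd to_tower (conic_form t G)})"
  proof (rule subsetI, rule ccontr)
    fix t assume t: "t \<in> {t. \<exists>n X. conic_form t G ^ n dvd Q * X \<and> \<not> conic_form t G ^ n dvd X}"
      and *: "t \<notin> (\<Union>p\<in>?P. {t. p dvd to_tower (conic_form t G)})"
    have "coprime (to_tower (conic_form t G)) (to_tower Q)"
    proof (rule ccontr)
      assume "\<not> coprime (to_tower (conic_form t G)) (to_tower Q)"
      then have "\<not> is_unit (gcd (to_tower (conic_form t G)) (to_tower Q))"
        by (simp only: is_unit_gcd not_False_eq_True)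
      moreover have "gcd (to_tower (conic_form t G)) (to_tower Q) \<noteq> 0"
        using assms(2) by simp
      ultimately obtain p where "prime p" "p dvd gcd (to_tower (conic_form t G)) (to_tower Q)"
        using prime_divisor_exists by blast
      then have "prime p" "p dvd to_tower (conic_form t G)" "p dvd to_tower Q" by simp_all
      then show False using * assms(2) by (auto simp: prime_factors_dvd)
    qed
    moreover obtain n X where nX: "conic_form t G ^ n dvd Q * X" "\<not> conic_form t G ^ n dvd X"
      using t by auto
    ultimately have "coprime (to_tower (conic_form t G ^ n)) (to_tower Q)"
      by (simp add: ring_hom_power[OF coeff_hom_to_tower])
    moreover have "to_tower (conic_form t G ^ n) dvd to_tower Q * to_tower X"
      using nX(1) by (simp flip: to_tower_mult add: to_tower_dvd_iff)
    ultimately show False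
      using nX(2) by (simp add: coprime_dvd_mult_right_iff to_tower_dvd_iff)
  qed
  then show ?thesis
    by (rule finite_subset) (use fin in auto)
qed

section \<open>The degree of a rational map\<close>

lemma var_neq_0 [simp]: "var v \<noteq> (0 :: ('v, 'a::comm_ring_1) mpoly)"
proof
  assume "var v = (0 :: ('v, 'a) mpoly)"
  then have "ev (\<lambda>_. 1) (var v) = (0 :: 'a)" by simp
  then show False by simp
qed

lemma homogeneous_cofactor:
  fixes p q :: "(3, 'a::field) mpoly"
  assumes "homogeneous e (p * q)" "p * q \<noteq> 0" "homogeneous i p"
  shows "i \<le> e" "homogeneous (e - i) q"
proof -
  obtain j where j: "homogeneous j q"
    using homogeneous_factor[of e q p] assms by (auto simp: mult.commute)
  have "i + j = e"
    using homogeneous_mult[OF assms(3) j] assms(1,2) homogeneous_unique by blast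
  then show "i \<le> e" "homogeneous (e - i) q" using j by auto
qed

lemma hom_triple_homogeneous: "hom_triple d F \<Longrightarrow> homogeneous d (F i)"
  by (simp add: hom_triple_def)

lemma hom_triple_factor:
  assumes "hom_triple d (mult_triple h G)"
  obtains i where "homogeneous i h" "h \<noteq> 0" "i \<le> d" "hom_triple (d - i) G"
proof -
  have h: "homogeneous d (h * G j)" for j using assms by (simp add: hom_triple_def mult_triple_def)
  obtain j where j: "h * G j \<noteq> 0" using assms unfolding hom_triple_def mult_triple_def by meson
  obtain i where i: "homogeneous i h" using homogeneous_factor[OF h j] .
  have "homogeneous (d - i) (G k)" for k
    using homogeneous_cofactor(2)[OF h _ i, of k] j by (cases "G k = 0") auto
  then have "hom_triple (d - i) G" using j by (auto simp: hom_triple_def)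
  then show ?thesis using that[OF i] j homogeneous_cofactor(1)[OF h j i] by auto
qed

lemma hom_triple_mult:
  "homogeneous i h \<Longrightarrow> h \<noteq> 0 \<Longrightarrow> hom_triple d F \<Longrightarrow> hom_triple (i + d) (mult_triple h F)"
  by (auto simp: hom_triple_def mult_triple_def fun_eq_iff intro: homogeneous_mult)

text \<open>A reduced triple of degree \<open>e\<close> represents a rational map of degree \<open>e\<close>.\<close>

definition reduced :: "nat \<Rightarrow> 'a::field triple \<Rightarrow> bool" where
  "reduced e G \<longleftrightarrow> hom_triple e G \<and> no_common_factor G"

lemma reducedD: "reduced e G \<Longrightarrow> hom_triple e G" "reduced e G \<Longrightarrow> no_common_factor G"
  by (auto simp: reduced_def)

lemma same_map_mult_left:
  "h \<noteq> 0 \<Longrightarrow> same_map (mult_triple h F) G \<longleftrightarrow> same_map F G"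
  by (simp add: same_map_def mult_triple_def mult.assoc)

lemma same_map_sym: "same_map F G \<Longrightarrow> same_map G F"
  unfolding same_map_def by (metis mult.commute)

lemma same_map_refl [simp]: "same_map F F"
  by (simp add: same_map_def mult.commute)

lemma same_map_mult_right:
  "h \<noteq> 0 \<Longrightarrow> same_map F (mult_triple h G) \<longleftrightarrow> same_map F G"
  using same_map_mult_left[of h G F] same_map_sym[of F] same_map_sym[of _ F] by blast

text \<open>Proportionality is transitive only through a nonzero triple; this is why the compositions below
  have to be shown to be nonzero.\<close>

lemma same_map_trans:
  fixes F G H :: "'a::field triple"
  assumes "same_map F G" "same_map G H" "G \<noteq> (\<lambda>i. 0)"
  shows "same_map F H"
  unfolding same_map_def
proof (intro allI)
  fix i j
  obtain k where k: "G k \<noteq> 0" using assms(3) by auto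
  have FG: "F a * G b = F b * G a" and GH: "G a * H b = G b * H a" for a b
    using assms(1,2) by (simp_all add: same_map_def)
  have "G k * (F i * H j) = (F i * G k) * H j" by (simp add: ac_simps)
  also have "\<dots> = F k * (G i * H j)" using FG[of i k] by (simp add: ac_simps)
  also have "\<dots> = (F k * G j) * H i" using GH[of i j] by (simp add: ac_simps)
  also have "\<dots> = G k * (F j * H i)" using FG[of k j] by (simp add: ac_simps)
  finally show "F i * H j = F j * H i" using k by simp
qed

lemma reduce:
  assumes "hom_triple d F"
  obtains h G e i where "F = mult_triple h G" "h \<noteq> 0" "homogeneous i h" "reduced e G" "d = i + e"
proof -
  obtain h G where *: "F = mult_triple h G" "h \<noteq> 0" "no_common_factor G"
    using remove_common_factor assms by (auto simp: hom_triple_def)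
  obtain i where "homogeneous i h" "i \<le> d" "hom_triple (d - i) G"
    using hom_triple_factor assms * by metis
  then show ?thesis using that[of h G i "d - i"] * by (simp add: reduced_def)
qed

lemma reduced_multiple:
  assumes "hom_triple d F" "reduced e G" "same_map F G"
  obtains h i where "F = mult_triple h G" "h \<noteq> 0" "homogeneous i h" "d = i + e"
proof -
  obtain h where h: "F = mult_triple h G"
    using same_map_multiple[OF reducedD(2)[OF assms(2)] assms(3)] .
  obtain i where i: "homogeneous i h" "h \<noteq> 0" "i \<le> d" "hom_triple (d - i) G"
    using hom_triple_factor assms(1) h by metis
  obtain j where "G j \<noteq> 0" using i(4) unfolding hom_triple_def by meson
  then have "d - i = e"
    using i(4) reducedD(1)[OF assms(2)] homogeneous_unique by (metis hom_triple_def)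
  then show ?thesis using that[OF h] i by simp
qed

lemma map_degree_eqI:
  assumes "reduced e G" "same_map F G" "F \<noteq> (\<lambda>i. 0)"
  shows "map_degree F = e"
  unfolding map_degree_def
proof (rule the_equality)
  show "\<exists>G. hom_triple e G \<and> no_common_factor G \<and> same_map F G"
    using assms by (auto simp: reduced_def)
  fix e' assume "\<exists>G'. hom_triple e' G' \<and> no_common_factor G' \<and> same_map F G'"
  then obtain G' where G': "reduced e' G'" "same_map F G'" by (auto simp: reduced_def)
  have s: "same_map G G'" using assms G' same_map_trans same_map_sym by blast
  have "e' \<le> e" by (rule reduced_multiple[OF reducedD(1)[OF assms(1)] G'(1) s]) simp
  moreover have "e \<le> e'"
    by (rule reduced_multiple[OF reducedD(1)[OF G'(1)] assms(1) same_map_sym[OF s]]) simp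
  ultimately show "e' = e" by simp
qed

lemma hom_triple_nonzero: "hom_triple d F \<Longrightarrow> F \<noteq> (\<lambda>i. 0)"
  by (simp add: hom_triple_def)

lemma map_degree_reduced: "reduced e G \<Longrightarrow> map_degree G = e"
  using map_degree_eqI[of e G G] hom_triple_nonzero[of e G] by (simp add: reduced_def)

lemma map_degree_cong:
  assumes "hom_triple d F" "hom_triple e G" "same_map F G"
  shows "map_degree F = map_degree G"
proof -
  obtain h H r i where H: "G = mult_triple h H" "h \<noteq> 0" "reduced r H" using reduce[OF assms(2)] by metis
  have "same_map G H" "same_map F H"
    using H assms(3) by (auto simp: same_map_mult_left same_map_mult_right same_map_refl)
  then show ?thesis using H(3) assms(1,2) map_degree_eqI hom_triple_nonzero by metis
qed

lemma map_degree_le: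
  assumes "hom_triple d F"
  shows "map_degree F \<le> d"
proof -
  obtain h H r i where H: "F = mult_triple h H" "h \<noteq> 0" "homogeneous i h" "reduced r H" "d = i + r"
    using reduce[OF assms] .
  have "same_map F H" using H(1,2) by (simp add: same_map_mult_left same_map_refl)
  then show ?thesis using H map_degree_eqI hom_triple_nonzero[OF assms] by (metis le_add2)
qed

text \<open>Multiplication by powers of a coordinate turns the reduced triple into triples of all higher
  degrees. So a bound on the degree amounts to a nonzero solution of a homogeneous linear system in
  the coefficients of a triple of a fixed degree.\<close>

lemma map_degree_le_iff:
  assumes "hom_triple d F"
  shows "map_degree F \<le> r \<longleftrightarrow> (\<exists>H. hom_triple r H \<and> same_map F H)"
proof
  assume "\<exists>H. hom_triple r H \<and> same_map F H"
  then show "map_degree F \<le> r" using map_degree_cong[OF assms] map_degree_le by metis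
next
  assume le: "map_degree F \<le> r"
  obtain h H e i where H: "F = mult_triple h H" "h \<noteq> 0" "homogeneous i h" "reduced e H" "d = i + e"
    using reduce[OF assms] .
  have FH: "same_map F H" using H(1,2) by (simp add: same_map_mult_left same_map_refl)
  then have e: "e \<le> r" using le H map_degree_eqI hom_triple_nonzero[OF assms] by metis
  have v: "homogeneous (r - e) (var 1 ^ (r - e) :: (3, 'a) mpoly)"
    using homogeneous_power[OF homogeneous_var, of "r - e" 1] by simp
  have n: "(var 1 :: (3, 'a) mpoly) ^ (r - e) \<noteq> 0" by simp
  have "hom_triple r (mult_triple (var 1 ^ (r - e)) H)"
    using hom_triple_mult[OF v n reducedD(1)[OF H(4)]] e by simp
  moreover have "same_map F (mult_triple (var 1 ^ (r - e)) H)"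
    using FH n by (simp add: same_map_mult_right)
  ultimately show "\<exists>H. hom_triple r H \<and> same_map F H" by blast
qed


section \<open>Dominant maps and composition\<close>

text \<open>Dominance means that the image lies on no curve. It ensures that compositions do not vanish, and
  it makes pullback of forms injective.\<close>

definition dominant :: "'a::field triple \<Rightarrow> bool" where
  "dominant F \<longleftrightarrow> (\<forall>e p. homogeneous e p \<longrightarrow> psubst F p = 0 \<longrightarrow> p = 0)"

lemma dominantD: "dominant F \<Longrightarrow> homogeneous e p \<Longrightarrow> psubst F p = 0 \<Longrightarrow> p = 0"
  by (auto simp: dominant_def)

lemma comp_mult_left: "comp_triple (mult_triple h E) X = mult_triple (psubst X h) (comp_triple E X)"
  by (simp add: comp_triple_def mult_triple_def)

lemma comp_mult_right:
  "hom_triple d E \<Longrightarrow> comp_triple E (mult_triple h X) = mult_triple (h ^ d) (comp_triple E X)"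
  by (auto simp: comp_triple_def mult_triple_def hom_triple_def psubst_scale fun_eq_iff)

lemma mult_mult_triple [simp]: "mult_triple g (mult_triple h F) = mult_triple (g * h) F"
  by (simp add: mult_triple_def mult.assoc)

lemma hom_triple_comp:
  assumes "hom_triple d E" "hom_triple e X" "dominant X"
  shows "hom_triple (d * e) (comp_triple E X)"
proof -
  obtain i where "E i \<noteq> 0" using assms(1) unfolding hom_triple_def by meson
  then have "psubst X (E i) \<noteq> 0" using assms(1,3) dominantD hom_triple_homogeneous by blast
  then have "comp_triple E X \<noteq> (\<lambda>i. 0)" by (auto simp: comp_triple_def fun_eq_iff)
  moreover have "homogeneous (d * e) (psubst X (E i))" for i
    using assms(1,2) by (auto simp: hom_triple_def intro: homogeneous_psubst)
  ultimately show ?thesis by (simp add: hom_triple_def comp_triple_def)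
qed

lemma dominant_comp:
  assumes "dominant E" "dominant X" "hom_triple d E"
  shows "dominant (comp_triple E X)"
  unfolding dominant_def
proof (intro allI impI)
  fix e p assume p: "homogeneous e p" "psubst (comp_triple E X) p = 0"
  then have "psubst X (psubst E p) = 0" by (simp add: psubst_comp_triple)
  moreover have "homogeneous (e * d) (psubst E p)"
    using p(1) assms(3) by (auto simp: hom_triple_def intro: homogeneous_psubst)
  ultimately have "psubst E p = 0" using assms(2) dominantD by blast
  then show "p = 0" using assms(1) p(1) dominantD by blast
qed

lemma dominant_mult_iff:
  assumes "h \<noteq> 0"
  shows "dominant (mult_triple h F) \<longleftrightarrow> dominant F"
  using assms by (auto simp: dominant_def mult_triple_def psubst_scale)

lemma dominant_var [simp]: "dominant var"
  by (simp add: dominant_def)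

lemma hom_triple_var [simp]: "hom_triple 1 var"
proof -
  have "(var :: 'a::field triple) \<noteq> (\<lambda>i. 0)" by (auto dest: fun_cong[of _ _ 1])
  then show ?thesis unfolding hom_triple_def using homogeneous_var by blast
qed

lemma hom_triple_0_const: "hom_triple 0 F \<Longrightarrow> \<exists>c. F = (\<lambda>i. const (c i))"
proof -
  assume F: "hom_triple 0 F"
  have "F i = const (lookup (F i) 0)" for i
  proof (rule poly_mapping_eqI)
    fix m
    have "monom_degree m = 0 \<Longrightarrow> m = (0 :: 3 \<Rightarrow>\<^sub>0 nat)"
      by (auto simp: monom_degree_def in_keys_iff intro: poly_mapping_eqI)
    then show "lookup (F i) m = lookup (const (lookup (F i) 0)) m"
      using homogeneous_lookup[OF hom_triple_homogeneous[OF F], of i m]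
      by (cases "m = 0"; cases "lookup (F i) m = 0") (auto simp: const_def lookup_single when_def)
  qed
  then show ?thesis by (intro exI[of _ "\<lambda>i. lookup (F i) 0"]) (rule ext)
qed

lemma dominant_degree_pos:
  assumes "dominant F" "hom_triple d F"
  shows "d \<ge> 1"
proof (rule ccontr)
  assume "\<not> d \<ge> 1"
  then obtain c where c: "F = (\<lambda>i. const (c i))"
    using assms(2) hom_triple_0_const[of F] by (auto simp: not_less_eq_eq)
  have z: "c i = 0" if "i \<noteq> j" for i j
  proof -
    define p where "p = const (c i) * var j - const (c j) * var i"
    have "homogeneous 1 p" unfolding p_def by (intro homogeneous_diff homogeneous_const_mult homogeneous_var)
    moreover have "psubst F p = 0" by (simp add: p_def c mult.commute)
    ultimately have "p = 0" using assms(1) dominantD by blast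
    then have "ev (\<lambda>k. if k = j then 1 else 0) p = 0" by simp
    then show "c i = 0" using that by (simp add: p_def)
  qed
  have "c i = 0" for i using z[of i "if i = 1 then 2 else 1"] by (auto split: if_splits)
  then have "F = (\<lambda>i. 0)" by (simp add: c)
  then show False using hom_triple_nonzero[OF assms(2)] by simp
qed

lemma reduce_dominant:
  assumes "hom_triple d F" "dominant F"
  obtains h G where "F = mult_triple h G" "h \<noteq> 0" "reduced (map_degree F) G" "dominant G"
    "map_degree F \<ge> 1"
proof -
  obtain h H r i where H: "F = mult_triple h H" "h \<noteq> 0" "reduced r H" using reduce[OF assms(1)] by metis
  have "same_map F H" using H(1,2) by (simp add: same_map_mult_left same_map_refl)
  then have r: "map_degree F = r" using H(3) map_degree_eqI hom_triple_nonzero[OF assms(1)] by metis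
  have "dominant H" using assms(2) H(1,2) by (simp add: dominant_mult_iff)
  then show ?thesis using that[of h H] H r dominant_degree_pos reducedD(1) by blast
qed

lemma map_degree_comp_le:
  assumes "hom_triple d E" "hom_triple e X" "dominant E" "dominant X"
  shows "map_degree (comp_triple E X) \<le> map_degree E * map_degree X"
proof -
  obtain h E' where E: "E = mult_triple h E'" "h \<noteq> 0" "reduced (map_degree E) E'" "dominant E'"
    using reduce_dominant[OF assms(1,3)] by metis
  obtain k X' where X: "X = mult_triple k X'" "k \<noteq> 0" "reduced (map_degree X) X'" "dominant X'"
    using reduce_dominant[OF assms(2,4)] by metis
  have *: "comp_triple E X = mult_triple (psubst X h * k ^ map_degree E) (comp_triple E' X')"
    using comp_mult_right[OF reducedD(1)[OF E(3)], of k X'] comp_mult_left[of h E' X]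
    by (simp flip: E(1) X(1))
  have EX: "hom_triple (d * e) (comp_triple E X)" by (rule hom_triple_comp[OF assms(1,2,4)])
  then have "psubst X h * k ^ map_degree E \<noteq> 0"
    using hom_triple_nonzero[OF EX] by (auto simp: * mult_triple_def)
  then have "same_map (comp_triple E X) (comp_triple E' X')"
    unfolding * by (simp add: same_map_mult_left same_map_refl)
  moreover have EX': "hom_triple (map_degree E * map_degree X) (comp_triple E' X')"
    using E X by (intro hom_triple_comp) (auto dest: reducedD)
  ultimately show ?thesis using map_degree_cong[OF EX EX'] map_degree_le[OF EX'] by simp
qed

lemma same_map_comp_left:
  assumes "same_map E E'"
  shows "same_map (comp_triple E X) (comp_triple E' X)"
  using assms by (simp add: same_map_def comp_triple_def flip: psubst_mult)

lemma same_map_comp_right: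
  assumes X: "hom_triple a X" and Y: "hom_triple b Y" and E: "hom_triple d E" and "same_map X Y"
  shows "same_map (comp_triple E X) (comp_triple E Y)"
proof -
  obtain h Z r i where Z: "Y = mult_triple h Z" "h \<noteq> 0" "reduced r Z" using reduce[OF Y] by metis
  have "same_map X Z" using assms(4) Z(1,2) by (simp add: same_map_mult_right)
  then obtain k j where k: "X = mult_triple k Z" "k \<noteq> 0" using reduced_multiple[OF X Z(3)] by metis
  show ?thesis unfolding k(1) Z(1) comp_mult_right[OF E]
    using k(2) Z(2) by (simp add: same_map_mult_left same_map_mult_right same_map_refl)
qed

section \<open>Linear systems, leading monomials and dimension counts\<close>

lemma nontrivial_solution:
  fixes M :: "'j \<Rightarrow> 'i \<Rightarrow> 'a::field"
  assumes "finite J" "finite I" "card J < card I"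
  shows "\<exists>x. (\<exists>i\<in>I. x i \<noteq> 0) \<and> (\<forall>j\<in>J. (\<Sum>i\<in>I. M j i * x i) = 0)"
  using assms
proof (induction J arbitrary: I M rule: finite_induct)
  case empty
  then have "I \<noteq> {}" by auto
  then show ?case by (intro exI[of _ "\<lambda>_. 1"]) auto
next
  case (insert j0 J)
  show ?case
  proof (cases "\<forall>i\<in>I. M j0 i = 0")
    case True
    have "card J < card I" using insert by auto
    then obtain x where "\<exists>i\<in>I. x i \<noteq> 0" "\<forall>j\<in>J. (\<Sum>i\<in>I. M j i * x i) = 0"
      using insert.IH[of I M] insert.prems by blast
    then show ?thesis using True by (intro exI[of _ x]) auto
  next
    case False
    then obtain i0 where i0: "i0 \<in> I" "M j0 i0 \<noteq> 0" by auto
    let ?I = "I - {i0}"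
    define M' where "M' j i = M j i - M j i0 * M j0 i / M j0 i0" for j i
    have "card J < card ?I" using insert i0 by auto
    then obtain x where x: "\<exists>i\<in>?I. x i \<noteq> 0" "\<forall>j\<in>J. (\<Sum>i\<in>?I. M' j i * x i) = 0"
      using insert.IH[of ?I M'] insert.prems by blast
    define s where "s = (\<Sum>i\<in>?I. M j0 i * x i)"
    define y where "y = x(i0 := - s / M j0 i0)"
    have split: "(\<Sum>i\<in>I. M j i * y i) = - M j i0 * s / M j0 i0 + (\<Sum>i\<in>?I. M j i * x i)" for j
    proof -
      have "(\<Sum>i\<in>I. M j i * y i) = M j i0 * y i0 + (\<Sum>i\<in>?I. M j i * y i)"
        using insert.prems i0 by (intro sum.remove) auto
      also have "(\<Sum>i\<in>?I. M j i * y i) = (\<Sum>i\<in>?I. M j i * x i)"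
        by (intro sum.cong) (auto simp: y_def)
      finally show ?thesis by (simp add: y_def)
    qed
    have "(\<Sum>i\<in>I. M j i * y i) = 0" if "j \<in> insert j0 J" for j
    proof (cases "j = j0")
      case True
      then show ?thesis using split[of j0] i0 by (simp add: s_def)
    next
      case False
      have "(\<Sum>i\<in>?I. M' j i * x i) = (\<Sum>i\<in>?I. M j i * x i) - M j i0 * s / M j0 i0"
        by (simp add: M'_def s_def left_diff_distrib sum_subtractf sum_distrib_left sum_divide_distrib
            mult.assoc)
      then show ?thesis using x(2) False that split[of j] by simp
    qed
    moreover have "\<exists>i\<in>I. y i \<noteq> 0" using x(1) by (auto simp: y_def)
    ultimately show ?thesis by blast
  qed
qed

text \<open>The index sets may exceed the supports, so that products with varying factors can be expanded
  over one index set.\<close>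

lemma lookup_mult_keys:
  fixes p q :: "('v, 'a::comm_ring_1) mpoly"
  assumes "finite A" "keys p \<subseteq> A" "finite B" "keys q \<subseteq> B"
  shows "lookup (p * q) m =
    (\<Sum>a\<in>A. \<Sum>b\<in>B. if a + b = m then lookup p a * lookup q b else 0)"
proof -
  have expand: "(\<Sum>m\<in>A. single m (lookup r m)) = r"
    if "finite A" "keys r \<subseteq> A" for A and r :: "('v, 'a) mpoly"
  proof (rule poly_mapping_eqI)
    fix k
    show "lookup (\<Sum>m\<in>A. single m (lookup r m)) k
        = lookup r k"
    proof (cases "k \<in> A")
      case False
      then have "lookup r k = 0" using that by (auto simp: in_keys_iff)
      then show ?thesis using False that(1)
        by (simp add: lookup_sum lookup_single when_def sum.delta)
    qed (use that(1) in \<open>simp add: lookup_sum lookup_single when_def sum.delta\<close>)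
  qed
  have "p * q = (\<Sum>a\<in>A. \<Sum>b\<in>B. single (a + b) (lookup p a * lookup q b))"
    using expand[OF assms(1,2)] expand[OF assms(3,4)]
    by (metis (no_types, lifting) mult_single sum.cong sum_product)
  then show ?thesis by (simp add: lookup_sum lookup_single when_def)
qed

definition lead_mono :: "(3, 'a::field) mpoly \<Rightarrow> 3 \<Rightarrow>\<^sub>0 nat" where
  "lead_mono p = Max (keys p)"

lemma lead_mono_in_keys: "p \<noteq> 0 \<Longrightarrow> lead_mono p \<in> keys p"
  by (simp add: lead_mono_def)

text \<open>The order on exponents is compatible with addition, so the product of the leading terms cannot
  cancel.\<close>

lemma lead_mono_mult_in_keys:
  assumes "p \<noteq> 0" "q \<noteq> 0"
  shows "lead_mono p + lead_mono q \<in> keys (p * q)"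
proof -
  let ?a = "lead_mono p" and ?b = "lead_mono q"
  have le: "a \<le> ?a" if "a \<in> keys p" for a using that by (simp add: lead_mono_def)
  have le': "b \<le> ?b" if "b \<in> keys q" for b using that by (simp add: lead_mono_def)
  have eq: "a = ?a \<and> b = ?b" if "a \<in> keys p" "b \<in> keys q" "a + b = ?a + ?b" for a b
  proof -
    have "a = ?a"
    proof (rule ccontr)
      assume "a \<noteq> ?a"
      then have "a < ?a" using le that by fastforce
      then have "a + b < ?a + ?b" using le'[OF that(2)] by (rule add_less_le_mono)
      then show False using that(3) by simp
    qed
    then show ?thesis using that(3) by simp
  qed
  have "lookup (p * q) (?a + ?b) =
    (\<Sum>a\<in>keys p. \<Sum>b\<in>keys q. if b = ?b then (if a = ?a then
       lookup p ?a * lookup q ?b else 0) else 0)"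
    unfolding lookup_mult_keys[OF finite_keys order_refl finite_keys order_refl]
    by (intro sum.cong refl) (use eq in auto)
  also have "\<dots> = lookup p ?a * lookup q ?b"
    using lead_mono_in_keys[OF assms(1)] lead_mono_in_keys[OF assms(2)] by simp
  finally show ?thesis
    using lead_mono_in_keys[OF assms(1)] lead_mono_in_keys[OF assms(2)] by (simp add: in_keys_iff)
qed

definition monoms :: "nat \<Rightarrow> (3 \<Rightarrow>\<^sub>0 nat) set" where
  "monoms e = {m. monom_degree m = e}"

lemma monoms_eq: "monoms e = (\<lambda>(i, j). mono3 i j (e - i - j)) ` (SIGMA i:{..e}. {..e - i})"
proof (rule set_eqI, rule iffI)
  fix m :: "3 \<Rightarrow>\<^sub>0 nat"
  assume "m \<in> monoms e"
  then have "m = mono3 (lookup m 1) (lookup m 2)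
      (e - lookup m 1 - lookup m 2)"
    "lookup m 1 \<le> e" "lookup m 2 \<le> e - lookup m 1"
    by (auto simp: monoms_def monom_degree_3 eq_mono3_iff)
  then show "m \<in> (\<lambda>(i, j). mono3 i j (e - i - j)) ` (SIGMA i:{..e}. {..e - i})"
    by (intro image_eqI[of _ _ "(lookup m 1, lookup m 2)"]) auto
qed (auto simp: monoms_def monom_degree_3)

lemma finite_monoms [simp]: "finite (monoms e)"
  unfolding monoms_eq by auto

lemma card_monoms: "2 * card (monoms e) = (e + 1) * (e + 2)"
proof -
  have "inj_on (\<lambda>(i, j). mono3 i j (e - i - j)) (SIGMA i:{..e}. {..e - i})"
    by (auto simp: inj_on_def mono3_eq_iff)
  then have "card (monoms e) = (\<Sum>i\<le>e. e - i + 1)"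
    unfolding monoms_eq by (simp add: card_image)
  also have "\<dots> = (\<Sum>i\<le>e. i + 1)"
    by (rule sum.reindex_bij_witness[of _ "\<lambda>i. e - i" "\<lambda>i. e - i"]) auto
  also have "2 * \<dots> = (e + 1) * (e + 2)"
    by (induction e) auto
  finally show ?thesis .
qed

text \<open>Monomials of degree \<open>A\<close> that are not multiples of the leading monomial of \<open>q\<close>. They span a
  complement of the multiples of \<open>q\<close> in degree \<open>A\<close>.\<close>

definition complement_monoms :: "(3, 'a::field) mpoly \<Rightarrow> nat \<Rightarrow> (3 \<Rightarrow>\<^sub>0 nat) set" where
  "complement_monoms q A = monoms A - range ((+) (lead_mono q))"

lemma finite_complement_monoms [simp]: "finite (complement_monoms q A)"
  by (simp add: complement_monoms_def)

lemma complement_monoms_not_dvd: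
  assumes "q \<noteq> 0" "q dvd p" "keys p \<subseteq> complement_monoms q A"
  shows "p = 0"
proof (rule ccontr)
  assume "p \<noteq> 0"
  obtain r where r: "p = q * r" using assms(2) by (rule dvdE)
  then have "r \<noteq> 0" using \<open>p \<noteq> 0\<close> by auto
  then have "lead_mono q + lead_mono r \<in> keys p"
    using r assms(1) lead_mono_mult_in_keys by blast
  then show False using assms(3) by (auto simp: complement_monoms_def)
qed

lemma card_complement_monoms:
  assumes "homogeneous e q" "q \<noteq> 0" "e \<le> A"
  shows "card (complement_monoms q A) + card (monoms (A - e)) = card (monoms A)"
proof -
  have e: "monom_degree (lead_mono q) = e"
    using assms(1) lead_mono_in_keys[OF assms(2)] by (simp add: homogeneous_def)
  have sub: "(+) (lead_mono q) ` monoms (A - e) \<subseteq> monoms A"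
    using assms(3) e by (auto simp: monoms_def monom_degree_add)
  have "monoms A \<inter> range ((+) (lead_mono q)) = (+) (lead_mono q) ` monoms (A - e)"
    using sub e by (auto simp: monoms_def monom_degree_add)
  then have "complement_monoms q A = monoms A - (+) (lead_mono q) ` monoms (A - e)"
    by (auto simp: complement_monoms_def)
  moreover have "card ((+) (lead_mono q) ` monoms (A - e)) = card (monoms (A - e))"
    by (simp add: card_image)
  moreover have "card ((+) (lead_mono q) ` monoms (A - e)) \<le> card (monoms A)"
    by (rule card_mono[OF finite_monoms sub])
  moreover have "card (monoms A - (+) (lead_mono q) ` monoms (A - e))
      = card (monoms A) - card ((+) (lead_mono q) ` monoms (A - e))"
    by (rule card_Diff_subset) (simp_all add: sub)
  ultimately show ?thesis by simp
qed

lemma card_complement_monoms_ge: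
  assumes "homogeneous e q" "q \<noteq> 0" "e \<le> A"
  shows "e * A \<le> 2 * card (complement_monoms q A)"
proof -
  obtain k where A: "A = e + k" using assms(3) by (metis le_add_diff_inverse)
  have "2 * card (complement_monoms q A) + (k + 1) * (k + 2) = (A + 1) * (A + 2)"
    using card_complement_monoms[OF assms] card_monoms[of k] card_monoms[of A] A by simp
  then show ?thesis unfolding A by (simp add: algebra_simps)
qed

text \<open>Divisibility of a form of degree \<open>D\<close> by the \<open>M\<close>-th power of a linear form imposes at most
  \<open>M (D + 1)\<close> linear conditions: a linear change of coordinates turns the linear form into a
  coordinate.\<close>

definition straighten :: "'a::field \<Rightarrow> 'a triple" where
  "straighten t = (\<lambda>i. if i = 1 then var 1 - const t * var 2 - const (t ^ 2) * var 3 else var i)"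

lemma dvd_power_conic_form:
  fixes P :: "(3, 'a::field) mpoly"
  assumes "\<And>m. lookup m 1 < M \<Longrightarrow> lookup (psubst (straighten t) P) m = 0"
  shows "conic_form t var ^ M dvd P"
proof -
  define q where "q = psubst (straighten t) P"
  define \<sigma> :: "'a triple" where "\<sigma> = (\<lambda>i. if i = 1 then conic_form t var else var i)"
  have "psubst \<sigma> (straighten t i) = var i" for i
    by (auto simp: straighten_def \<sigma>_def conic_form_def)
  then have P: "P = psubst \<sigma> q" by (simp add: q_def psubst_psubst)
  have "var 1 ^ M dvd q"
  proof -
    have "var 1 ^ M dvd (single m c :: (3, 'a) mpoly)"
      if "lookup m 1 \<ge> M" for m c
    proof -
      have "single m c = const c * monom_subst var m"
        by (simp add: monom_subst_var const_def mult_single)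
      also have "\<dots> = var 1 ^ lookup m 1 * (const c *
          (var 2 ^ lookup m 2 * var 3 ^ lookup m 3))"
        by (simp add: monom_subst_3 ac_simps)
      finally show ?thesis using le_imp_power_dvd[OF that, of "var 1 :: (3, 'a) mpoly"] by simp
    qed
    moreover have "lookup m 1 \<ge> M" if "m \<in> keys q" for m
      using that assms[of m] by (auto simp: q_def in_keys_iff not_less[symmetric])
    ultimately have "var 1 ^ M dvd (\<Sum>m\<in>keys q. single m (lookup q m))"
      by (intro dvd_sum) blast
    also have "(\<Sum>m\<in>keys q. single m (lookup q m)) = q"
      by (intro poly_mapping_eqI) (simp add: lookup_sum lookup_single when_def sum.delta in_keys_iff)
    finally show ?thesis .
  qed
  then obtain r where "q = var 1 ^ M * r" by (rule dvdE)
  then have "P = conic_form t var ^ M * psubst \<sigma> r" by (simp add: P \<sigma>_def)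
  then show ?thesis by simp
qed

lemma card_low_monoms:
  "card {m \<in> monoms D. lookup m 1 < M} \<le> M * (D + 1)"
proof -
  let ?S = "{m \<in> monoms D. lookup m 1 < M}"
  let ?f = "\<lambda>m. (lookup m 1, lookup m (2::3))"
  have inj: "inj_on ?f ?S"
    by (auto simp: inj_on_def monoms_def monom_degree_3 intro!: mono3_eqI)
  have sub: "?f ` ?S \<subseteq> {..<M} \<times> {..D}"
    by (auto simp: monoms_def monom_degree_3)
  have "card ?S \<le> card ({..<M} \<times> {..D})"
    by (rule card_inj_on_le[OF inj sub]) simp
  then show ?thesis by simp
qed

text \<open>In a relation between the powers of coprime \<open>E0\<close> and \<open>E1\<close> the coefficient of the highest power of
  \<open>E0\<close> is divisible by \<open>E1\<close>. Coefficients from a complement of the multiples of \<open>E1\<close> then vanish one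
  after the other.\<close>

lemma independent_products:
  fixes E0 E1 :: "(3, 'a::field) mpoly"
  assumes E1: "E1 \<noteq> 0"
    and cop: "\<And>X. E1 dvd E0 * X \<Longrightarrow> E1 dvd X"
    and keys: "\<And>i. i \<le> B \<Longrightarrow> keys (p i) \<subseteq> complement_monoms E1 A"
    and sum: "(\<Sum>i\<le>B. p i * E0 ^ i * E1 ^ (B - i)) = 0"
    and "i \<le> B"
  shows "p i = 0"
proof -
  have copn: "E1 dvd X" if "E1 dvd E0 ^ n * X" for n X
    using that
  proof (induction n)
    case (Suc n)
    then have "E1 dvd E0 * (E0 ^ n * X)" by (simp add: mult.assoc)
    then show ?case by (rule Suc.IH[OF cop])
  qed simp
  have zero: "p n = 0" if "E1 dvd p n * E0 ^ n" "n \<le> B" for n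
  proof -
    have "E1 dvd E0 ^ n * p n" using that(1) by (simp only: mult.commute)
    then have "E1 dvd p n" by (rule copn)
    then show ?thesis using complement_monoms_not_dvd E1 keys that(2) by blast
  qed
  have "\<forall>i\<le>n. p i = 0" if "(\<Sum>i\<le>n. p i * E0 ^ i * E1 ^ (n - i)) = 0" "n \<le> B" for n
    using that
  proof (induction n)
    case 0
    then show ?case by simp
  next
    case (Suc n)
    have *: "(\<Sum>i\<le>n. p i * E0 ^ i * E1 ^ (Suc n - i)) = E1 * (\<Sum>i\<le>n. p i * E0 ^ i * E1 ^ (n - i))"
      by (simp add: sum_distrib_left Suc_diff_le ac_simps)
    then have "p (Suc n) * E0 ^ Suc n = - (E1 * (\<Sum>i\<le>n. p i * E0 ^ i * E1 ^ (n - i)))"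
      using Suc.prems(1) by (simp add: eq_neg_iff_add_eq_0 add.commute)
    then have "p (Suc n) = 0" using Suc.prems(2) by (intro zero) simp_all
    then have "E1 * (\<Sum>i\<le>n. p i * E0 ^ i * E1 ^ (n - i)) = 0"
      using Suc.prems(1) * by simp
    then have "\<forall>i\<le>n. p i = 0" using E1 Suc by simp
    then show ?case using \<open>p (Suc n) = 0\<close> by (auto simp: le_Suc_eq)
  qed
  then show ?thesis using sum \<open>i \<le> B\<close> by blast
qed

section \<open>The four-point inequality\<close>

lemma psubst_conic_form: "psubst G (conic_form t F) = conic_form t (comp_triple F G)"
  by (simp add: conic_form_def comp_triple_def)

lemma conic_form_mult: "conic_form t (mult_triple h G) = h * conic_form t G"
  by (simp add: conic_form_def mult_triple_def algebra_simps)

lemma homogeneous_conic_form: "hom_triple e G \<Longrightarrow> homogeneous e (conic_form t G)"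
  unfolding conic_form_def hom_triple_def by (intro homogeneous_add homogeneous_const_mult) auto

lemma finite_conic_form_zero:
  fixes G :: "'a::field triple"
  assumes "G \<noteq> (\<lambda>i. 0)"
  shows "finite {t. conic_form t G = 0}"
proof (rule finite_if_no_three)
  fix a b c assume *: "a \<in> {t. conic_form t G = 0}" "b \<in> {t. conic_form t G = 0}"
    "c \<in> {t. conic_form t G = 0}" "a \<noteq> b" "a \<noteq> c" "b \<noteq> c"
  have "0 dvd G i" for i using * by (intro conic_form_dvd_unique[of 0 a G b c]) auto
  then have "G i = 0" for i by (simp only: dvd_0_left_iff)
  then show False using assms by auto
qed

text \<open>A bihomogeneous form of bidegree \<open>(A, B)\<close> evaluated at the triples \<open>F\<close> and \<open>G\<close>, where \<open>G\<close> enters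
  only through two members of its net. The pairs in \<open>I\<close> index the monomials: an exponent of the first
  of these members, and a monomial of degree \<open>A\<close> in \<open>F\<close>.\<close>

definition bi_form :: "'a::field \<Rightarrow> 'a \<Rightarrow> nat \<Rightarrow> (nat \<times> (3 \<Rightarrow>\<^sub>0 nat)) set \<Rightarrow>
    (nat \<times> (3 \<Rightarrow>\<^sub>0 nat) \<Rightarrow> 'a) \<Rightarrow> 'a triple \<Rightarrow> 'a triple \<Rightarrow> (3, 'a) mpoly" where
  "bi_form s t B I a F G = (\<Sum>z\<in>I. const (a z) *
     (monom_subst F (snd z) * conic_form s G ^ fst z * conic_form t G ^ (B - fst z)))"

lemma psubst_monom_subst: "psubst K (monom_subst F m) = monom_subst (comp_triple F K) m"
  by (simp add: monom_subst_3 comp_triple_def)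

lemma psubst_bi_form:
  "psubst K (bi_form s t B I a F G) = bi_form s t B I a (comp_triple F K) (comp_triple G K)"
  unfolding bi_form_def psubst_sum
  by (intro sum.cong refl) (simp add: psubst_monom_subst psubst_conic_form)

lemma monom_subst_mult_triple: "monom_subst (mult_triple h F) m = h ^ monom_degree m * monom_subst F m"
  by (simp add: monom_subst_3 monom_degree_3 mult_triple_def power_mult_distrib power_add ac_simps)

lemma bi_form_mult:
  assumes "I \<subseteq> {..B} \<times> monoms A"
  shows "bi_form s t B I a (mult_triple g F) (mult_triple h G) = g ^ A * h ^ B * bi_form s t B I a F G"
  unfolding bi_form_def sum_distrib_left
proof (intro sum.cong refl)
  fix z assume "z \<in> I"
  then have z: "fst z \<le> B" "monom_degree (snd z) = A" using assms by (auto simp: monoms_def)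
  have "h ^ B = h ^ fst z * h ^ (B - fst z)" using z(1) by (simp flip: power_add)
  then show "const (a z) * (monom_subst (mult_triple g F) (snd z) * conic_form s (mult_triple h G) ^ fst z
      * conic_form t (mult_triple h G) ^ (B - fst z)) = g ^ A * h ^ B * (const (a z) *
      (monom_subst F (snd z) * conic_form s G ^ fst z * conic_form t G ^ (B - fst z)))"
    by (simp add: monom_subst_mult_triple conic_form_mult z(2) power_mult_distrib ac_simps)
qed

lemma homogeneous_monom_subst:
  assumes "hom_triple x F"
  shows "homogeneous (monom_degree m * x) (monom_subst F m)"
proof -
  have "psubst F (single m 1) = monom_subst F m"
    by (simp add: coeff_hom.subst_single[OF coeff_hom_const] const_1)
  then show ?thesis
    using homogeneous_psubst[OF homogeneous_single[of m 1], of x F] assms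
    by (auto simp: hom_triple_def)
qed

lemma homogeneous_bi_form:
  assumes "I \<subseteq> {..B} \<times> monoms A" "hom_triple x F" "hom_triple y G"
  shows "homogeneous (A * x + B * y) (bi_form s t B I a F G)"
  unfolding bi_form_def
proof (intro homogeneous_sum homogeneous_const_mult)
  fix z assume "z \<in> I"
  then have z: "fst z \<le> B" "monom_degree (snd z) = A" using assms by (auto simp: monoms_def)
  have "homogeneous (monom_degree (snd z) * x + fst z * y + (B - fst z) * y)
      (monom_subst F (snd z) * conic_form s G ^ fst z * conic_form t G ^ (B - fst z))"
    by (intro homogeneous_mult homogeneous_power homogeneous_monom_subst homogeneous_conic_form assms)
  moreover have "monom_degree (snd z) * x + fst z * y + (B - fst z) * y = A * x + B * y"
    using z by (metis add.assoc add_mult_distrib le_add_diff_inverse)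
  ultimately show "homogeneous (A * x + B * y)
      (monom_subst F (snd z) * conic_form s G ^ fst z * conic_form t G ^ (B - fst z))" by simp
qed

text \<open>The case \<open>F = var\<close> suffices for all pairs \<open>(X, E X)\<close>, because these arise from \<open>(var, E)\<close> by
  substitution of the dominant triple \<open>X\<close>.\<close>

lemma bi_form_var_nonzero:
  fixes E :: "'a::field triple"
  assumes E1: "conic_form t E \<noteq> 0"
    and cop: "\<And>X. conic_form t E dvd conic_form s E * X \<Longrightarrow> conic_form t E dvd X"
    and I: "I = {..B} \<times> complement_monoms (conic_form t E) A"
    and z: "z \<in> I" "a z \<noteq> 0"
  shows "bi_form s t B I a var E \<noteq> 0"
proof
  assume zero: "bi_form s t B I a var E = 0"
  let ?C = "complement_monoms (conic_form t E) A"
  define p where "p i = (\<Sum>\<mu>\<in>?C. single \<mu> (a (i, \<mu>)))" for i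
  have lp: "lookup (p i) \<mu> = (if \<mu> \<in> ?C then a (i, \<mu>) else 0)" for i \<mu>
    by (simp add: p_def lookup_sum lookup_single when_def sum.delta)
  have "bi_form s t B I a var E = (\<Sum>i\<le>B. \<Sum>\<mu>\<in>?C. const (a (i, \<mu>)) *
     (monom_subst var \<mu> * conic_form s E ^ i * conic_form t E ^ (B - i)))"
    unfolding bi_form_def I by (simp add: sum.cartesian_product case_prod_beta)
  also have "\<dots> = (\<Sum>i\<le>B. p i * conic_form s E ^ i * conic_form t E ^ (B - i))"
    unfolding p_def sum_distrib_right
    by (intro sum.cong refl) (simp add: monom_subst_var const_def mult_single flip: mult.assoc)
  finally have sum: "(\<Sum>i\<le>B. p i * conic_form s E ^ i * conic_form t E ^ (B - i)) = 0"
    using zero by simp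
  have i: "fst z \<le> B" "snd z \<in> ?C" using z I by auto
  have "p (fst z) = 0"
  proof (rule independent_products[OF E1 cop _ sum i(1)])
    show "keys (p i) \<subseteq> ?C" for i by (auto simp: in_keys_iff lp split: if_splits)
  qed
  then show False using lp[of "fst z" "snd z"] z(2) i(2) by simp
qed

text \<open>The sections of the class \<open>A X\<^sup>* H + B Y\<^sup>* H\<close>, for the line class \<open>H\<close>, form a space of dimension
  at least \<open>A B e / 2\<close> if \<open>A \<ge> e\<close>, where \<open>e\<close> is the degree of the map \<open>E\<close> that takes \<open>X\<close> to \<open>Y\<close>. That is more
  than the number of conditions for vanishing to order \<open>e\<^sup>2\<close> along a line, once \<open>A = 8 e y\<close> and
  \<open>B = 8 e x\<close>; and a section that does so gives the inequality when it is pulled back by \<open>K\<close>.\<close>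

lemma four_point_reduced:
  fixes E X Y K X' Y' :: "'a::field triple"
  assumes inf: "infinite (UNIV :: 'a set)"
    and E: "reduced e E" and X: "reduced x X" and Y: "reduced y Y"
    and K: "reduced k K" and X': "reduced x' X'" and Y': "reduced y' Y'"
    and dom: "dominant X" "dominant K"
    and EX: "comp_triple E X = mult_triple \<psi> Y" "\<psi> \<noteq> 0"
    and XK: "comp_triple X K = mult_triple \<phi> X'" "\<phi> \<noteq> 0"
    and YK: "comp_triple Y K = mult_triple \<theta> Y'" "\<theta> \<noteq> 0"
    and pos: "x \<ge> 1" "y \<ge> 1" "e \<ge> 1"
  shows "e * k \<le> 8 * (y * x' + x * y')"
proof -
  \<comment> \<open>The proportion \<open>A : B = y : x\<close> balances the two terms of \<open>D\<close> and of the conclusion; the factor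
    \<open>8 * e\<close> makes the dimension exceed the number of conditions and \<open>A\<close> exceed \<open>e\<close>.\<close>
  define A where "A = 8 * e * y"
  define B where "B = 8 * e * x"
  define D where "D = A * x + B * y"
  define M where "M = e * e"
  obtain s where s: "conic_form s E \<noteq> 0"
    using ex_new_if_finite[OF inf finite_conic_form_zero[OF hom_triple_nonzero[OF reducedD(1)[OF E]]]]
    by auto
  obtain t where t: "conic_form t E \<noteq> 0"
    "\<And>n X. conic_form t E ^ n dvd conic_form s E * X \<Longrightarrow> conic_form t E ^ n dvd X"
    using ex_new_if_finite[OF inf finite_UnI[OF
        finite_conic_form_zero[OF hom_triple_nonzero[OF reducedD(1)[OF E]]]
        finite_conic_form_not_coprime[OF reducedD(2)[OF E] s]]]
    by auto
  \<comment> \<open>The line \<open>r\<close> has to be general: its pullback by \<open>K\<close> must not share factors with the curves that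
    the pullbacks of \<open>X\<close> and \<open>Y\<close> lose.\<close>
  have Q: "\<phi> ^ A * \<theta> ^ B \<noteq> 0" using XK(2) YK(2) by simp
  obtain r where r: "\<And>n X. conic_form r K ^ n dvd \<phi> ^ A * \<theta> ^ B * X \<Longrightarrow> conic_form r K ^ n dvd X"
    using ex_new_if_finite[OF inf finite_conic_form_not_coprime[OF reducedD(2)[OF K] Q]] by auto
  have homE: "homogeneous e (conic_form t E)"
    by (rule homogeneous_conic_form[OF reducedD(1)[OF E]])
  define I where "I = {..B} \<times> complement_monoms (conic_form t E) A"
  define J where "J = {m \<in> monoms D. lookup m 1 < M}"
  have fin: "finite I" "finite J" by (auto simp: I_def J_def)
  have sub: "I \<subseteq> {..B} \<times> monoms A" by (auto simp: I_def complement_monoms_def)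
  have "e \<le> A" using pos by (simp add: A_def)
  then have "(B + 1) * (e * A) \<le> (B + 1) * (2 * card (complement_monoms (conic_form t E) A))"
    by (intro mult_le_mono order_refl card_complement_monoms_ge[OF homE t(1)])
  also have "\<dots> = 2 * card I" by (simp add: I_def card_cartesian_product)
  finally have "(B + 1) * (e * A) \<le> 2 * card I" .
  moreover have "2 * (M * (D + 1)) < (B + 1) * (e * A)"
  proof -
    have "D = 16 * (e * x * y)" by (simp add: D_def A_def B_def)
    moreover have "1 \<le> e * x * y" using pos by simp
    ultimately have "D + 1 \<le> 17 * (e * x * y)" by simp
    then have "2 * (M * (D + 1)) \<le> 2 * (M * (17 * (e * x * y)))" by (intro mult_le_mono order_refl)
    also have "\<dots> = 34 * (e * e * (e * x * y))" by (simp add: M_def)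
    also have "\<dots> < 64 * (e * e * (e * x * y))" using pos by simp
    also have "\<dots> = B * (e * A)" by (simp add: A_def B_def)
    also have "\<dots> \<le> (B + 1) * (e * A)" by simp
    finally show ?thesis .
  qed
  moreover have "card J \<le> M * (D + 1)" unfolding J_def by (rule card_low_monoms)
  ultimately have "card J < card I" by linarith
  then obtain a where a: "\<exists>z\<in>I. a z \<noteq> 0"
    "\<forall>m\<in>J. (\<Sum>z\<in>I. lookup (psubst (straighten r) (monom_subst X (snd z) *
        conic_form s Y ^ fst z * conic_form t Y ^ (B - fst z))) m * a z) = 0"
    using nontrivial_solution[OF fin(2,1), where M = "\<lambda>m z. lookup
      (psubst (straighten r) (monom_subst X (snd z) * conic_form s Y ^ fst z * conic_form t Y ^ (B - fst z))) m"]
    by auto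
  define P where "P = bi_form s t B I a X Y"
  have homP: "homogeneous D P"
    unfolding P_def D_def by (rule homogeneous_bi_form[OF sub reducedD(1)[OF X] reducedD(1)[OF Y]])
  have "conic_form r var ^ M dvd P"
  proof (rule dvd_power_conic_form)
    fix m :: "3 \<Rightarrow>\<^sub>0 nat" assume m: "lookup m 1 < M"
    show "lookup (psubst (straighten r) P) m = 0"
    proof (cases "m \<in> monoms D")
      case True
      then have "m \<in> J" using m by (simp add: J_def)
      have "lookup (psubst (straighten r) P) m
        = (\<Sum>z\<in>I. lookup (const (a z) * psubst (straighten r) (monom_subst X (snd z) *
        conic_form s Y ^ fst z * conic_form t Y ^ (B - fst z))) m)"
        unfolding P_def bi_form_def psubst_sum lookup_sum psubst_mult[of _ "const _"] psubst_const ..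
      also have "\<dots> = 0" using a(2) \<open>m \<in> J\<close> by (simp add: const_mult_lookup mult.commute)
      finally show ?thesis .
    next
      case False
      have "homogeneous 1 (straighten r i)" for i
        unfolding straighten_def using homogeneous_var
        by (auto intro!: homogeneous_diff homogeneous_const_mult simp del: One_nat_def)
      then have "homogeneous (D * 1) (psubst (straighten r) P)" by (intro homogeneous_psubst homP)
      then show ?thesis using False homogeneous_lookup[of D _ m] by (auto simp: monoms_def)
    qed
  qed
  then obtain H where H: "P = conic_form r var ^ M * H" by (rule dvdE)

  \<comment> \<open>\<open>P\<close> is nonzero, because it is up to a factor the pullback by \<open>X\<close> of a nonzero form.\<close>
  have "psubst X (bi_form s t B I a var E) = bi_form s t B I a (mult_triple 1 X) (mult_triple \<psi> Y)"
    by (simp add: psubst_bi_form EX(1)) (simp add: mult_triple_def)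
  also have "\<dots> = \<psi> ^ B * P" by (simp add: bi_form_mult[OF sub] P_def)
  finally have *: "psubst X (bi_form s t B I a var E) = \<psi> ^ B * P" .
  have cop: "conic_form t E dvd Z" if "conic_form t E dvd conic_form s E * Z" for Z
    using t(2)[of 1 Z] that by simp
  obtain z where z: "z \<in> I" "a z \<noteq> 0" using a(1) by blast
  have "bi_form s t B I a var E \<noteq> 0"
    by (rule bi_form_var_nonzero[where a = a and z = z, OF t(1) _ I_def z]) (rule cop)
  then have "psubst X (bi_form s t B I a var E) \<noteq> 0"
    using dominantD[OF dom(1) homogeneous_bi_form[OF sub hom_triple_var reducedD(1)[OF E]]] by blast
  then have "P \<noteq> 0" using * by auto
  then have PK: "psubst K P \<noteq> 0" using dominantD[OF dom(2) homP] by blast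

  \<comment> \<open>The pullback of \<open>P\<close> by \<open>K\<close>, without the factors lost by \<open>X\<close> and \<open>Y\<close>; the power of the line
    still divides it, and degrees can be compared.\<close>
  define P' where "P' = bi_form s t B I a X' Y'"
  have eq: "psubst K P = \<phi> ^ A * \<theta> ^ B * P'"
    unfolding P_def P'_def psubst_bi_form XK(1) YK(1) by (rule bi_form_mult[OF sub])
  then have "P' \<noteq> 0" using PK by auto
  have homP': "homogeneous (A * x' + B * y') P'"
    unfolding P'_def by (rule homogeneous_bi_form[OF sub reducedD(1)[OF X'] reducedD(1)[OF Y']])
  have "psubst K P = conic_form r K ^ M * psubst K H" by (simp add: H psubst_conic_form)
  then have "conic_form r K ^ M dvd \<phi> ^ A * \<theta> ^ B * P'" using eq by (metis dvd_triv_left)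
  then have "conic_form r K ^ M dvd P'" by (rule r)
  then obtain H' where H': "P' = conic_form r K ^ M * H'" by (rule dvdE)
  have "homogeneous (M * k) (conic_form r K ^ M)"
    by (intro homogeneous_power homogeneous_conic_form reducedD(1)[OF K])
  then have "M * k \<le> A * x' + B * y'"
    using homogeneous_cofactor(1) homP' \<open>P' \<noteq> 0\<close> H' by blast
  then have "e * (e * k) \<le> e * (8 * (y * x' + x * y'))"
    by (simp add: M_def A_def B_def algebra_simps)
  then show ?thesis using pos(3) by simp
qed

lemma reduced_comp:
  assumes "hom_triple d E" "hom_triple e X" "dominant E" "dominant X"
    and "hom_triple d' E'" "hom_triple e' X'" "dominant E'" "dominant X'"
    and "same_map E E'" "same_map X X'" "reduced r Y" "same_map (comp_triple E X) Y"
  obtains \<psi> where "comp_triple E' X' = mult_triple \<psi> Y" "\<psi> \<noteq> 0"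
proof -
  have EX: "hom_triple (d * e) (comp_triple E X)" "hom_triple (d' * e) (comp_triple E' X)"
    "hom_triple (d' * e') (comp_triple E' X')"
    using assms(1-8) by (auto intro: hom_triple_comp)
  have "same_map (comp_triple E' X') (comp_triple E' X)"
    using same_map_comp_right[OF assms(6,2,5)] assms(10) same_map_sym by blast
  moreover have "same_map (comp_triple E' X) (comp_triple E X)"
    using same_map_comp_left assms(9) same_map_sym by blast
  ultimately have "same_map (comp_triple E' X') Y"
    using same_map_trans assms(12) hom_triple_nonzero EX by meson
  then show ?thesis using reduced_multiple[OF EX(3) assms(11)] that by metis
qed

text \<open>The maps \<open>K\<close>, \<open>X\<close>, \<open>E\<close> connect four copies of the plane. The degrees of \<open>E\<close> and \<open>K\<close> belong to one
  pairing of the four copies, and the right-hand side has the products for the two other pairings.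
  In terms of logarithms this is Gromov's four-point condition. Both sides depend only on the
  rational maps, so that reduced representatives may be used.\<close>

theorem four_point:
  fixes E X K :: "'a::field triple"
  assumes inf: "infinite (UNIV :: 'a set)"
    and E: "hom_triple e E" "dominant E" and X: "hom_triple x X" "dominant X"
    and K: "hom_triple k K" "dominant K"
  shows "map_degree E * map_degree K \<le> 8 * (map_degree (comp_triple E X) * map_degree (comp_triple X K)
    + map_degree X * map_degree (comp_triple E (comp_triple X K)))"
proof -
  have EX: "hom_triple (e * x) (comp_triple E X)" "dominant (comp_triple E X)"
    using E X by (auto intro: hom_triple_comp dominant_comp)
  have XK: "hom_triple (x * k) (comp_triple X K)" "dominant (comp_triple X K)"
    using X K by (auto intro: hom_triple_comp dominant_comp)
  have EXK: "hom_triple (e * (x * k)) (comp_triple E (comp_triple X K))"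
    "dominant (comp_triple E (comp_triple X K))"
    using E XK by (auto intro: hom_triple_comp dominant_comp)
  obtain hE E' where E': "E = mult_triple hE E'" "hE \<noteq> 0" "reduced (map_degree E) E'" "dominant E'" "map_degree E \<ge> 1"
    using reduce_dominant[OF E] .
  obtain hX X1 where X1: "X = mult_triple hX X1" "hX \<noteq> 0" "reduced (map_degree X) X1" "dominant X1" "map_degree X \<ge> 1"
    using reduce_dominant[OF X] .
  obtain hK K' where K': "K = mult_triple hK K'" "hK \<noteq> 0" "reduced (map_degree K) K'" "dominant K'"
    using reduce_dominant[OF K] by metis
  obtain hY Y where Y: "comp_triple E X = mult_triple hY Y" "hY \<noteq> 0"
    "reduced (map_degree (comp_triple E X)) Y" "dominant Y" "map_degree (comp_triple E X) \<ge> 1"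
    using reduce_dominant[OF EX] .
  obtain hX' X' where X': "comp_triple X K = mult_triple hX' X'" "hX' \<noteq> 0"
    "reduced (map_degree (comp_triple X K)) X'"
    using reduce_dominant[OF XK] by metis
  obtain hY' Y' where Y': "comp_triple E (comp_triple X K) = mult_triple hY' Y'" "hY' \<noteq> 0"
    "reduced (map_degree (comp_triple E (comp_triple X K))) Y'"
    using reduce_dominant[OF EXK] by metis
  have same: "same_map E E'" "same_map X X1" "same_map K K'" "same_map (comp_triple E X) Y"
    "same_map (comp_triple X K) X'"
    by (subst E'(1) X1(1) K'(1) Y(1) X'(1), simp add: same_map_mult_left E'(2) X1(2) K'(2) Y(2) X'(2))+
  have same': "same_map (comp_triple (comp_triple E X) K) Y'"
    by (subst comp_triple_assoc, subst Y'(1)) (simp add: same_map_mult_left Y'(2))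
  obtain \<psi> where \<psi>: "comp_triple E' X1 = mult_triple \<psi> Y" "\<psi> \<noteq> 0"
    using reduced_comp[OF E(1) X(1) E(2) X(2) reducedD(1)[OF E'(3)] reducedD(1)[OF X1(3)] E'(4) X1(4)
        same(1,2) Y(3) same(4)] .
  obtain \<phi> where \<phi>: "comp_triple X1 K' = mult_triple \<phi> X'" "\<phi> \<noteq> 0"
    using reduced_comp[OF X(1) K(1) X(2) K(2) reducedD(1)[OF X1(3)] reducedD(1)[OF K'(3)] X1(4) K'(4)
        same(2,3) X'(3) same(5)] .
  obtain \<theta> where \<theta>: "comp_triple Y K' = mult_triple \<theta> Y'" "\<theta> \<noteq> 0"
    using reduced_comp[OF EX(1) K(1) EX(2) K(2) reducedD(1)[OF Y(3)] reducedD(1)[OF K'(3)] Y(4) K'(4)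
        same(4,3) Y'(3) same'] .
  show ?thesis
    by (rule four_point_reduced[OF inf E'(3) X1(3) Y(3) K'(3) X'(3) Y'(3) X1(4) K'(4) \<psi> \<phi> \<theta>
          X1(5) Y(5) E'(5)])
qed

section \<open>Degree growth and the first dynamical degree\<close>

text \<open>Fekete's lemma.\<close>

lemma subadditive_limit:
  fixes u :: "nat \<Rightarrow> real"
  assumes nonneg: "\<And>n. u n \<ge> 0" and sub: "\<And>m n. u (m + n) \<le> u m + u n"
  obtains L where "(\<lambda>n. u n / real n) \<longlonglongrightarrow> L" "L \<ge> 0" "\<And>n. real n * L \<le> u n"
proof -
  define L where "L = (INF n\<in>{1..}. u n / real n)"
  have bdd: "bdd_below ((\<lambda>n. u n / real n) ` {1..})"
    by (rule bdd_belowI2[of _ 0]) (simp add: nonneg)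
  have L_le: "L \<le> u n / real n" if "n \<ge> 1" for n
    unfolding L_def using that by (intro cINF_lower[OF bdd]) auto
  have L0: "L \<ge> 0" unfolding L_def by (intro cINF_greatest) (auto simp: nonneg)
  have mult: "u (q * N + r) \<le> real q * u N + u r" for q N r
  proof (induction q)
    case (Suc q)
    have "u (Suc q * N + r) \<le> u N + u (q * N + r)" using sub[of N "q * N + r"] by (simp add: add.assoc)
    then show ?case using Suc by (simp add: algebra_simps)
  qed simp
  have "(\<lambda>n. u n / real n) \<longlonglongrightarrow> L"
  proof (rule LIMSEQ_I)
    fix e :: real assume "e > 0"
    have "L < L + e / 2" using \<open>e > 0\<close> by simp
    then obtain N where N: "N \<ge> 1" "u N / real N < L + e / 2"
      using cINF_less_iff[OF _ bdd, of "L + e / 2"] by (auto simp: L_def)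
    define M where "M = (\<Sum>i<N. u i)"
    have uM: "u r \<le> M" if "r < N" for r
      unfolding M_def using that by (intro member_le_sum) (auto simp: nonneg)
    have M0: "M \<ge> 0" unfolding M_def by (intro sum_nonneg) (simp add: nonneg)
    define n0 where "n0 = nat \<lceil>2 * M / e\<rceil> + 1"
    show "\<exists>no. \<forall>n\<ge>no. norm (u n / real n - L) < e"
    proof (intro exI[of _ n0] allI impI)
      fix n assume "n \<ge> n0"
      then have n: "n \<ge> 1" "2 * M / e < real n" unfolding n0_def by linarith+
      have "u n \<le> real (n div N) * u N + u (n mod N)"
        using mult[of "n div N" N "n mod N"] by simp
      also have "\<dots> \<le> real (n div N) * u N + M" using N(1) uM[of "n mod N"] by simp
      also have "real (n div N) * u N = (real (n div N) * real N) * (u N / real N)" using N(1) by simp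
      also have "\<dots> \<le> real n * (u N / real N)"
      proof (rule mult_right_mono)
        have "(n div N) * N \<le> n" by simp
        then show "real (n div N) * real N \<le> real n" by (simp only: of_nat_mult[symmetric] of_nat_le_iff)
        show "0 \<le> u N / real N" by (simp add: nonneg)
      qed
      finally have "u n \<le> real n * (u N / real N) + M" by simp
      then have "u n / real n \<le> u N / real N + M / real n"
        using n(1) by (simp add: field_simps)
      moreover have "M / real n < e / 2"
        using n \<open>e > 0\<close> by (simp add: field_simps)
      ultimately have "u n / real n < L + e" using N(2) by argo
      then show "norm (u n / real n - L) < e" using L_le[OF n(1)] by simp
    qed
  qed
  moreover have "real n * L \<le> u n" for n
    using L_le[of n] nonneg[of 0] by (cases "n = 0") (auto simp: field_simps)
  ultimately show ?thesis using that L0 by blast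
qed

lemma infinite_alg_closed: "infinite (UNIV :: 'a::alg_closed_field set)"
proof
  assume fin: "finite (UNIV :: 'a set)"
  define p :: "'a poly" where "p = (\<Prod>a\<in>UNIV. [:- a, 1:])"
  have root: "poly p x = 0" for x
    unfolding p_def poly_prod by (rule prod_zero[OF fin]) (auto intro: bexI[of _ x])
  have "degree p = card (UNIV :: 'a set)"
    unfolding p_def using fin by (subst degree_prod_eq_sum_degree) auto
  then have "degree (p + 1) > 0"
    using fin by (subst degree_add_eq_left) (auto simp: card_gt_0_iff)
  then obtain x where "poly (p + 1) x = 0" using alg_closed_imp_poly_has_root by blast
  then show False by (simp add: root)
qed

locale birational_pair =
  fixes F G :: "'a::alg_closed_field triple" and d e :: nat
  assumes hom_F: "hom_triple d F" and hom_G: "hom_triple e G"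
    and dominant_F: "dominant F" and dominant_G: "dominant G"
    and FG: "same_map (comp_triple F G) var" and GF: "same_map (comp_triple G F) var"

text \<open>If \<open>p\<close> vanishes on the image of \<open>F\<close>, it vanishes on that of \<open>F G\<close>, which is a multiple of the
  identity; so a multiple of \<open>p\<close> vanishes.\<close>

lemma dominant_if_right_inverse:
  assumes "comp_triple F G \<noteq> (\<lambda>i. 0)" "same_map (comp_triple F G) var"
  shows "dominant F"
  unfolding dominant_def
proof (intro allI impI)
  fix e p assume p: "homogeneous e p" "psubst F p = 0"
  let ?W = "comp_triple F G"
  obtain j where j: "?W j \<noteq> 0" using assms(1) by auto
  have "psubst ?W p = 0" by (simp add: psubst_comp_triple p(2))
  then have "0 = psubst (\<lambda>i. var j * ?W i) p" by (simp add: psubst_scale[OF p(1)])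
  also have "(\<lambda>i. var j * ?W i) = (\<lambda>i. ?W j * var i)"
    using assms(2) by (auto simp: same_map_def mult.commute)
  also have "psubst \<dots> p = ?W j ^ e * p" by (simp add: psubst_scale[OF p(1)])
  finally show "p = 0" using j by simp
qed

lemma birational_pair_if_birational:
  assumes "hom_triple d (F :: 'a::alg_closed_field triple)" "birational F"
  obtains G e where "birational_pair F G d e"
proof -
  obtain e G where G: "hom_triple e G" "comp_triple F G \<noteq> (\<lambda>i. 0)" "same_map (comp_triple F G) var"
    "comp_triple G F \<noteq> (\<lambda>i. 0)" "same_map (comp_triple G F) var"
    using assms(2) by (auto simp: birational_def)
  have "birational_pair F G d e"
    by unfold_locales (use assms(1) G dominant_if_right_inverse in auto)
  then show ?thesis using that by blast
qed

lemma map_degree_var [simp]: "map_degree (var :: 'a::field triple) = 1"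
proof -
  have h: "hom_triple 1 (var :: 'a triple)" by (rule hom_triple_var)
  obtain k K where "map_degree (var :: 'a triple) \<ge> 1" using reduce_dominant[OF h dominant_var] by metis
  then show ?thesis using map_degree_le[OF h] by simp
qed

lemma iter_triple_0 [simp]: "iter_triple 0 F = var"
  by (simp add: iter_triple_def)

lemma iter_triple_Suc: "iter_triple (Suc n) F = comp_triple F (iter_triple n F)"
  by (simp add: iter_triple_def)

lemma iter_triple_1 [simp]: "iter_triple (Suc 0) F = F"
  by (simp add: iter_triple_Suc)

lemma iter_triple_add: "iter_triple (m + n) F = comp_triple (iter_triple m F) (iter_triple n F)"
  by (induction m) (simp_all add: iter_triple_Suc comp_triple_assoc)

lemma iter_triple_dominant:
  assumes "hom_triple d F" "dominant F"
  shows "hom_triple (d ^ n) (iter_triple n F)" "dominant (iter_triple n F)"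
proof -
  have "hom_triple (d ^ n) (iter_triple n F) \<and> dominant (iter_triple n F)"
  proof (induction n)
    case 0
    then show ?case using hom_triple_var by simp
  next
    case (Suc n)
    then show ?case
      using hom_triple_comp[OF assms(1), of "d ^ n" "iter_triple n F"]
        dominant_comp[OF assms(2) _ assms(1), of "iter_triple n F"] by (simp add: iter_triple_Suc)
  qed
  then show "hom_triple (d ^ n) (iter_triple n F)" "dominant (iter_triple n F)" by auto
qed

lemma map_degree_pos: "hom_triple d F \<Longrightarrow> dominant F \<Longrightarrow> map_degree F \<ge> 1"
  using reduce_dominant by metis

lemma birational_pair_sym: "birational_pair F G d e \<Longrightarrow> birational_pair G F e d"
  by (simp add: birational_pair_def)

context birational_pair
begin

lemmas iter_F = iter_triple_dominant[OF hom_F dominant_F]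
lemmas iter_G = iter_triple_dominant[OF hom_G dominant_G]

lemma iter_inverse: "same_map (comp_triple (iter_triple n F) (iter_triple n G)) var"
proof (induction n)
  case (Suc n)
  have hFG: "hom_triple (d * e) (comp_triple F G)" by (rule hom_triple_comp[OF hom_F hom_G dominant_G])
  let ?X = "comp_triple (comp_triple F G) (iter_triple n G)"
  have X: "hom_triple (d * e * e ^ n) ?X" by (rule hom_triple_comp[OF hFG iter_G])
  have "same_map ?X (iter_triple n G)"
    using same_map_comp_left[OF FG, of "iter_triple n G"] by simp
  then have "same_map (comp_triple (iter_triple n F) ?X) (comp_triple (iter_triple n F) (iter_triple n G))"
    by (rule same_map_comp_right[OF X iter_G(1) iter_F(1)])
  moreover have "comp_triple (iter_triple n F) (iter_triple n G) \<noteq> (\<lambda>i. 0)"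
    by (rule hom_triple_nonzero[OF hom_triple_comp[OF iter_F(1) iter_G]])
  ultimately have "same_map (comp_triple (iter_triple n F) ?X) var"
    using same_map_trans Suc by blast
  moreover have "comp_triple (iter_triple n F) ?X = comp_triple (iter_triple (Suc n) F) (iter_triple (Suc n) G)"
    using iter_triple_add[of n 1 F] iter_triple_Suc[of n G] by (simp add: comp_triple_assoc)
  ultimately show ?case by simp
qed simp

lemma iter_cancel_left:
  assumes "m \<le> n"
  shows "same_map (comp_triple (iter_triple m F) (iter_triple n G)) (iter_triple (n - m) G)"
proof -
  have "iter_triple n G = comp_triple (iter_triple m G) (iter_triple (n - m) G)"
    using assms by (simp flip: iter_triple_add)
  then show ?thesis
    using same_map_comp_left[OF iter_inverse[of m], of "iter_triple (n - m) G"]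
    by (simp add: comp_triple_assoc)
qed

lemma iter_cancel_right:
  assumes "m \<le> n"
  shows "same_map (comp_triple (iter_triple n F) (iter_triple m G)) (iter_triple (n - m) F)"
proof -
  have "iter_triple n F = comp_triple (iter_triple (n - m) F) (iter_triple m F)"
    using assms by (simp flip: iter_triple_add)
  moreover have "same_map (comp_triple (iter_triple (n - m) F) (comp_triple (iter_triple m F) (iter_triple m G)))
      (comp_triple (iter_triple (n - m) F) var)"
    by (rule same_map_comp_right[OF hom_triple_comp[OF iter_F(1) iter_G] hom_triple_var iter_F(1) iter_inverse])
  ultimately show ?thesis by (simp add: comp_triple_assoc)
qed

abbreviation "deg_F n \<equiv> map_degree (iter_triple n F)"
abbreviation "deg_G n \<equiv> map_degree (iter_triple n G)"

text \<open>The degrees of a map and of its inverse are comparable; this is the four-point inequality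
  with three of the points equal.\<close>

lemma deg_inverse_le: "deg_F n \<le> 16 * deg_G n"
proof -
  have "map_degree (comp_triple (iter_triple n F) (iter_triple n G)) = 1"
    using map_degree_cong[OF hom_triple_comp[OF iter_F(1) iter_G] hom_triple_var iter_inverse] by simp
  then show ?thesis
    using four_point[OF infinite_alg_closed iter_F iter_G hom_triple_var dominant_var, of n n] by simp
qed

end

context birational_pair
begin

interpretation inv: birational_pair G F e d
  by (rule birational_pair_sym) unfold_locales

text \<open>The four-point inequality for the iterates of orders \<open>0\<close>, \<open>k\<close>, \<open>2 k\<close> and \<open>(m + 2) k\<close>, with the pairing
  \<open>{0, 2 k}\<close>, \<open>{k, (m + 2) k}\<close> on the left. The maps from higher to lower orders are iterates of the
  inverse; replacing their degrees by those of \<open>F\<close> costs the powers of \<open>16\<close>.\<close>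

lemma deg_recursion:
  "deg_F (2 * k) * deg_F ((m + 1) * k)
    \<le> 2048 * (deg_F k * deg_F (m * k)) + 128 * (deg_F k * deg_F ((m + 2) * k))"
proof -
  let ?E = "iter_triple (2 * k) F" and ?X = "iter_triple ((m + 2) * k) G"
    and ?K = "iter_triple ((m + 1) * k) F"
  have diffs: "(m + 2) * k - 2 * k = m * k" "(m + 2) * k - (m + 1) * k = k" "2 * k - k = k"
    by (simp_all add: algebra_simps)
  have EX: "map_degree (comp_triple ?E ?X) = deg_G (m * k)"
    using map_degree_cong[OF hom_triple_comp[OF iter_F(1) iter_G] iter_G(1) iter_cancel_left] diffs(1)
    by simp
  have XK': "same_map (comp_triple ?X ?K) (iter_triple k G)"
    using inv.iter_cancel_right[of "(m + 1) * k" "(m + 2) * k"] diffs(2) by simp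
  have XKh: "hom_triple (e ^ ((m + 2) * k) * d ^ ((m + 1) * k)) (comp_triple ?X ?K)"
    "dominant (comp_triple ?X ?K)"
    using hom_triple_comp[OF iter_G(1) iter_F] dominant_comp[OF iter_G(2) iter_F(2) iter_G(1)] by auto
  have XK: "map_degree (comp_triple ?X ?K) = deg_G k"
    by (rule map_degree_cong[OF XKh(1) iter_G(1) XK'])
  have "same_map (comp_triple ?E (comp_triple ?X ?K)) (comp_triple ?E (iter_triple k G))"
    by (rule same_map_comp_right[OF XKh(1) iter_G(1) iter_F(1) XK'])
  moreover have "same_map (comp_triple ?E (iter_triple k G)) (iter_triple k F)"
    using iter_cancel_right[of k "2 * k"] diffs(3) by simp
  ultimately have "same_map (comp_triple ?E (comp_triple ?X ?K)) (iter_triple k F)"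
    using same_map_trans hom_triple_nonzero[OF hom_triple_comp[OF iter_F(1) iter_G]] by blast
  then have EXK: "map_degree (comp_triple ?E (comp_triple ?X ?K)) = deg_F k"
    by (rule map_degree_cong[OF hom_triple_comp[OF iter_F(1) XKh] iter_F(1)])
  have "deg_F (2 * k) * deg_F ((m + 1) * k) \<le>
      8 * (deg_G (m * k) * deg_G k + deg_G ((m + 2) * k) * deg_F k)"
    using four_point[OF infinite_alg_closed iter_F[where n = "2 * k"] iter_G[where n = "(m + 2) * k"]
        iter_F[where n = "(m + 1) * k"]]
    by (simp only: EX XK EXK)
  also have "\<dots> \<le> 8 * ((16 * deg_F (m * k)) * (16 * deg_F k) + (16 * deg_F ((m + 2) * k)) * deg_F k)"
    by (intro mult_le_mono add_le_mono inv.deg_inverse_le order_refl)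
  finally show ?thesis by (simp add: algebra_simps)
qed

lemma deg_F_pos: "deg_F n \<ge> 1"
  by (rule map_degree_pos[OF iter_F])

lemma deg_F_submult: "deg_F (m + n) \<le> deg_F m * deg_F n"
  unfolding iter_triple_add by (rule map_degree_comp_le[OF iter_F(1) iter_F(1) iter_F(2) iter_F(2)])

text \<open>The first summand of the recursion is at most half of the left-hand side as long as the degrees
  increase, and then the second summand makes them increase further.\<close>

lemma deg_growth:
  fixes q :: real
  assumes "q \<ge> 1" and q: "real (deg_F (2 * k)) = 4096 * q * real (deg_F k)"
  shows "real (deg_F ((m + 1) * k)) \<ge> q ^ m \<and> deg_F ((m + 1) * k) \<ge> deg_F (m * k)"
proof (induction m)
  case 0
  show ?case using deg_F_pos[of k] by simp
next
  case (Suc m)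
  define x y z w where "x = real (deg_F k)" "y = real (deg_F (m * k))"
    "z = real (deg_F ((m + 1) * k))" "w = real (deg_F ((m + 2) * k))"
  note defs = this
  have x: "x > 0" using deg_F_pos[of k] by (simp add: defs)
  have z: "z \<ge> 1" using deg_F_pos[of "(m + 1) * k"] by (simp add: defs)
  have yz: "y \<le> z" using Suc by (simp add: defs)
  have "real (deg_F (2 * k) * deg_F ((m + 1) * k))
    \<le> real (2048 * (deg_F k * deg_F (m * k)) + 128 * (deg_F k * deg_F ((m + 2) * k)))"
    using deg_recursion[of k m] by (simp only: of_nat_le_iff)
  then have "4096 * q * x * z \<le> 2048 * (x * y) + 128 * (x * w)" by (simp add: defs q)
  also have "\<dots> = x * (2048 * y + 128 * w)" by (simp add: algebra_simps)
  finally have "x * (4096 * q * z) \<le> x * (2048 * y + 128 * w)" by (simp add: ac_simps)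
  then have "4096 * q * z \<le> 2048 * y + 128 * w" using x by simp
  moreover have "z \<le> q * z" using z \<open>q \<ge> 1\<close> mult_right_mono[of 1 q z] by simp
  then have "y \<le> q * z" using yz by linarith
  ultimately have w: "q * z \<le> w" using mult_nonneg_nonneg[of q z] z \<open>q \<ge> 1\<close> by linarith
  moreover have "q * q ^ m \<le> q * z" using Suc \<open>q \<ge> 1\<close> by (intro mult_left_mono) (auto simp: defs)
  moreover have "z \<le> q * z" using z \<open>q \<ge> 1\<close> mult_right_mono[of 1 q z] by simp
  ultimately have "q ^ Suc m \<le> w" "z \<le> w" by simp_all
  then show ?case by (simp add: defs)
qed

text \<open>Submultiplicativity of the degrees makes the defining limit exist and be an infimum. If the
  ratio of the degrees of orders \<open>2 k\<close> and \<open>k\<close> exceeds the constant, the geometric growth along the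
  multiples of \<open>k\<close> bounds the limit from below.\<close>

lemma dyn_degree_properties:
  shows "dyn_degree F \<ge> 1" "dyn_degree F ^ n \<le> real (deg_F n)"
    and "k \<ge> 1 \<Longrightarrow> real (deg_F (2 * k)) \<le> 4096 * dyn_degree F ^ k * real (deg_F k)"
proof -
  define u where "u n = ln (real (deg_F n))" for n
  have pos: "real (deg_F n) \<ge> 1" for n using deg_F_pos[of n] by simp
  have u0: "u n \<ge> 0" for n unfolding u_def using pos[of n] by simp
  have "u (m + n) \<le> u m + u n" for m n
  proof -
    have "real (deg_F (m + n)) \<le> real (deg_F m) * real (deg_F n)"
      using deg_F_submult[of m n] by (simp only: of_nat_mult[symmetric] of_nat_le_iff)
    then have "u (m + n) \<le> ln (real (deg_F m) * real (deg_F n))"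
      unfolding u_def using pos[of "m + n"] by (intro ln_mono) auto
    also have "\<dots> = u m + u n" unfolding u_def using pos[of m] pos[of n] by (simp add: ln_mult)
    finally show ?thesis .
  qed
  then obtain L where L: "(\<lambda>n. u n / real n) \<longlonglongrightarrow> L" "L \<ge> 0" "\<And>n. real n * L \<le> u n"
    using subadditive_limit[of u] u0 by blast
  have exp_u: "exp (u n) = real (deg_F n)" for n unfolding u_def using pos[of n] by simp
  have "(\<lambda>n. exp (u n / real n)) \<longlonglongrightarrow> exp L" by (intro tendsto_intros L)
  moreover have "\<forall>\<^sub>F n in sequentially. exp (u n / real n) = root n (real (deg_F n))"
  proof (rule eventually_mono[OF eventually_gt_at_top[of 0]])
    fix n :: nat assume "n > 0"
    have "exp (u n / real n) ^ n = real (deg_F n)"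
      using \<open>n > 0\<close> by (simp add: exp_u flip: exp_of_nat_mult)
    then show "exp (u n / real n) = root n (real (deg_F n))"
      using \<open>n > 0\<close> by (metis exp_ge_zero real_root_power_cancel)
  qed
  ultimately have "(\<lambda>n. root n (real (deg_F n))) \<longlonglongrightarrow> exp L"
    by (rule Lim_transform_eventually)
  then have dyn: "dyn_degree F = exp L" unfolding dyn_degree_def by (rule limI)
  show "dyn_degree F \<ge> 1" using L(2) by (simp add: dyn)
  show "dyn_degree F ^ n \<le> real (deg_F n)"
    unfolding dyn using L(3)[of n] by (simp flip: exp_of_nat_mult exp_u)
  assume k: "k \<ge> 1"
  define q where "q = real (deg_F (2 * k)) / (4096 * real (deg_F k))"
  have q: "real (deg_F (2 * k)) = 4096 * q * real (deg_F k)"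
    using pos[of k] by (simp add: q_def)
  have "q \<le> exp L ^ k"
  proof (cases "q \<ge> 1")
    case True
    have "filterlim (\<lambda>m. (m + 1) * k) at_top sequentially"
      using k by (intro filterlim_subseq strict_monoI) simp
    then have "(\<lambda>m. u ((m + 1) * k) / real ((m + 1) * k)) \<longlonglongrightarrow> L"
      by (rule filterlim_compose[OF L(1)])
    moreover have "(\<lambda>m. ln q / real k * (real m / real (m + 1))) \<longlonglongrightarrow> ln q / real k * 1"
      by (intro tendsto_intros) real_asymp
    moreover have "ln q / real k * (real m / real (m + 1)) \<le> u ((m + 1) * k) / real ((m + 1) * k)" for m
    proof -
      have "real m * ln q = ln (q ^ m)" using True by (simp add: ln_realpow)
      also have "\<dots> \<le> u ((m + 1) * k)"
        unfolding u_def using deg_growth[OF True q, of m] True by (intro ln_mono) auto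
      finally have "real m * ln q / real ((m + 1) * k) \<le> u ((m + 1) * k) / real ((m + 1) * k)"
        by (rule divide_right_mono) simp
      then show ?thesis by (simp add: field_simps)
    qed
    ultimately have "ln q / real k * 1 \<le> L" by (intro LIMSEQ_le) auto
    then have "ln q \<le> real k * L" using k by (simp add: field_simps)
    then have "exp (ln q) \<le> exp L ^ k" by (simp flip: exp_of_nat_mult)
    then show ?thesis using True by simp
  next
    case False
    have "1 \<le> exp L ^ k" using L(2) by simp
    then show ?thesis using False by linarith
  qed
  then show "real (deg_F (2 * k)) \<le> 4096 * dyn_degree F ^ k * real (deg_F k)"
    unfolding q dyn using pos[of k] by (intro mult_right_mono mult_left_mono) auto
qed

text \<open>The constant enters once for each doubling, that is, \<open>log\<^sub>2\<close> many times.\<close>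

lemma deg_doubling: "real (deg_F (2 ^ j)) \<le> 4096 ^ j * dyn_degree F ^ (2 ^ j) * real (deg_F 1)"
proof (induction j)
  case 0
  have "1 * real (deg_F 1) \<le> dyn_degree F * real (deg_F 1)"
    by (intro mult_right_mono dyn_degree_properties(1)) simp
  then show ?case by simp
next
  case (Suc j)
  have "real (deg_F (2 ^ Suc j)) \<le> 4096 * dyn_degree F ^ (2 ^ j) * real (deg_F (2 ^ j))"
    using dyn_degree_properties(3)[of "2 ^ j"] by simp
  also have "\<dots> \<le> 4096 * dyn_degree F ^ (2 ^ j) * (4096 ^ j * dyn_degree F ^ (2 ^ j) * real (deg_F 1))"
    using dyn_degree_properties(1) by (intro mult_left_mono Suc) simp_all
  also have "\<dots> = 4096 ^ Suc j * dyn_degree F ^ (2 ^ Suc j) * real (deg_F 1)"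
    by (simp add: power_mult power2_eq_square mult_ac flip: power_add mult_2)
  finally show ?case .
qed

lemma dyn_degree_gt:
  assumes "l \<ge> 1" "real (deg_F (2 ^ j)) > 4096 ^ j * l ^ (2 ^ j) * real d"
  shows "dyn_degree F > l"
proof (rule ccontr)
  assume "\<not> dyn_degree F > l"
  then have "dyn_degree F ^ (2 ^ j) \<le> l ^ (2 ^ j)"
    using dyn_degree_properties(1) by (intro power_mono) auto
  moreover have "real (deg_F 1) \<le> real d" using map_degree_le[OF hom_F] by simp
  ultimately have "4096 ^ j * dyn_degree F ^ (2 ^ j) * real (deg_F 1) \<le> 4096 ^ j * l ^ (2 ^ j) * real d"
    using assms(1) dyn_degree_properties(1) by (intro mult_mono) auto
  then show False using deg_doubling[of j] assms(2) by linarith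
qed

end

lemma doubly_exponential_beats:
  fixes l \<mu> C D :: real
  assumes "l \<ge> 1" "\<mu> > l" "C \<ge> 1" "D \<ge> 1"
  obtains j :: nat where "C ^ j * l ^ (2 ^ j) * D < \<mu> ^ (2 ^ j)"
proof -
  define c where "c = ln (\<mu> / l)"
  have c: "c > 0" unfolding c_def using assms by simp
  have "filterlim (\<lambda>j::nat. 2 ^ j * c - real j * ln C - ln D) at_top sequentially"
    using c by real_asymp
  then have "\<forall>\<^sub>F j in sequentially. 2 ^ j * c - real j * ln C - ln D > 0"
    by (rule filterlim_at_top_dense[THEN iffD1, rule_format])
  then obtain j :: nat where j: "2 ^ j * c - real j * ln C - ln D > 0"
    by (meson eventually_sequentially order_refl)
  have "ln (C ^ j * l ^ (2 ^ j) * D) < ln (\<mu> ^ (2 ^ j))"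
    using j assms by (simp add: ln_mult ln_realpow c_def ln_div algebra_simps)
  then have "C ^ j * l ^ (2 ^ j) * D < \<mu> ^ (2 ^ j)" using assms by (subst (asm) ln_less_cancel_iff) auto
  then show ?thesis by (rule that)
qed

section \<open>Open conditions on the coefficients\<close>

definition trivial_kernel :: "('v \<Rightarrow> 'a::field) \<Rightarrow> 'j set \<Rightarrow> 'i set \<Rightarrow> ('j \<Rightarrow> 'i \<Rightarrow> ('v, 'a) mpoly) \<Rightarrow> bool" where
  "trivial_kernel x J I M \<longleftrightarrow>
     (\<forall>h. (\<forall>j\<in>J. (\<Sum>i\<in>I. ev x (M j i) * h i) = 0) \<longrightarrow> (\<forall>i\<in>I. h i = 0))"

text \<open>Gaussian elimination with a fixed choice of pivots: a linear system whose coefficients are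
  forms and that has only the trivial solution at \<open>x0\<close> has only the trivial solution wherever the
  product of the pivots that are used at \<open>x0\<close> does not vanish.\<close>

lemma trivial_kernel_open:
  fixes M :: "'j \<Rightarrow> 'i \<Rightarrow> ('v, 'a::field) mpoly"
  assumes "finite I" "\<And>j i. homogeneous e (M j i)" "trivial_kernel x0 J I M"
  shows "\<exists>Q e'. homogeneous e' Q \<and> ev x0 Q \<noteq> 0 \<and> (\<forall>x. ev x Q \<noteq> 0 \<longrightarrow> trivial_kernel x J I M)"
  using assms
proof (induction I arbitrary: M e rule: finite_induct)
  case empty
  then show ?case
    by (intro exI[of _ 1] exI[of _ 0]) (simp add: trivial_kernel_def homogeneous_1)
next
  case (insert i0 I)
  have "\<exists>j0\<in>J. ev x0 (M j0 i0) \<noteq> 0"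
  proof (rule ccontr)
    assume *: "\<not> (\<exists>j0\<in>J. ev x0 (M j0 i0) \<noteq> 0)"
    have "(\<Sum>i\<in>insert i0 I. ev x0 (M j i) * (if i = i0 then 1 else 0)) = 0" if "j \<in> J" for j
    proof (rule sum.neutral, rule ballI)
      fix i
      show "ev x0 (M j i) * (if i = i0 then 1 else 0) = 0" using * that by auto
    qed
    then have "\<forall>i\<in>insert i0 I. (if i = i0 then 1 else 0 :: 'a) = 0"
      using insert.prems(2)[unfolded trivial_kernel_def] by (auto dest: spec[of _ "\<lambda>i. if i = i0 then 1 else 0"])
    then show False by auto
  qed
  then obtain j0 where j0: "j0 \<in> J" "ev x0 (M j0 i0) \<noteq> 0" by auto
  define M' where "M' j i = M j0 i0 * M j i - M j i0 * M j0 i" for j i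
  have hom': "homogeneous (e + e) (M' j i)" for j i
    unfolding M'_def by (intro homogeneous_diff homogeneous_mult insert.prems)
  have M': "(\<Sum>i\<in>I. ev x (M' j i) * h i) =
      ev x (M j0 i0) * (\<Sum>i\<in>insert i0 I. ev x (M j i) * h i)
      - ev x (M j i0) * (\<Sum>i\<in>insert i0 I. ev x (M j0 i) * h i)" for x j h
    using insert.hyps
    by (simp add: M'_def algebra_simps sum_subtractf sum_distrib_left)
  have "trivial_kernel x0 J I M'"
    unfolding trivial_kernel_def
  proof (intro allI impI)
    fix h assume h: "\<forall>j\<in>J. (\<Sum>i\<in>I. ev x0 (M' j i) * h i) = 0"
    define g where "g = h(i0 := - (\<Sum>i\<in>I. ev x0 (M j0 i) * h i) / ev x0 (M j0 i0))"
    have gh: "g i = h i" if "i \<in> I" for i using that insert.hyps by (auto simp: g_def)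
    have "(\<Sum>i\<in>I. ev x0 (M j0 i) * g i) = (\<Sum>i\<in>I. ev x0 (M j0 i) * h i)"
      by (intro sum.cong) (simp_all add: gh)
    then have 0: "(\<Sum>i\<in>insert i0 I. ev x0 (M j0 i) * g i) = 0"
      using insert.hyps j0 by (simp add: g_def)
    have "(\<Sum>i\<in>insert i0 I. ev x0 (M j i) * g i) = 0" if "j \<in> J" for j
    proof -
      have "(\<Sum>i\<in>I. ev x0 (M' j i) * g i) = (\<Sum>i\<in>I. ev x0 (M' j i) * h i)"
        by (intro sum.cong) (simp_all add: gh)
      then show ?thesis using M'[of x0 j g] h that j0 0 by simp
    qed
    then have "\<forall>i\<in>insert i0 I. g i = 0"
      using insert.prems(2)[unfolded trivial_kernel_def] by blast
    then show "\<forall>i\<in>I. h i = 0" using gh by auto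
  qed
  then obtain Q e' where Q: "homogeneous e' Q" "ev x0 Q \<noteq> 0"
    "\<And>x. ev x Q \<noteq> 0 \<Longrightarrow> trivial_kernel x J I M'"
    using insert.IH[of "e + e" M'] hom' by blast
  have "trivial_kernel x J (insert i0 I) M" if "ev x (M j0 i0 * Q) \<noteq> 0" for x
    unfolding trivial_kernel_def
  proof (intro allI impI)
    fix h assume h: "\<forall>j\<in>J. (\<Sum>i\<in>insert i0 I. ev x (M j i) * h i) = 0"
    have x: "ev x (M j0 i0) \<noteq> 0" "ev x Q \<noteq> 0" using that by auto
    have "\<forall>j\<in>J. (\<Sum>i\<in>I. ev x (M' j i) * h i) = 0"
      unfolding M' using h j0 by simp
    then have I0: "\<forall>i\<in>I. h i = 0" using Q(3)[OF x(2)] unfolding trivial_kernel_def by blast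
    have "ev x (M j0 i0) * h i0 = 0"
      using h j0(1) I0 insert.hyps by (auto dest!: bspec[of J _ j0])
    then show "\<forall>i\<in>insert i0 I. h i = 0" using I0 x(1) by auto
  qed
  then show ?case
    using Q j0(2) insert.prems(1)
    by (intro exI[of _ "M j0 i0 * Q"] exI[of _ "e + e'"]) (auto intro: homogeneous_mult)
qed

text \<open>Polynomial-valued functions of a triple whose coefficients are forms of degree \<open>e\<close> in the
  coefficients of the triple.\<close>

definition coeff_form :: "nat \<Rightarrow> nat \<Rightarrow> ('a::field triple \<Rightarrow> (3, 'a) mpoly) \<Rightarrow> bool" where
  "coeff_form d e P \<longleftrightarrow> (\<forall>m. \<exists>Q. homogeneous e Q \<and>
     (\<forall>F. hom_triple d F \<longrightarrow> lookup (P F) m = ev (coords F) Q))"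

lemma coeff_formI:
  assumes "\<And>m. homogeneous e (Q m)"
    "\<And>m F. hom_triple d F \<Longrightarrow> lookup (P F) m = ev (coords F) (Q m)"
  shows "coeff_form d e P"
  unfolding coeff_form_def using assms by blast

lemma coeff_formE:
  assumes "coeff_form d e P"
  obtains Q where "\<And>m. homogeneous e (Q m)"
    "\<And>m F. hom_triple d F \<Longrightarrow> lookup (P F) m = ev (coords F) (Q m)"
  using assms unfolding coeff_form_def by metis

lemma coeff_form_cong:
  assumes "coeff_form d e P" "\<And>F. hom_triple d F \<Longrightarrow> P F = P' F"
  shows "coeff_form d e P'"
  using assms unfolding coeff_form_def by metis

lemma coeff_form_fixed: "coeff_form d 0 (\<lambda>F. p)"
  by (rule coeff_formI[where Q = "\<lambda>m. const (lookup p m)"]) simp_all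

lemma coeff_form_coefficient: "coeff_form d 1 (\<lambda>F. const (lookup (F i) \<mu>))"
proof (rule coeff_formI[where Q = "\<lambda>m. if m = 0 then var (i, \<mu>) else 0"])
  show "homogeneous 1 (if m = 0 then var (i, \<mu>) else 0)" for m :: "3 \<Rightarrow>\<^sub>0 nat"
    using homogeneous_var[of "(i, \<mu>)"] by (cases "m = 0") simp_all
qed (simp add: const_def lookup_single when_def coords_def)

lemma coeff_form_diff:
  assumes "coeff_form d e P" "coeff_form d e P'"
  shows "coeff_form d e (\<lambda>F. P F - P' F)"
proof -
  obtain Q Q' where "\<And>m. homogeneous e (Q m)" "\<And>m. homogeneous e (Q' m)"
    "\<And>m F. hom_triple d F \<Longrightarrow> lookup (P F) m = ev (coords F) (Q m)"
    "\<And>m F. hom_triple d F \<Longrightarrow> lookup (P' F) m = ev (coords F) (Q' m)"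
    using assms coeff_formE by metis
  then show ?thesis
    by (intro coeff_formI[where Q = "\<lambda>m. Q m - Q' m"]) (simp_all add: homogeneous_diff lookup_minus)
qed

lemma coeff_form_add:
  assumes "coeff_form d e P" "coeff_form d e P'"
  shows "coeff_form d e (\<lambda>F. P F + P' F)"
proof -
  obtain Q Q' where "\<And>m. homogeneous e (Q m)" "\<And>m. homogeneous e (Q' m)"
    "\<And>m F. hom_triple d F \<Longrightarrow> lookup (P F) m = ev (coords F) (Q m)"
    "\<And>m F. hom_triple d F \<Longrightarrow> lookup (P' F) m = ev (coords F) (Q' m)"
    using assms coeff_formE by metis
  then show ?thesis
    by (intro coeff_formI[where Q = "\<lambda>m. Q m + Q' m"]) (simp_all add: homogeneous_add lookup_add)
qed

lemma coeff_form_zero: "coeff_form d e (\<lambda>F. 0)"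
  by (rule coeff_formI[where Q = "\<lambda>m. 0"]) simp_all

lemma coeff_form_sum:
  "(\<And>a. a \<in> A \<Longrightarrow> coeff_form d e (P a)) \<Longrightarrow> coeff_form d e (\<lambda>F. \<Sum>a\<in>A. P a F)"
  by (induction A rule: infinite_finite_induct) (auto intro: coeff_form_add coeff_form_zero)

lemma lookup_mult_decomp:
  fixes p q :: "(3, 'a::field) mpoly"
  defines "S \<equiv> \<lambda>m. \<Union>e\<le>monom_degree m. monoms e"
  shows "lookup (p * q) m =
    (\<Sum>a\<in>S m. \<Sum>b\<in>S m. if a + b = m then lookup p a * lookup q b else 0)"
proof -
  let ?A = "keys p \<union> S m" and ?B = "keys q \<union> S m"
  have fin: "finite (S m)" by (simp add: S_def)
  have in_S: "a \<in> S m" "b \<in> S m" if "a + b = m" for a b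
    using that by (auto simp: S_def monoms_def monom_degree_add)
  have "lookup (p * q) m =
    (\<Sum>a\<in>?A. \<Sum>b\<in>?B. if a + b = m then lookup p a * lookup q b else 0)"
    using fin by (intro lookup_mult_keys) auto
  also have "\<dots> = (\<Sum>a\<in>S m. \<Sum>b\<in>?B. if a + b = m then lookup p a * lookup q b else 0)"
    using fin in_S by (intro sum.mono_neutral_right) (auto intro!: sum.neutral)
  also have "\<dots> = (\<Sum>a\<in>S m. \<Sum>b\<in>S m. if a + b = m then lookup p a * lookup q b else 0)"
    using fin in_S by (intro sum.cong refl sum.mono_neutral_right) auto
  finally show ?thesis .
qed

lemma coeff_form_mult:
  assumes "coeff_form d e P" "coeff_form d e' P'"
  shows "coeff_form d (e + e') (\<lambda>F. P F * P' F)"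
proof -
  obtain Q Q' where Q: "\<And>m. homogeneous e (Q m)" "\<And>m. homogeneous e' (Q' m)"
    "\<And>m F. hom_triple d F \<Longrightarrow> lookup (P F) m = ev (coords F) (Q m)"
    "\<And>m F. hom_triple d F \<Longrightarrow> lookup (P' F) m = ev (coords F) (Q' m)"
    using assms coeff_formE by metis
  let ?S = "\<lambda>m::3 \<Rightarrow>\<^sub>0 nat. \<Union>e\<le>monom_degree m. monoms e"
  show ?thesis
  proof (rule coeff_formI[where Q = "\<lambda>m. \<Sum>a\<in>?S m. \<Sum>b\<in>?S m. if a + b = m then Q a * Q' b else 0"])
    show "homogeneous (e + e') (\<Sum>a\<in>?S m. \<Sum>b\<in>?S m. if a + b = m then Q a * Q' b else 0)" for m
      by (intro homogeneous_sum) (auto intro: homogeneous_mult Q)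
    fix m and F :: "'a triple" assume F: "hom_triple d F"
    show "lookup (P F * P' F) m = ev (coords F) (\<Sum>a\<in>?S m. \<Sum>b\<in>?S m. if a + b = m then Q a * Q' b else 0)"
      unfolding lookup_mult_decomp ev_sum by (intro sum.cong refl) (simp add: Q F)
  qed
qed

lemma coeff_form_power: "coeff_form d e P \<Longrightarrow> coeff_form d (n * e) (\<lambda>F. P F ^ n)"
proof (induction n)
  case 0
  then show ?case using coeff_form_fixed[of d 1] by simp
next
  case (Suc n)
  then show ?case using coeff_form_mult[of d e P "n * e" "\<lambda>F. P F ^ n"] by simp
qed

lemma hom_triple_expand:
  assumes "hom_triple d F"
  shows "psubst G (F i) = (\<Sum>\<mu>\<in>monoms d. const (lookup (F i) \<mu>) * monom_subst G \<mu>)"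
proof (rule coeff_hom.subst_superset[OF coeff_hom_const finite_monoms])
  show "keys (F i) \<subseteq> monoms d"
    using hom_triple_homogeneous[OF assms, of i] by (auto simp: homogeneous_def monoms_def)
qed

lemma coeff_form_iter: "\<exists>e. \<forall>i. coeff_form d e (\<lambda>F :: 'a::field triple. iter_triple n F i)"
proof (induction n)
  case 0
  show ?case by (intro exI[of _ 0]) (simp add: coeff_form_fixed)
next
  case (Suc n)
  then obtain e where e: "\<And>i. coeff_form d e (\<lambda>F :: 'a triple. iter_triple n F i)" by blast
  have "coeff_form d (1 + d * e) (\<lambda>F :: 'a triple. iter_triple (Suc n) F i)" for i
  proof (rule coeff_form_cong)
    show "coeff_form d (1 + d * e) (\<lambda>F :: 'a triple. \<Sum>\<mu>\<in>monoms d. const (lookup (F i) \<mu>) *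
        monom_subst (iter_triple n F) \<mu>)"
    proof (rule coeff_form_sum)
      fix \<mu> assume \<mu>: "\<mu> \<in> monoms d"
      have "coeff_form d (lookup \<mu> 1 * e + lookup \<mu> 2 * e + lookup \<mu> 3 * e)
         (\<lambda>F :: 'a triple. monom_subst (iter_triple n F) \<mu>)"
        unfolding monom_subst_3 by (intro coeff_form_mult coeff_form_power e)
      moreover have "lookup \<mu> 1 * e + lookup \<mu> 2 * e + lookup \<mu> 3 * e = d * e"
        using \<mu> by (simp add: monoms_def monom_degree_3 flip: add_mult_distrib)
      ultimately have "coeff_form d (d * e) (\<lambda>F :: 'a triple. monom_subst (iter_triple n F) \<mu>)" by simp
      then show "coeff_form d (1 + d * e) (\<lambda>F :: 'a triple. const (lookup (F i) \<mu>) *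
          monom_subst (iter_triple n F) \<mu>)"
        by (rule coeff_form_mult[OF coeff_form_coefficient])
    qed
    show "hom_triple d F \<Longrightarrow> (\<Sum>\<mu>\<in>monoms d. const (lookup (F i) \<mu>) *
        monom_subst (iter_triple n F) \<mu>) = iter_triple (Suc n) F i" for F :: "'a triple"
      by (simp add: iter_triple_Suc comp_triple_def hom_triple_expand)
  qed
  then show ?case by blast
qed

definition triple_of_coeffs :: "nat \<Rightarrow> (3 \<times> (3 \<Rightarrow>\<^sub>0 nat) \<Rightarrow> 'a::field) \<Rightarrow> 'a triple" where
  "triple_of_coeffs r h = (\<lambda>k. \<Sum>\<nu>\<in>monoms r. single \<nu> (h (k, \<nu>)))"

text \<open>The linear equations that express that a triple of forms of degree \<open>r\<close> is proportional to \<open>P\<close>. The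
  unknowns are the coefficients of the triple, and an equation is a coefficient of a \<open>2 \<times> 2\<close> minor.\<close>

definition proportional_system :: "'a::field triple \<Rightarrow> 3 \<times> 3 \<times> (3 \<Rightarrow>\<^sub>0 nat) \<Rightarrow> 3 \<times> (3 \<Rightarrow>\<^sub>0 nat) \<Rightarrow> 'a" where
  "proportional_system P = (\<lambda>(i, j, m) (k, \<nu>). lookup
     (P i * (if j = k then single \<nu> 1 else 0) - P j * (if i = k then single \<nu> 1 else 0)) m)"

lemma lookup_triple_of_coeffs:
  "lookup (triple_of_coeffs r h k) m = (if m \<in> monoms r then h (k, m) else 0)"
  by (simp add: triple_of_coeffs_def lookup_sum lookup_single when_def sum.delta)

lemma triple_of_coeffs_eq:
  assumes "hom_triple r H"
  shows "triple_of_coeffs r (coords H) = H"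
proof (intro ext poly_mapping_eqI)
  fix k m
  show "lookup (triple_of_coeffs r (coords H) k) m = lookup (H k) m"
    using homogeneous_lookup[OF hom_triple_homogeneous[OF assms], of k m]
    by (auto simp: lookup_triple_of_coeffs coords_def monoms_def)
qed

lemma homogeneous_triple_of_coeffs: "homogeneous r (triple_of_coeffs r h k)"
  unfolding homogeneous_def
  by (auto simp: in_keys_iff lookup_triple_of_coeffs monoms_def split: if_splits)

lemma proportional_system_sum:
  "(\<Sum>z\<in>UNIV \<times> monoms r. proportional_system P (i, j, m) z * h z)
    = lookup (P i * triple_of_coeffs r h j - P j * triple_of_coeffs r h i) m"
proof -
  have T: "triple_of_coeffs r h j = (\<Sum>z\<in>UNIV \<times> monoms r. const (h z) *
      (if j = fst z then single (snd z) 1 else 0))" for j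
  proof -
    have "(\<Sum>z\<in>UNIV \<times> monoms r. const (h z) * (if j = fst z then single (snd z) 1 else 0))
      = (\<Sum>k\<in>UNIV. \<Sum>\<nu>\<in>monoms r. const (h (k, \<nu>)) * (if j = k then single \<nu> 1 else 0))"
      by (simp add: sum.cartesian_product case_prod_beta)
    also have "\<dots> = (\<Sum>k\<in>UNIV. if j = k then (\<Sum>\<nu>\<in>monoms r. const (h (k, \<nu>)) * single \<nu> 1) else 0)"
      by (intro sum.cong refl) auto
    finally have "(\<Sum>z\<in>UNIV \<times> monoms r. const (h z) * (if j = fst z then single (snd z) 1 else 0))
      = (\<Sum>\<nu>\<in>monoms r. const (h (j, \<nu>)) * single \<nu> 1)" by simp
    then show ?thesis by (simp add: triple_of_coeffs_def const_def mult_single)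
  qed
  have "P i * triple_of_coeffs r h j - P j * triple_of_coeffs r h i =
    (\<Sum>z\<in>UNIV \<times> monoms r. const (h z) * (P i * (if j = fst z then single (snd z) 1 else 0)
      - P j * (if i = fst z then single (snd z) 1 else 0)))"
    unfolding T sum_distrib_left sum_subtractf[symmetric] by (intro sum.cong refl) (simp add: algebra_simps)
  then show ?thesis
    by (simp add: lookup_sum const_mult_lookup proportional_system_def case_prod_beta mult.commute)
qed

lemma map_degree_gt_iff_trivial:
  assumes "hom_triple e P"
  shows "map_degree P > r \<longleftrightarrow> (\<forall>h. (\<forall>j. (\<Sum>z\<in>UNIV \<times> monoms r. proportional_system P j z * h z) = 0)
     \<longrightarrow> (\<forall>z\<in>UNIV \<times> monoms r. h z = 0))"
proof -
  have solution: "(\<forall>j. (\<Sum>z\<in>UNIV \<times> monoms r. proportional_system P j z * h z) = 0)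
      \<longleftrightarrow> same_map P (triple_of_coeffs r h)" for h
  proof -
    have "(\<forall>j. (\<Sum>z\<in>UNIV \<times> monoms r. proportional_system P j z * h z) = 0) \<longleftrightarrow>
      (\<forall>i j. P i * triple_of_coeffs r h j - P j * triple_of_coeffs r h i = 0)"
      by (simp add: split_paired_All proportional_system_sum poly_mapping_eq_iff fun_eq_iff)
    then show ?thesis by (simp add: same_map_def)
  qed
  have zero: "(\<forall>z\<in>UNIV \<times> monoms r. h z = 0) \<longleftrightarrow> triple_of_coeffs r h = (\<lambda>k. 0)" for h :: "_ \<Rightarrow> 'a"
    by (auto simp: fun_eq_iff poly_mapping_eq_iff lookup_triple_of_coeffs)
  have "map_degree P > r \<longleftrightarrow> \<not> (\<exists>H. hom_triple r H \<and> same_map P H)"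
    using map_degree_le_iff[OF assms, of r] by auto
  also have "\<dots> \<longleftrightarrow> (\<forall>h. same_map P (triple_of_coeffs r h) \<longrightarrow> triple_of_coeffs r h = (\<lambda>k. 0))"
  proof
    assume *: "\<not> (\<exists>H. hom_triple r H \<and> same_map P H)"
    show "\<forall>h. same_map P (triple_of_coeffs r h) \<longrightarrow> triple_of_coeffs r h = (\<lambda>k. 0)"
      using * homogeneous_triple_of_coeffs unfolding hom_triple_def by blast
  next
    assume *: "\<forall>h. same_map P (triple_of_coeffs r h) \<longrightarrow> triple_of_coeffs r h = (\<lambda>k. 0)"
    show "\<not> (\<exists>H. hom_triple r H \<and> same_map P H)"
      using * triple_of_coeffs_eq hom_triple_nonzero by metis
  qed
  finally show ?thesis unfolding solution zero .
qed

text \<open>The degree of an iterate is lower semicontinuous.\<close>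

lemma map_degree_iter_gt_open:
  fixes F :: "'a::field triple"
  assumes "hom_triple d F" "dominant F" "map_degree (iter_triple n F) > r"
  obtains Q e where "homogeneous e Q" "ev (coords F) Q \<noteq> 0"
    "\<And>G. hom_triple d G \<Longrightarrow> dominant G \<Longrightarrow> ev (coords G) Q \<noteq> 0 \<Longrightarrow> map_degree (iter_triple n G) > r"
proof -
  obtain e where e: "\<And>i. coeff_form d e (\<lambda>F :: 'a triple. iter_triple n F i)"
    using coeff_form_iter by blast
  have "\<exists>Q. homogeneous e Q \<and>
     (\<forall>F :: 'a triple. hom_triple d F \<longrightarrow> proportional_system (iter_triple n F) j z = ev (coords F) Q)" for j z
  proof -
    obtain i' j' m k \<nu> where jz: "j = (i', j', m)" "z = (k, \<nu>)" by (metis prod_cases3 surj_pair)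
    have "coeff_form d (e + 0) (\<lambda>F :: 'a triple. iter_triple n F i' * (if j' = k then single \<nu> 1 else 0)
      - iter_triple n F j' * (if i' = k then single \<nu> 1 else 0))"
      by (intro coeff_form_diff coeff_form_mult e coeff_form_fixed)
    then show ?thesis unfolding coeff_form_def proportional_system_def jz by simp
  qed
  then obtain M where M: "\<And>j z. homogeneous e (M j z)"
    "\<And>j z (F :: 'a triple). hom_triple d F \<Longrightarrow> proportional_system (iter_triple n F) j z = ev (coords F) (M j z)"
    by metis
  have iff: "trivial_kernel (coords G) UNIV (UNIV \<times> monoms r) M \<longleftrightarrow> map_degree (iter_triple n G) > r"
    if "hom_triple d G" "dominant G" for G
    unfolding trivial_kernel_def map_degree_gt_iff_trivial[OF iter_triple_dominant(1)[OF that]]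
    by (simp add: M(2)[OF that(1)])
  have "finite ((UNIV :: 3 set) \<times> monoms r)" by simp
  moreover have "trivial_kernel (coords F) UNIV (UNIV \<times> monoms r) M"
    using iff[OF assms(1,2)] assms(3) by simp
  ultimately obtain Q e' where Q: "homogeneous e' Q" "ev (coords F) Q \<noteq> 0"
    "\<And>x. ev x Q \<noteq> 0 \<Longrightarrow> trivial_kernel x UNIV (UNIV \<times> monoms r) M"
    using trivial_kernel_open[of "UNIV \<times> monoms r" e M "coords F" UNIV] M(1) by blast
  show ?thesis
  proof (rule that[OF Q(1,2)])
    fix G assume G: "hom_triple d G" "dominant G" "ev (coords G) Q \<noteq> 0"
    show "map_degree (iter_triple n G) > r" using iff[OF G(1,2)] Q(3)[OF G(3)] by simp
  qed
qed

lemma openin_nonvanishing: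
  assumes "homogeneous e Q"
  shows "openin (zariski d) {p \<in> proj_triples d. \<not> vanishes_at Q p}"
proof -
  have "proj_triples d - {p \<in> proj_triples d. \<not> vanishes_at Q p} = zero_locus d {Q}"
    by (auto simp: zero_locus_def)
  moreover have "zariski_closed d (zero_locus d {Q})"
    by (rule zariski_closedI[of "{Q}"]) (use assms in auto)
  ultimately show ?thesis unfolding openin_zariski by auto
qed

lemma BirE:
  assumes "f \<in> (Bir d :: 'a::field triple set set)"
  obtains F where "f = proj_pt F" "hom_triple d F" "no_common_factor F" "birational F"
  using assms by (auto simp: Bir_def)

lemma openin_BirI:
  fixes S :: "'a::field triple set set"
  assumes "S \<subseteq> Bir d"
    and "\<And>F. hom_triple d F \<Longrightarrow> proj_pt F \<in> S \<Longrightarrow> \<exists>Q e. homogeneous e Q \<and> ev (coords F) Q \<noteq> 0 \<and>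
      (\<forall>G. hom_triple d G \<longrightarrow> proj_pt G \<in> Bir d \<longrightarrow> ev (coords G) Q \<noteq> 0 \<longrightarrow> proj_pt G \<in> S)"
  shows "openin (Bir_top d) S"
proof (subst openin_subopen, rule ballI)
  fix f assume f: "f \<in> S"
  then obtain F where F: "f = proj_pt F" "hom_triple d F" using assms(1) BirE by blast
  then obtain Q e where Q: "homogeneous e Q" "ev (coords F) Q \<noteq> 0"
    "\<And>G. hom_triple d G \<Longrightarrow> proj_pt G \<in> Bir d \<Longrightarrow> ev (coords G) Q \<noteq> 0 \<Longrightarrow> proj_pt G \<in> S"
    using assms(2) f by blast
  let ?T = "{p \<in> proj_triples d. \<not> vanishes_at Q p} \<inter> Bir d"
  have "openin (Bir_top d) ?T"
    unfolding Bir_top_def openin_subtopology using openin_nonvanishing[OF Q(1)] by blast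
  moreover have "f \<in> ?T"
    using F Q f assms(1) by (auto simp: proj_triples_def vanishes_at_proj_pt)
  moreover have "?T \<subseteq> S"
  proof
    fix g assume g: "g \<in> ?T"
    then obtain G where G: "g = proj_pt G" "hom_triple d G" using BirE by blast
    then show "g \<in> S" using Q(3)[of G] g by (simp add: vanishes_at_proj_pt[OF Q(1)])
  qed
  ultimately show "\<exists>T. openin (Bir_top d) T \<and> f \<in> T \<and> T \<subseteq> S" by blast
qed

lemma proj_pt_BirD:
  assumes "hom_triple d F" "proj_pt F \<in> (Bir d :: 'a::alg_closed_field triple set set)"
  obtains G e where "birational_pair F G d e"
proof -
  obtain F' where F': "proj_pt F = proj_pt F'" "hom_triple d F'" "birational F'"
    using BirE[OF assms(2)] by metis
  have "F \<in> proj_pt F'" using self_in_proj_pt F'(1) by blast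
  then obtain c where c: "c \<noteq> 0" "F = mult_triple (const c) F'"
    by (auto simp: proj_pt_def scale_triple_def mult_triple_def)
  obtain G e where "birational_pair F' G d e" using birational_pair_if_birational F' by blast
  then interpret b: birational_pair F' G d e .
  have c0: "(const c :: (3, 'a) mpoly) \<noteq> 0" using c(1) by simp
  have "birational_pair F G d e"
  proof
    show "hom_triple d F" by fact
    show "hom_triple e G" "dominant G" by (fact b.hom_G b.dominant_G)+
    show "dominant F" unfolding c(2) dominant_mult_iff[OF c0] by (fact b.dominant_F)
    show "same_map (comp_triple F G) var"
      unfolding c(2) comp_mult_left by (simp add: same_map_mult_left c(1) b.FG)
    show "same_map (comp_triple G F) var"
      unfolding c(2) comp_mult_right[OF b.hom_G] by (simp add: same_map_mult_left c(1) b.GF)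
  qed
  then show ?thesis by (rule that)
qed

text \<open>If the dynamical degree of \<open>F\<close> exceeds \<open>l\<close>, some iterate has a degree that certifies it; nearby
  maps have iterates of at least this degree.\<close>

lemma lambda1_gt_open:
  assumes "d \<ge> 1"
  shows "openin (Bir_top d) {f \<in> (Bir d :: 'a::alg_closed_field triple set set). lambda1 f > l}"
proof (cases "l \<ge> 1")
  case False
  have "lambda1 f > l" if f: "f \<in> (Bir d :: 'a triple set set)" for f
  proof -
    obtain F where F: "f = proj_pt F" "hom_triple d F" using BirE[OF f] .
    obtain G e where "birational_pair F G d e" using proj_pt_BirD F f by blast
    then show ?thesis
      using birational_pair.dyn_degree_properties(1) lambda1_proj_pt[OF F(2)] F(1) False by fastforce
  qed
  then have "{f \<in> (Bir d :: 'a triple set set). lambda1 f > l} = topspace (Bir_top d)"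
    by (auto simp: topspace_Bir_top)
  then show ?thesis by simp
next
  case True
  show ?thesis
  proof (rule openin_BirI)
    fix F :: "'a triple"
    assume F: "hom_triple d F" "proj_pt F \<in> {f \<in> Bir d. lambda1 f > l}"
    then obtain G e where "birational_pair F G d e" using proj_pt_BirD by blast
    then interpret birational_pair F G d e .
    have "dyn_degree F > l" using F lambda1_proj_pt[OF F(1)] by simp
    then obtain j :: nat where "4096 ^ j * l ^ (2 ^ j) * real d < dyn_degree F ^ (2 ^ j)"
      using doubly_exponential_beats[of l "dyn_degree F" 4096 "real d"] True assms by auto
    then have j: "4096 ^ j * l ^ (2 ^ j) * real d < real (deg_F (2 ^ j))"
      using dyn_degree_properties(2)[of "2 ^ j"] by linarith
    define r where "r = deg_F (2 ^ j) - 1"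
    have r: "deg_F (2 ^ j) > r" using deg_F_pos[of "2 ^ j"] by (simp add: r_def)
    obtain Q e' where Q: "homogeneous e' Q" "ev (coords F) Q \<noteq> 0"
      "\<And>G. hom_triple d G \<Longrightarrow> dominant G \<Longrightarrow> ev (coords G) Q \<noteq> 0 \<Longrightarrow> map_degree (iter_triple (2 ^ j) G) > r"
      using map_degree_iter_gt_open[OF hom_F dominant_F r] by blast
    have "proj_pt G \<in> {f \<in> Bir d. lambda1 f > l}"
      if G: "hom_triple d G" "proj_pt G \<in> Bir d" "ev (coords G) Q \<noteq> 0" for G
    proof -
      obtain G' k where "birational_pair G G' d k" using proj_pt_BirD G by blast
      then interpret g: birational_pair G G' d k .
      have "g.deg_F (2 ^ j) \<ge> deg_F (2 ^ j)" using Q(3)[OF G(1) g.dominant_F G(3)] by (simp add: r_def)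
      then have "4096 ^ j * l ^ (2 ^ j) * real d < real (g.deg_F (2 ^ j))" using j by linarith
      then show ?thesis using g.dyn_degree_gt[OF True] G(2) lambda1_proj_pt[OF G(1)] by simp
    qed
    then show "\<exists>Q e. homogeneous e Q \<and> ev (coords F) Q \<noteq> 0 \<and>
      (\<forall>G. hom_triple d G \<longrightarrow> proj_pt G \<in> Bir d \<longrightarrow> ev (coords G) Q \<noteq> 0 \<longrightarrow> proj_pt G \<in> {f \<in> Bir d. lambda1 f > l})"
      using Q(1,2) by blast
  qed auto
qed

section \<open>Restriction to a line\<close>

lemma nonvanishing_point:
  fixes p :: "(3, 'a::field) mpoly"
  assumes "infinite (UNIV :: 'a set)" "p \<noteq> 0"
  shows "\<exists>x. ev x p \<noteq> 0"
proof -
  define N where "N = Suc (Max (monom_degree ` keys p))"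
  have N: "monom_degree m < N" if "m \<in> keys p" for m
    using that by (simp add: N_def less_Suc_eq_le)
  define \<kappa> :: "(3 \<Rightarrow>\<^sub>0 nat) \<Rightarrow> nat" where
    "\<kappa> m = lookup m 1 + N * (lookup m 2 + N * lookup m 3)" for m
  \<comment> \<open>Kronecker substitution: the exponents are the digits of a number in base \<open>N\<close>.\<close>
  have inj: "m = m'" if "m \<in> keys p" "m' \<in> keys p" "\<kappa> m = \<kappa> m'" for m m'
  proof -
    have dig: "lookup m 1 = \<kappa> m mod N \<and> lookup m 2 = \<kappa> m div N mod N
        \<and> lookup m 3 = \<kappa> m div N div N" if "m \<in> keys p" for m
    proof -
      have "lookup m 1 < N" "lookup m 2 < N"
        using N[OF that] by (simp_all add: monom_degree_3)
      then show ?thesis by (simp add: \<kappa>_def)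
    qed
    show ?thesis using dig[OF that(1)] dig[OF that(2)] that(3) by (intro mono3_eqI) simp_all
  qed
  define q where "q = (\<Sum>m\<in>keys p. monom (lookup p m) (\<kappa> m))"
  obtain m0 where m0: "m0 \<in> keys p" using assms(2) lead_mono_in_keys by blast
  have "coeff q (\<kappa> m0) = (\<Sum>m\<in>keys p. if m = m0 then lookup p m0 else 0)"
    unfolding q_def coeff_sum by (intro sum.cong) (use inj m0 in auto)
  also have "\<dots> = lookup p m0" using m0 by simp
  finally have "q \<noteq> 0" using m0 by (auto simp: in_keys_iff)
  then obtain t where t: "poly q t \<noteq> 0"
    using ex_new_if_finite[OF assms(1) poly_roots_finite] by auto
  have "poly q t = ev (\<lambda>v. if v = 1 then t else if v = 2 then t ^ N else t ^ (N * N)) p"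
    unfolding q_def poly_sum subst_def monom_subst_3
    by (intro sum.cong refl) (simp add: poly_monom \<kappa>_def power_add power_mult algebra_simps flip: power_mult)
  then show ?thesis using t by metis
qed

text \<open>Restriction to the line through \<open>c\<close> and \<open>w\<close> in the affine parameter \<open>u \<mapsto> w + u c\<close>. The point \<open>c\<close>
  is at infinity: the value there is the coefficient at the formal degree.\<close>

definition restrict_line :: "(3 \<Rightarrow> 'a) \<Rightarrow> (3 \<Rightarrow> 'a) \<Rightarrow> (3, 'a::field) mpoly \<Rightarrow> 'a poly" where
  "restrict_line c w = subst (\<lambda>a. [:a:]) (\<lambda>v. [:w v, c v:])"

lemma coeff_hom_const_upoly: "coeff_hom (\<lambda>a::'a::field. [:a:])"
  by unfold_locales simp_all

lemma restrict_line_mult: "restrict_line c w (p * q) = restrict_line c w p * restrict_line c w q"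
  unfolding restrict_line_def by (rule coeff_hom.subst_mult[OF coeff_hom_const_upoly])

lemma poly_restrict_line: "poly (restrict_line c w p) u = ev (\<lambda>v. w v + u * c v) p"
proof -
  have "coeff_hom (\<lambda>q. poly q u)" by unfold_locales simp_all
  then show ?thesis
    unfolding restrict_line_def by (subst ring_hom_subst[of "\<lambda>q. poly q u"]) simp_all
qed

lemma coeff_mult_top:
  fixes p q :: "'a::comm_ring_1 poly"
  assumes "degree p \<le> m" "degree q \<le> n"
  shows "degree (p * q) \<le> m + n" "coeff (p * q) (m + n) = coeff p m * coeff q n"
proof -
  show "degree (p * q) \<le> m + n" using degree_mult_le[of p q] assms by linarith
  have "coeff (p * q) (m + n) = (\<Sum>i\<le>m + n. if i = m then coeff p m * coeff q n else 0)"
    unfolding coeff_mult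
  proof (intro sum.cong refl)
    fix i assume "i \<in> {..m + n}"
    consider "i < m" | "i = m" | "i > m" by linarith
    then show "coeff p i * coeff q (m + n - i) = (if i = m then coeff p m * coeff q n else 0)"
      using assms by cases (auto simp: coeff_eq_0)
  qed
  then show "coeff (p * q) (m + n) = coeff p m * coeff q n" by simp
qed

lemma coeff_power_top:
  fixes p :: "'a::comm_ring_1 poly"
  assumes "degree p \<le> 1"
  shows "degree (p ^ n) \<le> n \<and> coeff (p ^ n) n = coeff p 1 ^ n"
proof (induction n)
  case (Suc n)
  then show ?case using coeff_mult_top[OF assms, of "p ^ n" n] by simp
qed simp

lemma restrict_line_top:
  assumes "homogeneous D p"
  shows "degree (restrict_line c w p) \<le> D" "coeff (restrict_line c w p) D = ev c p"
proof -
  have m: "degree (monom_subst (\<lambda>v. [:w v, c v:]) m) \<le> monom_degree m \<and>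
      coeff (monom_subst (\<lambda>v. [:w v, c v:]) m) (monom_degree m) = monom_subst c m" for m
  proof -
    have *: "degree ([:w v, c v:] ^ n) \<le> n" "coeff ([:w v, c v:] ^ n) n = c v ^ n" for v n
      using coeff_power_top[of "[:w v, c v:]" n] by simp_all
    show ?thesis
      unfolding monom_subst_3 monom_degree_3
      by (simp add: coeff_mult_top * del: degree_mult_eq)
  qed
  show "degree (restrict_line c w p) \<le> D"
    unfolding restrict_line_def subst_def
  proof (rule degree_sum_le[OF finite_keys])
    fix k assume "k \<in> keys p"
    then have "monom_degree k = D" using assms by (simp add: homogeneous_def)
    then show "degree ([:lookup p k:] * monom_subst (\<lambda>v. [:w v, c v:]) k) \<le> D"
      using m[of k] degree_smult_le[of "lookup p k"] by (simp add: order_trans[OF degree_smult_le])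
  qed
  have "coeff (restrict_line c w p) D = (\<Sum>k\<in>keys p. lookup p k *
      coeff (monom_subst (\<lambda>v. [:w v, c v:]) k) D)"
    by (simp add: restrict_line_def subst_def coeff_sum)
  also have "\<dots> = ev c p"
    unfolding subst_def
  proof (intro sum.cong refl)
    fix k assume "k \<in> keys p"
    then have "monom_degree k = D" using assms by (simp add: homogeneous_def)
    then show "lookup p k * coeff (monom_subst (\<lambda>v. [:w v, c v:]) k) D
        = lookup p k * monom_subst c k"
      using m[of k] by simp
  qed
  finally show "coeff (restrict_line c w p) D = ev c p" .
qed

text \<open>Over an algebraically closed field the roots of \<open>p\<close> can be split off one at a time.\<close>

lemma dvd_of_no_common_root:
  fixes p q a :: "'a::alg_closed_field poly"
  assumes "p \<noteq> 0" "\<And>u. poly p u = 0 \<Longrightarrow> poly q u \<noteq> 0" "p dvd a * q"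
  shows "p dvd a"
  using assms
proof (induction "degree p" arbitrary: p a)
  case 0
  then have "is_unit p" using is_unit_iff_degree[of p] by simp
  then show ?case by (rule unit_imp_dvd)
next
  case (Suc n)
  obtain r where r: "poly p r = 0" using alg_closed_imp_poly_has_root[of p] Suc.hyps(2) by auto
  then have "[:- r, 1:] dvd p" by (simp add: poly_eq_0_iff_dvd)
  then obtain p' where p': "p = [:- r, 1:] * p'" by (rule dvdE)
  have "[:- r, 1:] dvd a * q" using Suc.prems(3) unfolding p' by (rule dvd_mult_left)
  then have "poly a r * poly q r = 0" by (simp flip: poly_mult add: poly_eq_0_iff_dvd)
  then have "poly a r = 0" using Suc.prems(2)[OF r] by simp
  then have "[:- r, 1:] dvd a" by (simp add: poly_eq_0_iff_dvd)
  then obtain a' where a': "a = [:- r, 1:] * a'" by (rule dvdE)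
  have "p' \<noteq> 0" using Suc.prems(1) p' by auto
  have "degree p = Suc (degree p')" using \<open>p' \<noteq> 0\<close> unfolding p' by (subst degree_mult_eq) auto
  then have "n = degree p'" using Suc.hyps(2) by simp
  moreover have "p' dvd a' * q"
  proof -
    have "[:- r, 1:] * p' dvd [:- r, 1:] * (a' * q)" using Suc.prems(3) by (simp only: p' a' mult.assoc)
    then show ?thesis by (subst (asm) dvd_mult_cancel_left) auto
  qed
  moreover have "poly q u \<noteq> 0" if "poly p' u = 0" for u using Suc.prems(2)[of u] that by (simp add: p')
  ultimately have "p' dvd a'" using Suc.hyps(1) \<open>p' \<noteq> 0\<close> by blast
  then show ?case unfolding p' a' by (rule mult_dvd_mono[OF dvd_refl])
qed


section \<open>A line without base points\<close>

text \<open>In degree \<open>n\<close> the ideal of two coprime forms of degree \<open>d\<close> has codimension at most \<open>d\<^sup>2\<close>, so it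
  contains a nonzero binary form in any two given linear forms once \<open>n + 1 > d\<^sup>2\<close>.\<close>

lemma coprime_pair_contains_binary_form:
  fixes M0 M1 y z :: "(3, 'a::field) mpoly"
  assumes M: "homogeneous d M0" "homogeneous d M1" "M0 \<noteq> 0" "M1 \<noteq> 0"
    and cop: "\<And>X. M1 dvd M0 * X \<Longrightarrow> M1 dvd X"
    and lin: "homogeneous 1 y" "homogeneous 1 z"
  shows "\<exists>n r p q. (\<exists>i\<le>n. r i \<noteq> 0) \<and>
    (\<Sum>i\<le>n. const (r i) * (y ^ i * z ^ (n - i))) = p * M0 + q * M1"
proof -
  define k where "k = d + d * d"
  define n where "n = k + d"
  let ?C = "complement_monoms M1 k"
  define I where "I = {..n} <+> (?C <+> monoms k)"
  define v :: "nat + ((3 \<Rightarrow>\<^sub>0 nat) + (3 \<Rightarrow>\<^sub>0 nat)) \<Rightarrow> (3, 'a) mpoly" where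
    "v = case_sum (\<lambda>i. y ^ i * z ^ (n - i)) (case_sum (\<lambda>m. single m 1 * M0)
       (\<lambda>m. single m 1 * M1))"
  have fin: "finite I" by (simp add: I_def)
  have "card I = n + 1 + (card ?C + card (monoms k))"
    by (simp add: I_def card_Plus)
  moreover have "card ?C + card (monoms (d * d)) = card (monoms k)"
    using card_complement_monoms[OF M(2,4), of k] by (simp add: k_def)
  ultimately have "2 * card I + (d * d + 1) * (d * d + 2) = 2 * n + 2 + 2 * ((k + 1) * (k + 2))"
    using card_monoms[of k] card_monoms[of "d * d"] by linarith
  moreover have "2 * card (monoms n) = (n + 1) * (n + 2)" by (rule card_monoms)
  ultimately have "card (monoms n) < card I"
    unfolding n_def k_def by (simp add: algebra_simps)
  then obtain a where a: "\<exists>x\<in>I. a x \<noteq> 0" "\<forall>m\<in>monoms n. (\<Sum>x\<in>I. lookup (v x) m * a x) = 0"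
    using nontrivial_solution[OF finite_monoms fin, of n "\<lambda>m x. lookup (v x) m"] by auto
  have hv: "homogeneous n (v x)" if "x \<in> I" for x
  proof -
    have "homogeneous n (y ^ i * z ^ (n - i))" if "i \<le> n" for i
      using homogeneous_mult[OF homogeneous_power[OF lin(1), of i] homogeneous_power[OF lin(2), of "n - i"]] that
      by simp
    moreover have "homogeneous n (single m 1 * M0)" "homogeneous n (single m 1 * M1)"
      if "m \<in> monoms k" for m
      using homogeneous_mult[OF homogeneous_single[of m 1] M(1)] homogeneous_mult[OF homogeneous_single[of m 1] M(2)] that
      by (simp_all add: monoms_def n_def)
    ultimately show ?thesis
      using that by (auto simp: I_def v_def complement_monoms_def)
  qed
  have "(\<Sum>x\<in>I. const (a x) * v x) = 0"
  proof (rule poly_mapping_eqI)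
    fix m
    have h: "homogeneous n (\<Sum>x\<in>I. const (a x) * v x)"
      by (intro homogeneous_sum homogeneous_const_mult hv)
    show "lookup (\<Sum>x\<in>I. const (a x) * v x) m = lookup 0 m"
    proof (cases "m \<in> monoms n")
      case True
      then show ?thesis unfolding lookup_sum const_mult_lookup using a(2) by (simp add: mult.commute)
    next
      case False
      then show ?thesis using homogeneous_lookup[OF h, of m] by (auto simp: monoms_def)
    qed
  qed
  moreover define p where "p = (\<Sum>m\<in>?C. single m (a (Inr (Inl m))))"
  moreover define q where "q = (\<Sum>m\<in>monoms k. single m (a (Inr (Inr m))))"
  define R where "R = (\<Sum>i\<le>n. const (a (Inl i)) * (y ^ i * z ^ (n - i)))"
  moreover have "(\<Sum>x\<in>I. const (a x) * v x) = R + (p * M0 + q * M1)"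
    unfolding I_def R_def p_def q_def sum_distrib_right
    by (simp add: sum.Plus v_def const_def mult_single flip: mult.assoc)
  ultimately have zero: "R + (p * M0 + q * M1) = 0" by simp
  have lp: "lookup p m = (if m \<in> ?C then a (Inr (Inl m)) else 0)" for m
    by (simp add: p_def lookup_sum lookup_single when_def sum.delta)
  have lq: "lookup q m = (if m \<in> monoms k then a (Inr (Inr m)) else 0)" for m
    by (simp add: q_def lookup_sum lookup_single when_def sum.delta)
  have "\<exists>i\<le>n. a (Inl i) \<noteq> 0"
  proof (rule ccontr)
    assume *: "\<not> (\<exists>i\<le>n. a (Inl i) \<noteq> 0)"
    then have "R = 0" by (simp add: R_def)
    then have eq: "M0 * p = M1 * (- q)" using zero by (simp add: eq_neg_iff_add_eq_0 mult.commute)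
    have "M1 dvd M0 * p" unfolding eq by simp
    then have "M1 dvd p" by (rule cop)
    moreover have "keys p \<subseteq> ?C" by (auto simp: in_keys_iff lp split: if_splits)
    ultimately have "p = 0" using complement_monoms_not_dvd[OF M(4)] by blast
    then have "q = 0" using eq M(4) by simp
    have "a (Inr (Inl m)) = 0" if "m \<in> ?C" for m using lp[of m] that \<open>p = 0\<close> by simp
    moreover have "a (Inr (Inr m)) = 0" if "m \<in> monoms k" for m using lq[of m] that \<open>q = 0\<close> by simp
    ultimately have "\<forall>x\<in>I. a x = 0" using * by (auto simp: I_def)
    then show False using a(1) by blast
  qed
  moreover have "R = (- p) * M0 + (- q) * M1"
    using zero by (simp add: eq_neg_iff_add_eq_0[symmetric])
  ultimately show ?thesis unfolding R_def by (intro exI[of _ n] exI[of _ "\<lambda>i. a (Inl i)"]) blast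
qed

lemma finite_conic_zero:
  fixes v :: "3 \<Rightarrow> 'a::field"
  assumes "v \<noteq> (\<lambda>i. 0)"
  shows "finite {t. v 1 + t * v 2 + t ^ 2 * v 3 = 0}"
proof -
  have "[:v 1, v 2, v 3:] \<noteq> 0"
  proof
    assume "[:v 1, v 2, v 3:] = 0"
    then have "v i = 0" for i using exhaust_3[of i] by auto
    then show False using assms by auto
  qed
  then have "finite {t. poly [:v 1, v 2, v 3:] t = 0}" by (rule poly_roots_finite)
  then show ?thesis by (simp add: power2_eq_square algebra_simps)
qed

lemma ev_conic_form: "ev z (conic_form t F) = ev z (F 1) + t * ev z (F 2) + t ^ 2 * ev z (F 3)"
  by (simp add: conic_form_def)

lemma ev_scale: "homogeneous e p \<Longrightarrow> ev (\<lambda>v. a * x v) p = a ^ e * ev x p"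
  by (rule subst_scale)

text \<open>The lines through a point \<open>c\<close> that is not a base point: a binary form in the ideal of two
  coprime members of the net, in coordinates on the pencil of these lines, vanishes on all lines that
  meet the base locus.\<close>

lemma line_without_base_points:
  fixes F :: "'a::field triple"
  assumes inf: "infinite (UNIV :: 'a set)" and F: "reduced d F"
  obtains c w where "c 1 = 1" "w 1 = 0" "w 2 = 1"
    "\<And>\<alpha> \<beta>. (\<And>i. ev (\<lambda>v. \<alpha> * c v + \<beta> * w v) (F i) = 0) \<Longrightarrow> \<alpha> = 0 \<and> \<beta> = 0"
proof -
  obtain i where i: "F i \<noteq> 0" using reducedD(1)[OF F] unfolding hom_triple_def by meson
  have hF: "homogeneous d (F j)" for j by (rule hom_triple_homogeneous[OF reducedD(1)[OF F]])
  have "var 1 * F i \<noteq> 0" using i by simp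
  then obtain x where x: "ev x (var 1 * F i) \<noteq> 0" using nonvanishing_point[OF inf] by blast
  define c where "c = (\<lambda>v. inverse (x 1) * x v)"
  have c1: "c 1 = 1" using x by (simp add: c_def)
  have ci: "ev c (F i) \<noteq> 0" unfolding c_def using x by (simp add: ev_scale[OF hF])
  obtain s where s: "conic_form s F \<noteq> 0"
    using ex_new_if_finite[OF inf finite_conic_form_zero[OF hom_triple_nonzero[OF reducedD(1)[OF F]]]]
    by auto
  obtain t where t: "conic_form t F \<noteq> 0"
    "\<And>n X. conic_form t F ^ n dvd conic_form s F * X \<Longrightarrow> conic_form t F ^ n dvd X"
    using ex_new_if_finite[OF inf finite_UnI[OF
        finite_conic_form_zero[OF hom_triple_nonzero[OF reducedD(1)[OF F]]]
        finite_conic_form_not_coprime[OF reducedD(2)[OF F] s]]]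
    by auto
  have cop: "conic_form t F dvd X" if "conic_form t F dvd conic_form s F * X" for X
    using t(2)[of 1 X] that by simp
  define y where "y = var 2 - const (c 2) * var (1::3)"
  define z where "z = var 3 - const (c 3) * var (1::3)"
  have lin: "homogeneous 1 y" "homogeneous 1 z"
    unfolding y_def z_def by (intro homogeneous_diff homogeneous_const_mult homogeneous_var)+
  obtain n r p q where r: "\<exists>i\<le>n. r i \<noteq> 0"
    "(\<Sum>i\<le>n. const (r i) * (y ^ i * z ^ (n - i))) = p * conic_form s F + q * conic_form t F"
    using coprime_pair_contains_binary_form[OF homogeneous_conic_form[OF reducedD(1)[OF F]]
        homogeneous_conic_form[OF reducedD(1)[OF F]] s t(1) cop lin] by blast
  define \<rho> where "\<rho> = (\<Sum>i\<le>n. monom (r i) (n - i))"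
  obtain i0 where i0: "i0 \<le> n" "r i0 \<noteq> 0" using r(1) by blast
  have "coeff \<rho> (n - i0) = (\<Sum>i\<le>n. if i = i0 then r i0 else 0)"
    unfolding \<rho>_def coeff_sum using i0 by (intro sum.cong) auto
  then have "\<rho> \<noteq> 0" using i0 by auto
  then obtain \<tau> where \<tau>: "poly \<rho> \<tau> \<noteq> 0"
    using ex_new_if_finite[OF inf poly_roots_finite] by auto
  define w :: "3 \<Rightarrow> 'a" where "w = (\<lambda>v. if v = 1 then 0 else if v = 2 then 1 else \<tau>)"
  have w: "w 1 = 0" "w 2 = 1" "w 3 = \<tau>" by (simp_all add: w_def)
  show ?thesis
  proof (rule that[of c w])
    fix \<alpha> \<beta> assume zero: "\<And>i. ev (\<lambda>v. \<alpha> * c v + \<beta> * w v) (F i) = 0"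
    let ?x = "\<lambda>v. \<alpha> * c v + \<beta> * w v"
    have yz: "ev ?x y = \<beta>" "ev ?x z = \<beta> * \<tau>" by (simp_all add: y_def z_def c1 w algebra_simps)
    have "ev ?x (\<Sum>i\<le>n. const (r i) * (y ^ i * z ^ (n - i))) = 0"
      unfolding r(2) by (simp add: ev_conic_form zero)
    moreover have "ev ?x (\<Sum>i\<le>n. const (r i) * (y ^ i * z ^ (n - i))) = (\<Sum>i\<le>n. \<beta> ^ n * (r i * \<tau> ^ (n - i)))"
      unfolding ev_sum
    proof (intro sum.cong refl)
      fix i assume "i \<in> {..n}"
      then have "\<beta> ^ n = \<beta> ^ i * \<beta> ^ (n - i)" by (simp flip: power_add)
      then show "ev ?x (const (r i) * (y ^ i * z ^ (n - i))) = \<beta> ^ n * (r i * \<tau> ^ (n - i))"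
        by (simp add: yz power_mult_distrib)
    qed
    moreover have "\<dots> = \<beta> ^ n * poly \<rho> \<tau>"
      by (simp add: \<rho>_def poly_sum poly_monom sum_distrib_left)
    ultimately have "\<beta> ^ n * poly \<rho> \<tau> = 0" by simp
    then have \<beta>: "\<beta> = 0" using \<tau> by simp
    then have "\<alpha> ^ d * ev c (F i) = 0" using zero[of i] by (simp add: ev_scale[OF hF])
    then show "\<alpha> = 0 \<and> \<beta> = 0" using \<beta> ci by simp
  qed (use c1 w in auto)
qed

section \<open>Iterates without common factor\<close>

text \<open>The system \<open>a p - b q = 0\<close> for the restrictions \<open>p\<close>, \<open>q\<close> of \<open>P 1\<close>, \<open>P 2\<close> to a line, in the coefficients
  of the unknown polynomials \<open>a\<close>, \<open>b\<close> of degree less than \<open>D\<close>. For forms \<open>P 1\<close>, \<open>P 2\<close> of positive degree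
  \<open>D\<close> over an algebraically closed field this is Sylvester's criterion: it has only the trivial
  solution iff the forms have no common zero on the projective line.\<close>

definition line_system :: "(3 \<Rightarrow> 'a) \<Rightarrow> (3 \<Rightarrow> 'a) \<Rightarrow> 'a::field triple \<Rightarrow> nat \<Rightarrow> nat + nat \<Rightarrow> 'a" where
  "line_system c w P k = case_sum (\<lambda>i. coeff (monom 1 i * restrict_line c w (P 1)) k)
     (\<lambda>i. - coeff (monom 1 i * restrict_line c w (P 2)) k)"

definition line_unknowns :: "nat \<Rightarrow> (nat + nat) set" where
  "line_unknowns D = {..<D} <+> {..<D}"

definition line_system_trivial :: "(3 \<Rightarrow> 'a) \<Rightarrow> (3 \<Rightarrow> 'a) \<Rightarrow> nat \<Rightarrow> 'a::field triple \<Rightarrow> bool" where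
  "line_system_trivial c w D P \<longleftrightarrow>
     (\<forall>h. (\<forall>k. (\<Sum>x\<in>line_unknowns D. line_system c w P k x * h x) = 0) \<longrightarrow> (\<forall>x\<in>line_unknowns D. h x = 0))"

lemma poly_as_monom_sum:
  fixes a :: "'a::field poly"
  assumes "degree a < D"
  shows "(\<Sum>i<D. monom (coeff a i) i) = a"
  by (intro poly_eqI) (use assms in \<open>auto simp: coeff_sum coeff_eq_0\<close>)

lemma line_system_sum:
  "(\<Sum>x\<in>line_unknowns D. line_system c w P k x * h x) =
    coeff ((\<Sum>i<D. monom (h (Inl i)) i) * restrict_line c w (P 1)
      - (\<Sum>i<D. monom (h (Inr i)) i) * restrict_line c w (P 2)) k"
proof -
  have *: "coeff (monom 1 i * p) k * b = coeff (monom b i * p) k" for i b and p :: "'a poly"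
  proof -
    have "monom b i = smult b (monom 1 i)" by (simp add: smult_monom)
    then show ?thesis by (simp add: mult.commute)
  qed
  show ?thesis
    by (simp add: line_unknowns_def sum.Plus line_system_def * sum_negf sum_distrib_right coeff_sum)
qed

lemma line_system_trivialI:
  fixes P :: "'a::alg_closed_field triple"
  assumes hom: "\<And>i. homogeneous D (P i)"
    and inf: "ev c (P 1) \<noteq> 0 \<or> ev c (P 2) \<noteq> 0"
    and fin: "\<And>u. ev (\<lambda>v. w v + u * c v) (P 1) \<noteq> 0 \<or> ev (\<lambda>v. w v + u * c v) (P 2) \<noteq> 0"
  shows "line_system_trivial c w D P"
  unfolding line_system_trivial_def
proof (intro allI impI ballI)
  fix h x
  assume h: "\<forall>k. (\<Sum>x\<in>line_unknowns D. line_system c w P k x * h x) = 0"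
    and x: "x \<in> line_unknowns D"
  have D: "D > 0" using x by (auto simp: line_unknowns_def)
  define p q where "p = restrict_line c w (P 1)" and "q = restrict_line c w (P 2)"
  define a b where "a = (\<Sum>i<D. monom (h (Inl i)) i)" and "b = (\<Sum>i<D. monom (h (Inr i)) i)"
  have deg: "degree a < D" "degree b < D"
    unfolding a_def b_def using D by (auto intro!: degree_sum_less intro: le_less_trans[OF degree_monom_le])
  have ca: "coeff a i = h (Inl i)" "coeff b i = h (Inr i)" if "i < D" for i
    using that by (simp_all add: a_def b_def coeff_sum)
  have eq: "a * p = b * q"
  proof (rule poly_eqI)
    fix k show "coeff (a * p) k = coeff (b * q) k"
      using h unfolding line_system_sum by (simp add: a_def b_def p_def q_def)
  qed
  have top: "degree p \<le> D" "coeff p D = ev c (P 1)" "degree q \<le> D" "coeff q D = ev c (P 2)"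
    unfolding p_def q_def by (rule restrict_line_top[OF hom])+
  have nz: "poly p u \<noteq> 0 \<or> poly q u \<noteq> 0" for u
    using fin[of u] by (simp add: p_def q_def poly_restrict_line)
  have "a = 0 \<and> b = 0"
  proof (cases "coeff q D = 0")
    case False
    then have q: "q \<noteq> 0" "degree q = D" using top le_degree[of q D] by auto
    have "q dvd a * p" unfolding eq by simp
    moreover have "poly p u \<noteq> 0" if "poly q u = 0" for u using nz[of u] that by simp
    ultimately have "q dvd a" using dvd_of_no_common_root[OF q(1)] by blast
    then have "a = 0" using deg(1) q(2) dvd_imp_degree_le[of q a] by (cases "a = 0") auto
    then show ?thesis using eq q(1) by auto
  next
    case True
    then have p: "p \<noteq> 0" "degree p = D" using inf top le_degree[of p D] by auto
    have "p dvd b * q" unfolding eq[symmetric] by simp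
    moreover have "poly q u \<noteq> 0" if "poly p u = 0" for u using nz[of u] that by simp
    ultimately have "p dvd b" using dvd_of_no_common_root[OF p(1)] by blast
    then have "b = 0" using deg(2) p(2) dvd_imp_degree_le[of p b] by (cases "b = 0") auto
    then show ?thesis using eq p(1) by auto
  qed
  then show "h x = 0" using x ca by (auto simp: line_unknowns_def)
qed

lemma homogeneous_dvd_degree_0:
  fixes h :: "(3, 'a::field) mpoly"
  assumes "homogeneous 0 h" "h \<noteq> 0"
  shows "h dvd 1"
proof -
  have "hom_triple 0 (\<lambda>i::3. h)" using assms by (auto simp: hom_triple_def fun_eq_iff)
  from hom_triple_0_const[OF this] obtain a where a: "(\<lambda>i::3. h) = (\<lambda>i. const (a i))" by blast
  have h: "h = const (a 1)" using fun_cong[OF a, of 1] by simp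
  have "1 = const (a 1) * const (inverse (a 1))"
    using assms(2) h by (simp flip: const_mult add: const_1)
  then show ?thesis unfolding h by (rule dvdI)
qed

text \<open>A common factor \<open>h\<close> of the first two entries would give the nontrivial solution whose
  components are the restrictions of the cofactors.\<close>

lemma no_common_factor_if_line_system_trivial:
  fixes P :: "'a::field triple"
  assumes hom: "\<And>i. homogeneous D (P i)" and D: "D > 0"
    and triv: "line_system_trivial c w D P"
  shows "no_common_factor P"
proof -
  let ?\<rho> = "restrict_line c w"
  have no_solution: "a = 0 \<and> b = 0" if "degree a < D" "degree b < D" "a * ?\<rho> (P 1) = b * ?\<rho> (P 2)" for a b
  proof -
    define h where "h = case_sum (coeff a) (coeff b)"
    have "(\<Sum>x\<in>line_unknowns D. line_system c w P k x * h x) = 0" for k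
      unfolding line_system_sum using that by (simp add: h_def poly_as_monom_sum)
    then have h0: "h x = 0" if "x \<in> line_unknowns D" for x 
      using triv that unfolding line_system_trivial_def by blast
    have "coeff a i = 0 \<and> coeff b i = 0" for i
    proof (cases "i < D")
      case True
      then show ?thesis using h0[of "Inl i"] h0[of "Inr i"] by (auto simp: line_unknowns_def h_def)
    next
      case False
      then show ?thesis using that by (simp add: coeff_eq_0)
    qed
    then show ?thesis by (simp add: poly_eq_iff)
  qed
  have not_both: "\<not> (?\<rho> (P 1) = 0 \<and> ?\<rho> (P 2) = 0)"
    using no_solution[of 1 0] D by auto
  have "P \<noteq> (\<lambda>i. 0)"
  proof
    assume "P = (\<lambda>i. 0)"
    then show False using not_both by (simp add: restrict_line_def)
  qed
  then have P: "hom_triple D P" using hom by (simp add: hom_triple_def)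
  show ?thesis
    unfolding no_common_factor_def
  proof (intro allI impI)
    fix h assume "\<forall>i. h dvd P i"
    then have "\<forall>i. \<exists>g. P i = h * g" by (simp add: dvd_def)
    then obtain H where H: "\<And>i. P i = h * H i" by metis
    then have "P = mult_triple h H" unfolding mult_triple_def by (rule ext)
    then have P': "hom_triple D (mult_triple h H)" using P by simp
    obtain \<delta> where \<delta>: "homogeneous \<delta> h" "h \<noteq> 0" "\<delta> \<le> D" "hom_triple (D - \<delta>) H"
      by (rule hom_triple_factor[OF P'])
    show "h dvd 1"
    proof (cases "\<delta> = 0")
      case True
      then show ?thesis using homogeneous_dvd_degree_0 \<delta> by blast
    next
      case False
      have "degree (?\<rho> (H i)) < D" for i
        using restrict_line_top(1)[OF hom_triple_homogeneous[OF \<delta>(4)], of c w i] False D by linarith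
      moreover have "?\<rho> (H 2) * ?\<rho> (P 1) = ?\<rho> (H 1) * ?\<rho> (P 2)"
        unfolding H restrict_line_mult by (simp add: ac_simps)
      ultimately have "?\<rho> (H 2) = 0 \<and> ?\<rho> (H 1) = 0" by (intro no_solution)
      then have False using not_both by (simp add: H restrict_line_mult)
      then show ?thesis ..
    qed
  qed
qed

lemma homogeneous_iter:
  assumes "hom_triple d F"
  shows "homogeneous (d ^ n) (iter_triple n F i)"
proof (induction n arbitrary: i)
  case 0
  then show ?case using homogeneous_var[of i] by simp
next
  case (Suc n)
  show ?case
    unfolding iter_triple_Suc comp_triple_def
    using homogeneous_psubst[OF hom_triple_homogeneous[OF assms] Suc] by simp
qed

lemma coeff_restrict_line:
  assumes "homogeneous D p"
  shows "coeff (monom 1 i * restrict_line c w p) k = (\<Sum>m\<in>monoms D. lookup p m *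
    coeff (monom 1 i * monom_subst (\<lambda>v. [:w v, c v:]) m) k)"
proof -
  have "restrict_line c w p = (\<Sum>m\<in>monoms D. [:lookup p m:] * monom_subst (\<lambda>v. [:w v, c v:]) m)"
    unfolding restrict_line_def
    by (rule coeff_hom.subst_superset[OF coeff_hom_const_upoly finite_monoms])
       (use assms in \<open>auto simp: homogeneous_def monoms_def\<close>)
  then show ?thesis by (simp add: sum_distrib_left coeff_sum)
qed

lemma iter_no_common_factor_open:
  fixes F :: "'a::field triple"
  assumes F: "hom_triple d F" and d: "d \<ge> 1"
    and triv: "line_system_trivial c w (d ^ n) (iter_triple n F)"
  obtains Q e where "homogeneous e Q" "ev (coords F) Q \<noteq> 0"
    "\<And>G. hom_triple d G \<Longrightarrow> ev (coords G) Q \<noteq> 0 \<Longrightarrow> no_common_factor (iter_triple n G)"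
proof -
  obtain e where e: "\<And>i. coeff_form d e (\<lambda>F :: 'a triple. iter_triple n F i)"
    using coeff_form_iter by blast
  have R: "\<exists>Q. homogeneous e Q \<and> (\<forall>F :: 'a triple. hom_triple d F \<longrightarrow>
      coeff (monom 1 i * restrict_line c w (iter_triple n F j)) k = ev (coords F) Q)" for i j k
  proof -
    obtain Q where Q: "\<And>m. homogeneous e (Q m)"
      "\<And>m (F :: 'a triple). hom_triple d F \<Longrightarrow> lookup (iter_triple n F j) m = ev (coords F) (Q m)"
      using coeff_formE[OF e[of j]] by blast
    let ?K = "\<lambda>m. coeff (monom 1 i * monom_subst (\<lambda>v. [:w v, c v:]) m) k"
    have "homogeneous e (\<Sum>m\<in>monoms (d ^ n). const (?K m) * Q m)"
      by (intro homogeneous_sum homogeneous_const_mult Q)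
    moreover have "coeff (monom 1 i * restrict_line c w (iter_triple n F j)) k
        = ev (coords F) (\<Sum>m\<in>monoms (d ^ n). const (?K m) * Q m)" if "hom_triple d F" for F
      unfolding coeff_restrict_line[OF homogeneous_iter[OF that]] ev_sum
      by (intro sum.cong refl) (simp add: Q(2)[OF that])
    ultimately show ?thesis by blast
  qed
  have "\<exists>Q. homogeneous e Q \<and> (\<forall>F :: 'a triple. hom_triple d F \<longrightarrow>
      line_system c w (iter_triple n F) k x = ev (coords F) Q)" for k x
  proof (cases x)
    case (Inl i)
    then show ?thesis using R[of i 1 k] by (simp add: line_system_def)
  next
    case (Inr i)
    obtain Q where Q: "homogeneous e Q" "\<And>F :: 'a triple. hom_triple d F \<Longrightarrow>
      coeff (monom 1 i * restrict_line c w (iter_triple n F 2)) k = ev (coords F) Q"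
      using R[of i 2 k] by blast
    have "homogeneous e (const (- 1) * Q)" by (rule homogeneous_const_mult[OF Q(1)])
    then show ?thesis using Inr Q(2)
      by (intro exI[of _ "const (- 1) * Q"]) (simp add: line_system_def)
  qed
  then have "\<forall>k x. \<exists>Q. homogeneous e Q \<and> (\<forall>F :: 'a triple. hom_triple d F \<longrightarrow>
      line_system c w (iter_triple n F) k x = ev (coords F) Q)" by blast
  then obtain M where M: "\<And>k x. homogeneous e (M k x)"
    "\<And>k x (F :: 'a triple). hom_triple d F \<Longrightarrow> line_system c w (iter_triple n F) k x = ev (coords F) (M k x)"
    by metis
  have "finite (line_unknowns (d ^ n))" by (simp add: line_unknowns_def)
  moreover have "trivial_kernel (coords F) UNIV (line_unknowns (d ^ n)) M"
    using triv by (simp add: trivial_kernel_def line_system_trivial_def M(2)[OF F])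
  ultimately obtain Q e' where Q: "homogeneous e' Q" "ev (coords F) Q \<noteq> 0"
    "\<And>x. ev x Q \<noteq> 0 \<Longrightarrow> trivial_kernel x UNIV (line_unknowns (d ^ n)) M"
    using trivial_kernel_open[of "line_unknowns (d ^ n)" e M "coords F" UNIV] M(1) by blast
  show ?thesis
  proof (rule that[OF Q(1,2)])
    fix G assume G: "hom_triple d G" "ev (coords G) Q \<noteq> 0"
    have D: "d ^ n > 0" using d by simp
    show "no_common_factor (iter_triple n G)"
    proof (rule no_common_factor_if_line_system_trivial[OF homogeneous_iter[OF G(1)] D])
      show "line_system_trivial c w (d ^ n) (iter_triple n G)"
        using Q(3)[OF G(2)] by (simp add: trivial_kernel_def line_system_trivial_def M(2)[OF G(1)])
    qed
  qed
qed


section \<open>Density\<close>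

text \<open>For independent \<open>c\<close>, \<open>w\<close> and for \<open>s \<noteq> t\<close> this is \<open>F\<close> followed by a linear map of rank two onto the
  line through \<open>c\<close> and \<open>w\<close>.\<close>

definition project_to_line :: "(3 \<Rightarrow> 'a) \<Rightarrow> (3 \<Rightarrow> 'a) \<Rightarrow> 'a \<Rightarrow> 'a \<Rightarrow> 'a::field triple \<Rightarrow> 'a triple" where
  "project_to_line c w s t F = (\<lambda>i. const (c i) * conic_form s F + const (w i) * conic_form t F)"

text \<open>The general member of the net has finitely many zeros on the line, and another general member
  vanishes at none of them.\<close>

lemma projection_exists:
  fixes F :: "'a::field triple"
  assumes inf: "infinite (UNIV :: 'a set)" and hF: "hom_triple d F"
    and base: "\<And>\<alpha> \<beta>. (\<And>i. ev (\<lambda>v. \<alpha> * c v + \<beta> * w v) (F i) = 0) \<Longrightarrow> \<alpha> = 0 \<and> \<beta> = 0"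
  obtains s t where "\<And>\<alpha> \<beta>. ev (\<lambda>v. \<alpha> * c v + \<beta> * w v) (conic_form s F) = 0 \<Longrightarrow>
    ev (\<lambda>v. \<alpha> * c v + \<beta> * w v) (conic_form t F) = 0 \<Longrightarrow> \<alpha> = 0 \<and> \<beta> = 0"
proof -
  define z where "z u = (\<lambda>v. w v + u * c v)" for u
  have c: "(\<lambda>i. ev c (F i)) \<noteq> (\<lambda>i. 0)"
  proof
    assume *: "(\<lambda>i. ev c (F i)) = (\<lambda>i. 0)"
    show False using base[of 1 0] fun_cong[OF *] by simp
  qed
  have z: "(\<lambda>i. ev (z u) (F i)) \<noteq> (\<lambda>i. 0)" for u
  proof
    assume *: "(\<lambda>i. ev (z u) (F i)) = (\<lambda>i. 0)"
    show False using base[of u 1] fun_cong[OF *] by (simp add: z_def add.commute)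
  qed
  obtain s where s: "ev c (conic_form s F) \<noteq> 0"
    using ex_new_if_finite[OF inf finite_conic_zero[OF c]] by (auto simp: ev_conic_form)
  define p where "p = restrict_line c w (conic_form s F)"
  have "coeff p d \<noteq> 0"
    using restrict_line_top(2)[OF homogeneous_conic_form[OF hF]] s by (simp add: p_def)
  then have "p \<noteq> 0" by auto
  then have "finite {u. poly p u = 0}" by (rule poly_roots_finite)
  then have "finite (\<Union>u\<in>{u. poly p u = 0}. {t. ev (z u) (conic_form t F) = 0})"
    using finite_conic_zero[OF z] by (auto simp: ev_conic_form)
  then obtain t where t: "t \<notin> (\<Union>u\<in>{u. poly p u = 0}. {t. ev (z u) (conic_form t F) = 0})"
    using ex_new_if_finite[OF inf] by blast
  show ?thesis
  proof (rule that[of s t])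
    fix \<alpha> \<beta> assume zero: "ev (\<lambda>v. \<alpha> * c v + \<beta> * w v) (conic_form s F) = 0"
      "ev (\<lambda>v. \<alpha> * c v + \<beta> * w v) (conic_form t F) = 0"
    have hs: "homogeneous d (conic_form r F)" for r by (rule homogeneous_conic_form[OF hF])
    show "\<alpha> = 0 \<and> \<beta> = 0"
    proof (cases "\<beta> = 0")
      case True
      then have "\<alpha> ^ d * ev c (conic_form s F) = 0" using zero(1) by (simp add: ev_scale[OF hs])
      then show ?thesis using s True by simp
    next
      case False
      define u where "u = \<alpha> / \<beta>"
      have "(\<lambda>v. \<alpha> * c v + \<beta> * w v) = (\<lambda>v. \<beta> * z u v)"
        using False by (auto simp: z_def u_def field_simps)
      then have "\<beta> ^ d * ev (z u) (conic_form s F) = 0" "\<beta> ^ d * ev (z u) (conic_form t F) = 0"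
        using zero by (simp_all add: ev_scale[OF hs])
      then have "poly p u = 0" "ev (z u) (conic_form t F) = 0"
        using False by (simp_all add: p_def poly_restrict_line z_def)
      then show ?thesis using t by auto
    qed
  qed
qed

text \<open>When \<open>A\<close> has rank two and its image is a line that contains no base point of \<open>F\<close>, the map
  \<open>A F\<close> induces a morphism of degree \<open>d\<close> of this line to itself, provided that the kernel of \<open>A\<close> is not
  on the image of the line. So no iterate has a zero on the line.\<close>

lemma iter_on_line:
  fixes F :: "'a::field triple" and c w :: "3 \<Rightarrow> 'a" and s t :: 'a
  defines "A \<equiv> project_to_line c w s t F"
  assumes st: "\<And>\<alpha> \<beta>. ev (\<lambda>v. \<alpha> * c v + \<beta> * w v) (conic_form s F) = 0 \<Longrightarrow>
    ev (\<lambda>v. \<alpha> * c v + \<beta> * w v) (conic_form t F) = 0 \<Longrightarrow> \<alpha> = 0 \<and> \<beta> = 0"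
    and "\<alpha> \<noteq> 0 \<or> \<beta> \<noteq> 0"
  shows "\<exists>\<alpha>' \<beta>'. (\<alpha>' \<noteq> 0 \<or> \<beta>' \<noteq> 0) \<and>
    (\<forall>i. ev (\<lambda>v. \<alpha> * c v + \<beta> * w v) (iter_triple n A i) = \<alpha>' * c i + \<beta>' * w i)"
proof (induction n)
  case 0
  then show ?case using assms(3) by auto
next
  case (Suc n)
  let ?x = "\<lambda>v. \<alpha> * c v + \<beta> * w v"
  obtain \<alpha>' \<beta>' where *: "\<alpha>' \<noteq> 0 \<or> \<beta>' \<noteq> 0" "\<And>i. ev ?x (iter_triple n A i) = \<alpha>' * c i + \<beta>' * w i"
    using Suc by blast
  let ?y = "\<lambda>v. \<alpha>' * c v + \<beta>' * w v"
  have "ev ?x (iter_triple (Suc n) A i) = ev ?y (conic_form s F) * c i + ev ?y (conic_form t F) * w i" for i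
    by (simp add: iter_triple_Suc comp_triple_def ev_psubst *(2))
       (simp add: A_def project_to_line_def mult.commute)
  moreover have "ev ?y (conic_form s F) \<noteq> 0 \<or> ev ?y (conic_form t F) \<noteq> 0"
    using st[of \<alpha>' \<beta>'] *(1) by blast
  ultimately show ?case by blast
qed

definition linear_triple :: "'a::field ^ 3 ^ 3 \<Rightarrow> 'a triple" where
  "linear_triple A = (\<lambda>i. \<Sum>j\<in>UNIV. const (A $ i $ j) * var j)"

lemma comp_linear_triple: "comp_triple (linear_triple A) F i = (\<Sum>j\<in>UNIV. const (A $ i $ j) * F j)"
  by (simp add: comp_triple_def linear_triple_def psubst_sum)

lemma linear_triple_mult: "comp_triple (linear_triple A) (linear_triple B) = linear_triple (A ** B)"
proof
  fix i
  have "comp_triple (linear_triple A) (linear_triple B) i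
      = (\<Sum>j\<in>UNIV. \<Sum>k\<in>UNIV. const (A $ i $ j * B $ j $ k) * var k)"
    by (simp add: comp_linear_triple) (simp add: linear_triple_def sum_distrib_left const_mult mult.assoc)
  also have "\<dots> = (\<Sum>k\<in>UNIV. \<Sum>j\<in>UNIV. const (A $ i $ j * B $ j $ k) * var k)"
    by (rule sum.swap)
  also have "\<dots> = linear_triple (A ** B) i"
    by (simp add: linear_triple_def matrix_matrix_mult_def sum_distrib_right ring_hom_sum[OF coeff_hom_const])
  finally show "comp_triple (linear_triple A) (linear_triple B) i = linear_triple (A ** B) i" .
qed

lemma linear_triple_one: "linear_triple (mat 1) = var"
proof
  fix i
  have "linear_triple (mat 1) i = (\<Sum>j\<in>UNIV. if j = i then var i else 0)"
    unfolding linear_triple_def mat_def by (intro sum.cong refl) (auto simp: const_1)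
  then show "linear_triple (mat 1) i = var i" by simp
qed

lemma linear_triple_invertible:
  assumes "A ** B = mat 1" "B ** A = mat 1"
  shows "hom_triple 1 (linear_triple A)" "dominant (linear_triple A)"
proof -
  have AB: "comp_triple (linear_triple A) (linear_triple B) = var"
    by (simp add: linear_triple_mult assms linear_triple_one)
  have "linear_triple A \<noteq> (\<lambda>i. 0)"
  proof
    assume "linear_triple A = (\<lambda>i. 0)"
    then have "comp_triple (linear_triple A) (linear_triple B) 1 = 0" by (simp add: comp_triple_def)
    then show False using AB by simp
  qed
  moreover have "homogeneous 1 (linear_triple A i)" for i
    unfolding linear_triple_def by (intro homogeneous_sum homogeneous_const_mult homogeneous_var)
  ultimately show "hom_triple 1 (linear_triple A)" by (simp add: hom_triple_def)
  have "(var :: 'a triple) \<noteq> (\<lambda>i. 0)" using hom_triple_nonzero[OF hom_triple_var] .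
  then show "dominant (linear_triple A)"
    using dominant_if_right_inverse[of "linear_triple A" "linear_triple B"] AB by simp
qed

lemma linear_comp_Bir:
  fixes F :: "'a::alg_closed_field triple"
  assumes F: "hom_triple d F" "no_common_factor F" "birational F" and A: "invertible A"
  shows "hom_triple d (comp_triple (linear_triple A) F)" "proj_pt (comp_triple (linear_triple A) F) \<in> Bir d"
proof -
  obtain B where AB: "A ** B = mat 1" "B ** A = mat 1" using A by (auto simp: invertible_def)
  obtain G e where "birational_pair F G d e" using birational_pair_if_birational F by blast
  then interpret birational_pair F G d e .
  let ?A = "linear_triple A" and ?B = "linear_triple B"
  let ?H = "comp_triple ?A F" and ?K = "comp_triple G ?B"
  note lA = linear_triple_invertible[OF AB] and lB = linear_triple_invertible[OF AB(2,1)]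
  have AB_var: "comp_triple ?A ?B = var" "comp_triple ?B ?A = var"
    by (simp_all add: linear_triple_mult AB linear_triple_one)
  show H: "hom_triple d ?H" using hom_triple_comp[OF lA(1) F(1) dominant_F] by simp
  have domH: "dominant ?H" by (rule dominant_comp[OF lA(2) dominant_F lA(1)])
  have K: "hom_triple e ?K" using hom_triple_comp[OF hom_G lB] by simp
  have domK: "dominant ?K" by (rule dominant_comp[OF dominant_G lB(2) hom_G])
  have KH: "comp_triple ?K ?H = comp_triple G F"
    using AB_var(2) comp_triple_assoc[of ?B ?A F] by (simp add: comp_triple_assoc)
  have FG': "hom_triple (d * e) (comp_triple F G)" by (rule hom_triple_comp[OF F(1) hom_G dominant_G])
  have FGB: "hom_triple (d * e * 1) (comp_triple (comp_triple F G) ?B)"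
    by (rule hom_triple_comp[OF FG' lB])
  have "same_map (comp_triple (comp_triple F G) ?B) ?B"
    using same_map_comp_left[OF FG, of ?B] by simp
  then have "same_map (comp_triple ?A (comp_triple (comp_triple F G) ?B)) (comp_triple ?A ?B)"
    by (rule same_map_comp_right[OF FGB lB(1) lA(1)])
  then have HK: "same_map (comp_triple ?H ?K) var"
    by (simp add: comp_triple_assoc AB_var)
  have "birational ?H"
    unfolding birational_def
  proof (intro exI conjI)
    show "hom_triple e ?K" by fact
    show "comp_triple ?H ?K \<noteq> (\<lambda>i. 0)"
      by (rule hom_triple_nonzero[OF hom_triple_comp[OF H K domK]])
    show "same_map (comp_triple ?H ?K) var" by fact
    show "comp_triple ?K ?H \<noteq> (\<lambda>i. 0)"
      by (rule hom_triple_nonzero[OF hom_triple_comp[OF K H domH]])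
    show "same_map (comp_triple ?K ?H) var" unfolding KH by (rule GF)
  qed
  moreover have "no_common_factor ?H"
    unfolding no_common_factor_def
  proof (intro allI impI)
    fix h assume h: "\<forall>i. h dvd ?H i"
    have "comp_triple ?B ?H = F" using AB_var(2) by (simp flip: comp_triple_assoc)
    then have "F i = (\<Sum>j\<in>UNIV. const (B $ i $ j) * ?H j)" for i
      using comp_linear_triple[of B ?H i] by simp
    then have "h dvd F i" for i using h by (simp add: dvd_sum)
    then show "h dvd 1" using F(2) by (simp add: no_common_factor_def)
  qed
  ultimately show "proj_pt ?H \<in> Bir d" using H by (auto simp: Bir_def)
qed

lemma ev_pencil_poly:
  fixes Q :: "('v, 'a::field) mpoly"
  obtains q where "\<And>s :: 'a. poly q s = ev (\<lambda>v. (1 - s) * a v + s * b v) Q"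
proof
  fix s :: 'a
  have "coeff_hom (\<lambda>p. poly p s)" by unfold_locales simp_all
  then show "poly (subst (\<lambda>c. [:c:]) (\<lambda>v. [:a v, b v - a v:]) Q) s = ev (\<lambda>v. (1 - s) * a v + s * b v) Q"
    by (subst ring_hom_subst[of "\<lambda>p. poly p s"]) (simp_all add: algebra_simps)
qed

text \<open>Along the pencil \<open>(1 - s) I + s A\<close> of matrices, one condition holds at \<open>s = 0\<close>, where the map
  is \<open>F\<close>, and the other at \<open>s = 1\<close>; being open they hold together for some \<open>s\<close>.\<close>

lemma exists_stable_nearby:
  fixes F :: "'a::alg_closed_field triple"
  assumes F: "hom_triple d F" "no_common_factor F" "birational F" and d: "d \<ge> 1"
    and Q: "ev (coords F) Q \<noteq> 0"
  obtains G where "hom_triple d G" "proj_pt G \<in> Bir d" "ev (coords G) Q \<noteq> 0"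
    "no_common_factor (iter_triple n G)"
proof -
  note inf = infinite_alg_closed[where 'a = 'a]
  have "reduced d F" using F by (simp add: reduced_def)
  then obtain c w where cw: "c 1 = 1" "w 1 = 0" "w 2 = 1"
    "\<And>\<alpha> \<beta>. (\<And>i. ev (\<lambda>v. \<alpha> * c v + \<beta> * w v) (F i) = 0) \<Longrightarrow> \<alpha> = 0 \<and> \<beta> = 0"
    using line_without_base_points[OF inf] by blast
  obtain s0 t0 where st: "\<And>\<alpha> \<beta>. ev (\<lambda>v. \<alpha> * c v + \<beta> * w v) (conic_form s0 F) = 0 \<Longrightarrow>
    ev (\<lambda>v. \<alpha> * c v + \<beta> * w v) (conic_form t0 F) = 0 \<Longrightarrow> \<alpha> = 0 \<and> \<beta> = 0"
    using projection_exists[OF inf F(1) cw(4)] by blast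
  define A where "A = project_to_line c w s0 t0 F"
  have homA: "homogeneous d (A i)" for i
    unfolding A_def project_to_line_def
    by (intro homogeneous_add homogeneous_const_mult homogeneous_conic_form F)
  have on_line: "\<exists>\<alpha>' \<beta>'. (\<alpha>' \<noteq> 0 \<or> \<beta>' \<noteq> 0) \<and>
      (\<forall>i. ev (\<lambda>v. \<alpha> * c v + \<beta> * w v) (iter_triple m A i) = \<alpha>' * c i + \<beta>' * w i)"
    if "\<alpha> \<noteq> 0 \<or> \<beta> \<noteq> 0" for \<alpha> \<beta> m
    unfolding A_def by (rule iter_on_line[OF st that])
  \<comment> \<open>The first two coordinates \<open>\<alpha>\<close> and \<open>\<alpha> * c 2 + \<beta>\<close> determine a point of the line.\<close>
  have nz: "ev (\<lambda>v. \<alpha> * c v + \<beta> * w v) (iter_triple m A 1) \<noteq> 0 \<or>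
      ev (\<lambda>v. \<alpha> * c v + \<beta> * w v) (iter_triple m A 2) \<noteq> 0" if ab: "\<alpha> \<noteq> 0 \<or> \<beta> \<noteq> 0" for \<alpha> \<beta> m
  proof -
    obtain \<alpha>' \<beta>' where *: "\<alpha>' \<noteq> 0 \<or> \<beta>' \<noteq> 0"
      "\<And>i. ev (\<lambda>v. \<alpha> * c v + \<beta> * w v) (iter_triple m A i) = \<alpha>' * c i + \<beta>' * w i"
      using on_line[OF ab, of m] by blast
    show ?thesis using *(1) unfolding *(2) cw(1-3) by (cases "\<alpha>' = 0") simp_all
  qed
  have "A \<noteq> (\<lambda>i. 0)" using nz[of 1 0 1] by auto
  then have A: "hom_triple d A" using homA by (simp add: hom_triple_def)
  have triv: "line_system_trivial c w (d ^ n) (iter_triple n A)"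
  proof (rule line_system_trivialI[OF homogeneous_iter[OF A]])
    show "ev c (iter_triple n A 1) \<noteq> 0 \<or> ev c (iter_triple n A 2) \<noteq> 0"
      using nz[of 1 0 n] by simp
    show "ev (\<lambda>v. w v + u * c v) (iter_triple n A 1) \<noteq> 0 \<or> ev (\<lambda>v. w v + u * c v) (iter_triple n A 2) \<noteq> 0" for u
      using nz[of u 1 n] by (simp add: add.commute)
  qed
  obtain Q2 e where Q2: "homogeneous e Q2" "ev (coords A) Q2 \<noteq> 0"
    "\<And>G. hom_triple d G \<Longrightarrow> ev (coords G) Q2 \<noteq> 0 \<Longrightarrow> no_common_factor (iter_triple n G)"
    using iter_no_common_factor_open[OF A d triv] by blast
  \<comment> \<open>The rows of coefficients of the members of the net, and the matrix of the projection.\<close>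
  define v where "v r j = (if j = 1 then 1 else if j = 2 then r else r ^ 2)" for r :: 'a and j :: 3
  define B :: "'a ^ 3 ^ 3" where "B = (\<chi> i j. c i * v s0 j + w i * v t0 j)"
  define L :: "'a \<Rightarrow> 'a ^ 3 ^ 3" where
    "L s = (\<chi> i j. (1 - s) * (if i = j then 1 else 0) + s * B $ i $ j)" for s
  define G where "G s = comp_triple (linear_triple (L s)) F" for s
  have conic: "conic_form r F = (\<Sum>j\<in>UNIV. const (v r j) * F j)" for r
    unfolding sum_3 by (simp add: conic_form_def v_def const_1)
  have L_const: "const (L s $ i $ j) = const (1 - s) * (if i = j then 1 else 0) +
      const s * (const (c i) * const (v s0 j) + const (w i) * const (v t0 j))" for s i j
    by (cases "i = j") (simp_all add: L_def B_def const_add const_mult const_1)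
  have "G s i = const (1 - s) * F i + const s * A i" for s i
  proof -
    have "G s i = (\<Sum>j\<in>UNIV. const (1 - s) * (if j = i then F i else 0)
        + const s * (const (c i) * (const (v s0 j) * F j) + const (w i) * (const (v t0 j) * F j)))"
      unfolding G_def comp_linear_triple
      by (intro sum.cong refl) (auto simp: L_const algebra_simps)
    also have "\<dots> = const (1 - s) * F i + const s * (const (c i) * conic_form s0 F + const (w i) * conic_form t0 F)"
      unfolding conic by (simp add: sum.distrib flip: sum_distrib_left)
    finally show ?thesis by (simp add: A_def project_to_line_def)
  qed
  then have coords: "coords (G s) = (\<lambda>v. (1 - s) * coords F v + s * coords A v)" for s
    by (auto simp: coords_def lookup_add const_mult_lookup)
  obtain q1 where q1: "\<And>s. poly q1 s = ev (coords (G s)) Q"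
    unfolding coords using ev_pencil_poly[of "coords F" "coords A" Q] by blast
  obtain q2 where q2: "\<And>s. poly q2 s = ev (coords (G s)) Q2"
    unfolding coords using ev_pencil_poly[of "coords F" "coords A" Q2] by blast
  define q3 where "q3 = det (\<chi> i j. [:if i = j then 1 else 0, B $ i $ j - (if i = j then 1 else 0):] :: 'a poly ^ 3 ^ 3)"
  have q3: "poly q3 s = det (L s)" for s
    unfolding q3_def det_3 by (simp add: L_def algebra_simps)
  have "L 0 = mat 1" by (simp add: L_def mat_def vec_eq_iff)
  then have "poly q3 0 \<noteq> 0" by (simp add: q3)
  moreover have "poly q1 0 \<noteq> 0" using Q by (simp add: q1 coords)
  moreover have "poly q2 1 \<noteq> 0" using Q2(2) by (simp add: q2 coords)
  ultimately have "q1 * q2 * q3 \<noteq> 0" by auto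
  from ex_new_if_finite[OF inf poly_roots_finite[OF this]]
  obtain s where s: "poly (q1 * q2 * q3) s \<noteq> 0" by blast
  then have "invertible (L s)" by (simp add: invertible_det_nz q3)
  then have Bir: "hom_triple d (G s)" "proj_pt (G s) \<in> Bir d"
    unfolding G_def by (rule linear_comp_Bir[OF F])+
  show ?thesis
  proof (rule that[OF Bir])
    show "ev (coords (G s)) Q \<noteq> 0" using s q1 by auto
    show "no_common_factor (iter_triple n (G s))" using s q2 by (intro Q2(3) Bir) auto
  qed
qed

text \<open>A basic neighbourhood of \<open>F\<close> contains a map with an iterate of maximal degree \<open>d ^ 2 ^ j\<close>, for \<open>j\<close> so
  large that this exceeds the threshold that certifies \<open>\<lambda>\<^sub>1 > l\<close>.\<close>

lemma lambda1_gt_dense: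
  fixes d :: nat
  assumes d: "d \<ge> 1" and l: "l < real d" "1 \<le> l"
  shows "Bir_top d closure_of {f \<in> (Bir d :: 'a::alg_closed_field triple set set). lambda1 f > l} = Bir d"
proof (intro equalityI subsetI)
  fix f assume "f \<in> Bir_top d closure_of {f \<in> (Bir d :: 'a triple set set). lambda1 f > l}"
  then have "f \<in> topspace (Bir_top d)" by (rule subsetD[OF closure_of_subset_topspace])
  then show "f \<in> Bir d" by (simp only: topspace_Bir_top)
next
  fix f assume f: "f \<in> (Bir d :: 'a triple set set)"
  obtain F where F: "f = proj_pt F" "hom_triple d F" "no_common_factor F" "birational F"
    using BirE[OF f] .
  show "f \<in> Bir_top d closure_of {f \<in> (Bir d :: 'a triple set set). lambda1 f > l}"
    unfolding in_closure_of topspace_Bir_top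
  proof (intro conjI allI impI f)
    fix T assume T: "f \<in> T \<and> openin (Bir_top d) T"
    then obtain U where U: "openin (zariski d) U" "T = U \<inter> Bir d"
      by (auto simp: Bir_top_def openin_subtopology)
    then obtain S where S: "\<forall>Q\<in>S. \<exists>e. homogeneous e Q" "proj_triples d - U = zero_locus d S"
      unfolding openin_zariski by (auto elim: zariski_closedE)
    have in_proj: "proj_pt G \<in> proj_triples d" if "hom_triple d G" for G :: "'a triple"
      using that by (auto simp: proj_triples_def)
    have "f \<in> U" using T U(2) by simp
    then have "f \<notin> zero_locus d S" using S(2) by blast
    then obtain Q where Q: "Q \<in> S" "\<not> vanishes_at Q f"
      using in_proj[OF F(2)] by (auto simp: zero_locus_def F(1))
    obtain e where e: "homogeneous e Q" using S(1) Q(1) by blast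
    have QF: "ev (coords F) Q \<noteq> 0" using Q(2) by (simp add: F(1) vanishes_at_proj_pt[OF e])
    obtain j :: nat where j: "4096 ^ j * l ^ (2 ^ j) * real d < real d ^ (2 ^ j)"
      using doubly_exponential_beats[of l "real d" 4096 "real d"] l d by auto
    obtain G where G: "hom_triple d G" "proj_pt G \<in> Bir d" "ev (coords G) Q \<noteq> 0"
      "no_common_factor (iter_triple (2 ^ j) G)"
      using exists_stable_nearby[OF F(2,3,4) d QF] .
    obtain G' k where "birational_pair G G' d k" using proj_pt_BirD[OF G(1,2)] .
    then interpret birational_pair G G' d k .
    have "map_degree (iter_triple (2 ^ j) G) = d ^ (2 ^ j)"
      using iter_F(1) G(4) by (intro map_degree_reduced) (simp add: reduced_def)
    then have "dyn_degree G > l" using j by (intro dyn_degree_gt[OF l(2), of j]) simp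
    then have "lambda1 (proj_pt G) > l" by (simp add: lambda1_proj_pt[OF G(1)])
    moreover have "proj_pt G \<in> U"
    proof (rule ccontr)
      assume "proj_pt G \<notin> U"
      then have "proj_pt G \<in> zero_locus d S" using S(2) in_proj[OF G(1)] by blast
      then have "vanishes_at Q (proj_pt G)" using Q(1) by (simp add: zero_locus_def)
      then show False using G(3) by (simp add: vanishes_at_proj_pt[OF e])
    qed
    ultimately show "\<exists>y. y \<in> {f \<in> Bir d. lambda1 f > l} \<and> y \<in> T" using G(2) U(2) by blast
  qed
qed

theorem theorem1p6:
  fixes d :: nat
  assumes "d \<ge> 2"
  shows "(\<forall>l::real. l < real d \<longrightarrow>
            openin (Bir_top d) {f \<in> (Bir d :: 'a::alg_closed_field triple set set). lambda1 f > l}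
          \<and> Bir_top d closure_of {f \<in> (Bir d :: 'a triple set set). lambda1 f > l} = Bir d)
       \<and> (\<exists>V :: 'a triple set set. openin (Bir_top d) V
            \<and> Bir_top d closure_of V = Bir d
            \<and> (\<forall>f\<in>V. lambda1 f > 1))"
proof -
  let ?U = "\<lambda>l. {f \<in> (Bir d :: 'a triple set set). lambda1 f > l}"
  have d: "d \<ge> 1" using assms by simp
  have opn: "openin (Bir_top d) (?U l)" for l by (rule lambda1_gt_open[OF d])
  have dense: "Bir_top d closure_of ?U l = Bir d" if "l < real d" for l
  proof -
    have "Bir_top d closure_of ?U (max l 1) = Bir d"
      using that assms by (intro lambda1_gt_dense[OF d]) auto
    moreover have "Bir_top d closure_of ?U (max l 1) \<subseteq> Bir_top d closure_of ?U l"
      by (rule closure_of_mono) auto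
    ultimately show ?thesis
      using closure_of_subset_topspace[of "Bir_top d" "?U l"] by (simp add: topspace_Bir_top subset_antisym)
  qed
  have "openin (Bir_top d) (?U 1) \<and> Bir_top d closure_of ?U 1 = Bir d \<and> (\<forall>f\<in>?U 1. lambda1 f > 1)"
    using opn[of 1] dense[of 1] assms by simp
  then show ?thesis using opn dense by blast
qed

end
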